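(* Let $n\geq 3$ be odd and let $q\in\mathbb{K}^*$ be not a root of unity. The quantum cluster algebra $\mathcal{A}_{n-1}^q$ of the Dynkin quiver of type $A_{n-1}$ is a simple (right and left) noetherian ring.
   Context: $\mathbb{K}$ is an algebraically closed field, $\mathbb{K}^*=\mathbb{K}\setminus\{0\}$, $q^{1/2}$ is a fixed square root of $q$. Quantum cluster algebras (no frozen variables, over $\mathbb{K}$). Let $B=(b_{ij})$ and $\Lambda=(\lambda_{ij})$ be skew-symmetric $N\times N$ integer matrices with $B^T\Lambda=dI$ for some positive integer $d$. Let $T$ be the quantum torus generated by $X_1^{\pm1},\dots,X_N^{\pm1}$ with $X_iX_j=q^{\lambda_{ij}}X_jX_i$, and $D$ its division ring of fractions. For $c\in\mathbb{Z}^N$ put $M(c)=q^{-\frac12\sum_{i<j}c_ic_j\lambda_{ij}}X_1^{c_1}\cdots X_N^{c_N}$. Let $e_1,\dots,e_N$ be the standard basis and $[a]_+=\max(a,0)$. The mutation of the quantum seed $((X_1,\dots,X_N),B,\Lambda)$ in direction $k$ replaces $X_k$ by $X_k'=M\big(-e_k+\sum_i[b_{ik}]_+e_i\big)+M\big(-e_k+\sum_i[-b_{ik}]_+e_i\big)\in D$, leaves the other $X_i$ unchanged, replaces $B$ by the usual matrix mutation $\mu_k(B)$ and $\Lambda$ by $\Lambda'=E^T\Lambda E$, where $E$ agrees with the identity matrix outside column $k$, $E_{kk}=-1$ and $E_{ik}=[-b_{ik}]_+$ for $i\neq k$ (so that the new cluster quasi-commutes according to $\Lambda'$). The quantum cluster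 algebra is the $\mathbb{K}$-subalgebra of $D$ generated by all elements of all clusters obtained from the initial seed by finite sequences of mutations. $\mathcal{A}_{n-1}^q$ is the quantum cluster algebra with $N=n-1$ whose initial seed has cluster $(y_1,\dots,y_{n-1})$, exchange matrix $B$ the skew-symmetric adjacency matrix of the quiver $1\rightarrow2\rightarrow\cdots\rightarrow n-1$ (so for $i\leq j$, $b_{ij}=1$ if $j=i+1$ and $b_{ij}=0$ otherwise), and $\Lambda$ the inverse of $B^T$, i.e. the skew-symmetric matrix with, for $i<j$, $\lambda_{ij}=1$ if $j$ is even and $i$ is odd and $\lambda_{ij}=0$ otherwise; thus $y_iy_j=q^{\lambda_{ij}}y_jy_i$. *)

theory Defs
  imports "HOL-Algebra.Generated_Rings" "HOL-Library.Poly_Mapping" "HOL-Computational_Algebra.Polynomial"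
begin

section \<open>Ring-theoretic notions for noncommutative rings\<close>

text \<open>The locale \<open>noetherian_ring\<close> of HOL-Algebra only speaks about two-sided ideals, so the
  one-sided notions are introduced here, in the same finitely-generated form.\<close>

definition left_ideal :: "'a set \<Rightarrow> ('a, 'm) ring_scheme \<Rightarrow> bool" where
  "left_ideal I R \<longleftrightarrow> additive_subgroup I R \<and> (\<forall>x\<in>carrier R. \<forall>a\<in>I. x \<otimes>\<^bsub>R\<^esub> a \<in> I)"

definition right_ideal :: "'a set \<Rightarrow> ('a, 'm) ring_scheme \<Rightarrow> bool" where
  "right_ideal I R \<longleftrightarrow> additive_subgroup I R \<and> (\<forall>x\<in>carrier R. \<forall>a\<in>I. a \<otimes>\<^bsub>R\<^esub> x \<in> I)"

definition left_noetherian :: "('a, 'm) ring_scheme \<Rightarrow> bool" where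
  "left_noetherian R \<longleftrightarrow> ring R \<and>
     (\<forall>I. left_ideal I R \<longrightarrow>
        (\<exists>A \<subseteq> carrier R. finite A \<and> I = \<Inter> {J. left_ideal J R \<and> A \<subseteq> J}))"

definition right_noetherian :: "('a, 'm) ring_scheme \<Rightarrow> bool" where
  "right_noetherian R \<longleftrightarrow> ring R \<and>
     (\<forall>I. right_ideal I R \<longrightarrow>
        (\<exists>A \<subseteq> carrier R. finite A \<and> I = \<Inter> {J. right_ideal J R \<and> A \<subseteq> J}))"

definition simple_ring :: "('a, 'm) ring_scheme \<Rightarrow> bool" where
  "simple_ring R \<longleftrightarrow> ring R \<and> \<one>\<^bsub>R\<^esub> \<noteq> \<zero>\<^bsub>R\<^esub> \<and>
     (\<forall>I. ideal I R \<longrightarrow> I = {\<zero>\<^bsub>R\<^esub>} \<or> I = carrier R)"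

definition is_division_ring :: "('a, 'm) ring_scheme \<Rightarrow> bool" where
  "is_division_ring D \<longleftrightarrow> ring D \<and> \<one>\<^bsub>D\<^esub> \<noteq> \<zero>\<^bsub>D\<^esub> \<and> Units D = carrier D - {\<zero>\<^bsub>D\<^esub>}"

text \<open>\<open>D\<close>, together with the embedding \<open>\<iota>\<close>, is a division ring of (right) fractions of \<open>T\<close>.
  This determines \<open>D\<close> up to a unique isomorphism over \<open>T\<close>; if \<open>T\<close> is an Ore domain on both
  sides (as every quantum torus is), the left fractions give the same division ring.\<close>

definition division_ring_of_fractions ::
  "('t, 'm) ring_scheme \<Rightarrow> ('d, 'l) ring_scheme \<Rightarrow> ('t \<Rightarrow> 'd) \<Rightarrow> bool" where
  "division_ring_of_fractions T D \<iota> \<longleftrightarrow>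
     is_division_ring D \<and> \<iota> \<in> ring_hom T D \<and> inj_on \<iota> (carrier T) \<and>
     carrier D = {\<iota> a \<otimes>\<^bsub>D\<^esub> inv\<^bsub>D\<^esub> (\<iota> b) | a b.
                    a \<in> carrier T \<and> b \<in> carrier T \<and> b \<noteq> \<zero>\<^bsub>T\<^esub>}"


section \<open>The quantum torus\<close>

text \<open>Matrices and exponent vectors are indexed by \<open>1, \<dots>, N\<close>; values of a matrix outside this
  range are never used. The torus is realised on its basis of ordered monomials:
  the exponent vector \<open>a\<close> stands for \<open>X\<^sub>1^a\<^sub>1 \<cdots> X\<^sub>N^a\<^sub>N\<close>. Moving the factors \<open>X\<^sub>i^b\<^sub>i\<close> of the second
  monomial to the left past the factors \<open>X\<^sub>l^a\<^sub>l\<close>, \<open>l > i\<close>, of the first one with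
  \<open>X\<^sub>l X\<^sub>i = q^(\<Lambda> l i) X\<^sub>i X\<^sub>l\<close> gives \<open>X^a X^b = q^(torus_twist N \<Lambda> a b) X^(a + b)\<close>.\<close>

type_synonym int_matrix = "nat \<Rightarrow> nat \<Rightarrow> int"

definition torus_twist :: "nat \<Rightarrow> int_matrix \<Rightarrow> (nat \<Rightarrow>\<^sub>0 int) \<Rightarrow> (nat \<Rightarrow>\<^sub>0 int) \<Rightarrow> int" where
  "torus_twist N \<Lambda> a b =
     (\<Sum>i\<in>{1..N}. \<Sum>l\<in>{i<..N}. \<Lambda> l i * Poly_Mapping.lookup a l * Poly_Mapping.lookup b i)"

definition torus_mult :: "nat \<Rightarrow> 'k::field \<Rightarrow> int_matrix \<Rightarrow>
    ((nat \<Rightarrow>\<^sub>0 int) \<Rightarrow>\<^sub>0 'k) \<Rightarrow> ((nat \<Rightarrow>\<^sub>0 int) \<Rightarrow>\<^sub>0 'k) \<Rightarrow> ((nat \<Rightarrow>\<^sub>0 int) \<Rightarrow>\<^sub>0 'k)" where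
  "torus_mult N q \<Lambda> f g =
     (\<Sum>a\<in>Poly_Mapping.keys f. \<Sum>b\<in>Poly_Mapping.keys g.
        Poly_Mapping.single (a + b)
          (Poly_Mapping.lookup f a * Poly_Mapping.lookup g b * q powi torus_twist N \<Lambda> a b))"

definition quantum_torus ::
    "nat \<Rightarrow> 'k::field \<Rightarrow> int_matrix \<Rightarrow> ((nat \<Rightarrow>\<^sub>0 int) \<Rightarrow>\<^sub>0 'k) ring" where
  "quantum_torus N q \<Lambda> =
     \<lparr>carrier = {f. \<forall>a\<in>Poly_Mapping.keys f. Poly_Mapping.keys a \<subseteq> {1..N}},
      monoid.mult = torus_mult N q \<Lambda>, one = Poly_Mapping.single 0 1, ring.zero = 0, ring.add = (+)\<rparr>"

definition torus_scalar :: "'k::field \<Rightarrow> ((nat \<Rightarrow>\<^sub>0 int) \<Rightarrow>\<^sub>0 'k)" where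
  "torus_scalar c = Poly_Mapping.single 0 c"

definition torus_gen :: "nat \<Rightarrow> ((nat \<Rightarrow>\<^sub>0 int) \<Rightarrow>\<^sub>0 'k::field)" where
  "torus_gen i = Poly_Mapping.single (Poly_Mapping.single i 1) 1"

lemma torus_mult_superset:
  assumes "finite A" "finite B" "Poly_Mapping.keys f \<subseteq> A" "Poly_Mapping.keys g \<subseteq> B"
  shows "torus_mult N q \<Lambda> f g = (\<Sum>a\<in>A. \<Sum>b\<in>B. Poly_Mapping.single (a + b)
          (Poly_Mapping.lookup f a * Poly_Mapping.lookup g b * q powi torus_twist N \<Lambda> a b))"
proof -
  let ?h = "\<lambda>a b. Poly_Mapping.single (a + b)
          (Poly_Mapping.lookup f a * Poly_Mapping.lookup g b * q powi torus_twist N \<Lambda> a b)"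
  have "(\<Sum>b\<in>Poly_Mapping.keys g. ?h a b) = (\<Sum>b\<in>B. ?h a b)" for a
    by (rule sum.mono_neutral_left) (use assms in \<open>auto simp: in_keys_iff\<close>)
  moreover have "(\<Sum>a\<in>Poly_Mapping.keys f. \<Sum>b\<in>B. ?h a b) = (\<Sum>a\<in>A. \<Sum>b\<in>B. ?h a b)"
    by (rule sum.mono_neutral_left) (use assms in \<open>auto simp: in_keys_iff\<close>)
  ultimately show ?thesis by (simp add: torus_mult_def)
qed

lemma torus_mult_single:
  "torus_mult N q \<Lambda> (Poly_Mapping.single a x) (Poly_Mapping.single b y) =
     Poly_Mapping.single (a + b) (x * y * q powi torus_twist N \<Lambda> a b)"
  by (subst torus_mult_superset[of "{a}" "{b}"]) (auto simp: lookup_single)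

lemma torus_mult_add_left:
  "torus_mult N q \<Lambda> (f + f') g = torus_mult N q \<Lambda> f g + torus_mult N q \<Lambda> f' g"
proof -
  let ?A = "Poly_Mapping.keys f \<union> Poly_Mapping.keys f'" and ?B = "Poly_Mapping.keys g"
  have k: "Poly_Mapping.keys (f + f') \<subseteq> ?A" by (rule Poly_Mapping.keys_add)
  show ?thesis
    by (simp add: torus_mult_superset[OF _ _ k, of ?B] torus_mult_superset[of ?A ?B f g]
        torus_mult_superset[of ?A ?B f' g] lookup_add single_add distrib_right sum.distrib)
qed

lemma torus_mult_add_right:
  "torus_mult N q \<Lambda> f (g + g') = torus_mult N q \<Lambda> f g + torus_mult N q \<Lambda> f g'"
proof -
  let ?A = "Poly_Mapping.keys f" and ?B = "Poly_Mapping.keys g \<union> Poly_Mapping.keys g'"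
  have k: "Poly_Mapping.keys (g + g') \<subseteq> ?B" by (rule Poly_Mapping.keys_add)
  show ?thesis
    by (simp add: torus_mult_superset[OF _ _ _ k, of ?A] torus_mult_superset[of ?A ?B f g]
        torus_mult_superset[of ?A ?B f g'] lookup_add single_add distrib_right distrib_left
        sum.distrib)
qed

lemma torus_mult_zero [simp]: "torus_mult N q \<Lambda> 0 g = 0" "torus_mult N q \<Lambda> f 0 = 0"
  by (simp_all add: torus_mult_def)

lemma poly_mapping_add_induct [case_names zero single add]:
  fixes f :: "'a \<Rightarrow>\<^sub>0 'b::ab_group_add"
  assumes "P 0" "\<And>a x. P (Poly_Mapping.single a x)" "\<And>f g. P f \<Longrightarrow> P g \<Longrightarrow> P (f + g)"
  shows "P f"
proof (induction f rule: update_induct)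
  case const
  show ?case by (rule assms(1))
next
  case (update f a b)
  have "Poly_Mapping.update a b f = f + Poly_Mapping.single a b"
    using update by (intro poly_mapping_eqI)
      (auto simp: lookup_update lookup_add lookup_single when_def in_keys_iff)
  then show ?case using assms(2,3) update by simp
qed

lemma torus_twist_add_left: "torus_twist N \<Lambda> (a + b) c = torus_twist N \<Lambda> a c + torus_twist N \<Lambda> b c"
  by (simp add: torus_twist_def lookup_add algebra_simps sum.distrib)

lemma torus_twist_add_right: "torus_twist N \<Lambda> a (b + c) = torus_twist N \<Lambda> a b + torus_twist N \<Lambda> a c"
  by (simp add: torus_twist_def lookup_add algebra_simps sum.distrib)

lemma torus_twist_zero [simp]: "torus_twist N \<Lambda> 0 c = 0" "torus_twist N \<Lambda> c 0 = 0"
  by (simp_all add: torus_twist_def)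

lemma torus_mult_assoc:
  assumes "q \<noteq> 0"
  shows "torus_mult N q \<Lambda> (torus_mult N q \<Lambda> f g) h = torus_mult N q \<Lambda> f (torus_mult N q \<Lambda> g h)"
proof (induction f rule: poly_mapping_add_induct)
  case (single a x)
  show ?case
  proof (induction g rule: poly_mapping_add_induct)
    case (single b y)
    show ?case
    proof (induction h rule: poly_mapping_add_induct)
      case (single c z)
      show ?case using assms
        by (simp add: torus_mult_single torus_twist_add_left torus_twist_add_right power_int_add
            algebra_simps)
    qed (simp_all add: torus_mult_add_right)
  qed (simp_all add: torus_mult_add_left torus_mult_add_right)
qed (simp_all add: torus_mult_add_left)

lemma torus_mult_one:
  "torus_mult N q \<Lambda> (Poly_Mapping.single 0 1) f = f"
  "torus_mult N q \<Lambda> f (Poly_Mapping.single 0 1) = f"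
proof -
  show "torus_mult N q \<Lambda> (Poly_Mapping.single 0 1) f = f"
  proof (induction f rule: poly_mapping_add_induct)
    case (single a x)
    show ?case by (simp only: torus_mult_single) simp
  qed (simp_all only: torus_mult_zero torus_mult_add_right)
  show "torus_mult N q \<Lambda> f (Poly_Mapping.single 0 1) = f"
  proof (induction f rule: poly_mapping_add_induct)
    case (single a x)
    show ?case by (simp only: torus_mult_single) simp
  qed (simp_all only: torus_mult_zero torus_mult_add_left)
qed

lemma torus_mult_closed:
  assumes "f \<in> carrier (quantum_torus N q \<Lambda>)" "g \<in> carrier (quantum_torus N q \<Lambda>)"
  shows "torus_mult N q \<Lambda> f g \<in> carrier (quantum_torus N q \<Lambda>)"
proof -
  have *: "Poly_Mapping.keys c \<subseteq> {1..N}"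
    if "c \<in> Poly_Mapping.keys (torus_mult N q \<Lambda> f g)" for c
  proof -
    let ?h = "\<lambda>a b. Poly_Mapping.single (a + b)
          (Poly_Mapping.lookup f a * Poly_Mapping.lookup g b * q powi torus_twist N \<Lambda> a b)"
    have "c \<in> (\<Union>a\<in>Poly_Mapping.keys f. Poly_Mapping.keys (\<Sum>b\<in>Poly_Mapping.keys g. ?h a b))"
      using keys_sum that unfolding torus_mult_def by (rule subsetD)
    then obtain a where a: "a \<in> Poly_Mapping.keys f"
      and c: "c \<in> Poly_Mapping.keys (\<Sum>b\<in>Poly_Mapping.keys g. ?h a b)" by (rule UN_E)
    have "c \<in> (\<Union>b\<in>Poly_Mapping.keys g. Poly_Mapping.keys (?h a b))"
      using keys_sum c by (rule subsetD)
    then obtain b where b: "b \<in> Poly_Mapping.keys g" and "c \<in> Poly_Mapping.keys (?h a b)"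
      by (rule UN_E)
    then have "c = a + b" by (auto split: if_splits)
    moreover have "Poly_Mapping.keys a \<subseteq> {1..N}" "Poly_Mapping.keys b \<subseteq> {1..N}"
      using assms a b
      by (simp_all add: quantum_torus_def)
    ultimately show ?thesis using Poly_Mapping.keys_add[of a b] by blast
  qed
  then show ?thesis by (simp add: quantum_torus_def)
qed

lemma ring_quantum_torus:
  assumes "q \<noteq> 0"
  shows "ring (quantum_torus N q \<Lambda>)"
proof (rule ringI)
  show "abelian_group (quantum_torus N q \<Lambda>)"
  proof (rule abelian_groupI)
    fix x y assume "x \<in> carrier (quantum_torus N q \<Lambda>)" "y \<in> carrier (quantum_torus N q \<Lambda>)"
    then show "x \<oplus>\<^bsub>quantum_torus N q \<Lambda>\<^esub> y \<in> carrier (quantum_torus N q \<Lambda>)"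
      using Poly_Mapping.keys_add[of x y] by (auto simp: quantum_torus_def)
  next
    fix x assume "x \<in> carrier (quantum_torus N q \<Lambda>)"
    then show "\<exists>y\<in>carrier (quantum_torus N q \<Lambda>). y \<oplus>\<^bsub>quantum_torus N q \<Lambda>\<^esub> x = \<zero>\<^bsub>quantum_torus N q \<Lambda>\<^esub>"
      by (intro bexI[of _ "- x"]) (auto simp: quantum_torus_def in_keys_iff)
  qed (auto simp: quantum_torus_def add_ac)
  show "monoid (quantum_torus N q \<Lambda>)"
  proof (rule monoidI)
    fix x y assume "x \<in> carrier (quantum_torus N q \<Lambda>)" "y \<in> carrier (quantum_torus N q \<Lambda>)"
    then show "x \<otimes>\<^bsub>quantum_torus N q \<Lambda>\<^esub> y \<in> carrier (quantum_torus N q \<Lambda>)"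
      using torus_mult_closed[of x N q \<Lambda> y] by (simp add: quantum_torus_def)
  qed (auto simp: quantum_torus_def torus_mult_assoc[OF assms] torus_mult_one
      simp del: single_one)
qed (auto simp: quantum_torus_def torus_mult_add_left torus_mult_add_right)

lemma torus_gen_closed: "i \<in> {1..N} \<Longrightarrow> torus_gen i \<in> carrier (quantum_torus N q \<Lambda>)"
  by (simp add: quantum_torus_def torus_gen_def)

lemma torus_gen_commute:
  assumes "q \<noteq> 0" and skew: "\<And>i j. \<Lambda> j i = - \<Lambda> i j" and "i \<in> {1..N}" "j \<in> {1..N}"
  shows "torus_gen i \<otimes>\<^bsub>quantum_torus N q \<Lambda>\<^esub> torus_gen j =
    torus_scalar (q powi \<Lambda> i j) \<otimes>\<^bsub>quantum_torus N q \<Lambda>\<^esub>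
      (torus_gen j \<otimes>\<^bsub>quantum_torus N q \<Lambda>\<^esub> torus_gen i)"
proof -
  have tw: "torus_twist N \<Lambda> (Poly_Mapping.single i 1) (Poly_Mapping.single j 1) =
      (if j < i then \<Lambda> i j else 0)" if "i \<in> {1..N}" "j \<in> {1..N}" for i j
  proof -
    have "torus_twist N \<Lambda> (Poly_Mapping.single i 1) (Poly_Mapping.single j 1) =
        (\<Sum>i'\<in>{1..N}. if i' = j then (\<Sum>l\<in>{i'<..N}. if l = i then \<Lambda> l i' else 0) else 0)"
      unfolding torus_twist_def
    proof (intro sum.cong refl)
      fix i'
      have "(\<Sum>l\<in>{i'<..N}. \<Lambda> l i' * Poly_Mapping.lookup (Poly_Mapping.single i 1) l *
          Poly_Mapping.lookup (Poly_Mapping.single j 1) i') =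
        (\<Sum>l\<in>{i'<..N}. if i' = j then (if l = i then \<Lambda> l i' else 0) else 0)"
        by (rule sum.cong) (auto simp: lookup_single when_def)
      also have "\<dots> = (if i' = j then (\<Sum>l\<in>{i'<..N}. if l = i then \<Lambda> l i' else 0) else 0)"
        by (cases "i' = j") simp_all
      finally show "(\<Sum>l\<in>{i'<..N}. \<Lambda> l i' * Poly_Mapping.lookup (Poly_Mapping.single i 1) l *
          Poly_Mapping.lookup (Poly_Mapping.single j 1) i') = \<dots>" .
    qed
    also have "\<dots> = (if j < i then \<Lambda> i j else 0)"
      using that by (simp only: sum.delta finite_atLeastAtMost finite_greaterThanAtMost) simp
    finally show ?thesis .
  qed
  let ?e = "\<lambda>i. Poly_Mapping.single i 1 :: nat \<Rightarrow>\<^sub>0 int"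
  have opp: "\<Lambda> i j + \<Lambda> j i = 0" using skew[of i j] by linarith
  have "torus_twist N \<Lambda> (?e i) (?e j) = \<Lambda> i j + torus_twist N \<Lambda> (?e j) (?e i)"
    unfolding tw[OF assms(3,4)] tw[OF assms(4,3)]
    using opp by (cases i j rule: linorder_cases) auto
  then show ?thesis using assms(1)
    by (simp add: quantum_torus_def torus_gen_def torus_scalar_def torus_mult_single
        add.commute[of "?e i"] power_int_add)
qed


section \<open>Quantum cluster algebras\<close>

text \<open>In this section \<open>D\<close> is the ambient division ring, \<open>\<sigma>\<close> the embedding of the scalars,
  and \<open>r\<close> the chosen square root \<open>q^(1/2)\<close>.\<close>

definition cluster_monomial :: "('d, 'm) ring_scheme \<Rightarrow> ('k::field \<Rightarrow> 'd) \<Rightarrow> 'k \<Rightarrow> nat \<Rightarrow>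
    (nat \<Rightarrow> 'd) \<Rightarrow> int_matrix \<Rightarrow> (nat \<Rightarrow> int) \<Rightarrow> 'd" where
  "cluster_monomial D \<sigma> r N x \<Lambda> c =
     \<sigma> (r powi (- (\<Sum>i\<in>{1..N}. \<Sum>j\<in>{i<..N}. c i * c j * \<Lambda> i j))) \<otimes>\<^bsub>D\<^esub>
     foldr (\<lambda>i y. (x i [^]\<^bsub>D\<^esub> c i) \<otimes>\<^bsub>D\<^esub> y) [1..<Suc N] \<one>\<^bsub>D\<^esub>"

type_synonym 'd quantum_seed = "(nat \<Rightarrow> 'd) \<times> int_matrix \<times> int_matrix"

definition mutate_cluster :: "('d, 'm) ring_scheme \<Rightarrow> ('k::field \<Rightarrow> 'd) \<Rightarrow> 'k \<Rightarrow> nat \<Rightarrow> nat \<Rightarrow>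
    (nat \<Rightarrow> 'd) \<Rightarrow> int_matrix \<Rightarrow> int_matrix \<Rightarrow> (nat \<Rightarrow> 'd)" where
  "mutate_cluster D \<sigma> r N k x B \<Lambda> =
     x(k := cluster_monomial D \<sigma> r N x \<Lambda> (\<lambda>i. max (B i k) 0 - of_bool (i = k)) \<oplus>\<^bsub>D\<^esub>
            cluster_monomial D \<sigma> r N x \<Lambda> (\<lambda>i. max (- B i k) 0 - of_bool (i = k)))"

definition mutate_matrix :: "nat \<Rightarrow> int_matrix \<Rightarrow> int_matrix" where
  "mutate_matrix k B = (\<lambda>i j. if i = k \<or> j = k then - B i j
     else B i j + max (B i k) 0 * max (B k j) 0 - max (- B i k) 0 * max (- B k j) 0)"

definition form_change :: "nat \<Rightarrow> int_matrix \<Rightarrow> int_matrix" where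
  "form_change k B = (\<lambda>i j. if j = k then (if i = k then -1 else max (- B i k) 0)
     else of_bool (i = j))"

text \<open>\<open>E\<^sup>T \<Lambda> E\<close> with \<open>E = form_change k B\<close>.\<close>

definition mutate_form :: "nat \<Rightarrow> nat \<Rightarrow> int_matrix \<Rightarrow> int_matrix \<Rightarrow> int_matrix" where
  "mutate_form N k B \<Lambda> = (\<lambda>i j. \<Sum>s\<in>{1..N}. \<Sum>t\<in>{1..N}.
     form_change k B s i * \<Lambda> s t * form_change k B t j)"

inductive_set mutation_class :: "('d, 'm) ring_scheme \<Rightarrow> ('k::field \<Rightarrow> 'd) \<Rightarrow> 'k \<Rightarrow> nat \<Rightarrow>
    'd quantum_seed \<Rightarrow> 'd quantum_seed set"
  for D \<sigma> r N S where
  initial: "S \<in> mutation_class D \<sigma> r N S"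
| mutate: "(x, B, \<Lambda>) \<in> mutation_class D \<sigma> r N S \<Longrightarrow> k \<in> {1..N} \<Longrightarrow>
    (mutate_cluster D \<sigma> r N k x B \<Lambda>, mutate_matrix k B, mutate_form N k B \<Lambda>)
      \<in> mutation_class D \<sigma> r N S"

definition cluster_variables :: "('d, 'm) ring_scheme \<Rightarrow> ('k::field \<Rightarrow> 'd) \<Rightarrow> 'k \<Rightarrow> nat \<Rightarrow>
    'd quantum_seed \<Rightarrow> 'd set" where
  "cluster_variables D \<sigma> r N S =
     {x i | x B \<Lambda> i. (x, B, \<Lambda>) \<in> mutation_class D \<sigma> r N S \<and> i \<in> {1..N}}"

text \<open>The subalgebra over the scalars generated by the cluster variables; the scalars are central
  in \<open>D\<close>, so it is the subring generated by scalars and cluster variables.\<close>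

definition quantum_cluster_algebra :: "('d, 'm) ring_scheme \<Rightarrow> ('k::field \<Rightarrow> 'd) \<Rightarrow> 'k \<Rightarrow> nat \<Rightarrow>
    'd quantum_seed \<Rightarrow> ('d, 'm) ring_scheme" where
  "quantum_cluster_algebra D \<sigma> r N S =
     D\<lparr>carrier := generate_ring D (\<sigma> ` UNIV \<union> cluster_variables D \<sigma> r N S)\<rparr>"


section \<open>Type A\<close>

definition linear_quiver_matrix :: int_matrix where
  "linear_quiver_matrix i j = of_bool (j = i + 1) - of_bool (i = j + 1)"

definition linear_quiver_form :: int_matrix where
  "linear_quiver_form i j =
     of_bool (i < j \<and> odd i \<and> even j) - of_bool (j < i \<and> odd j \<and> even i)"

lemma linear_quiver_form_skew: "linear_quiver_form j i = - linear_quiver_form i j"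
  by (simp add: linear_quiver_form_def)

lemma linear_quiver_form_inverse:
  assumes "odd n" "i \<in> {1..n - 1}" "j \<in> {1..n - 1}"
  shows "(\<Sum>k\<in>{1..n - 1}. linear_quiver_matrix k i * linear_quiver_form k j) = of_bool (i = j)"
proof -
  let ?f = "\<lambda>k. linear_quiver_form k j"
  have "(\<Sum>k\<in>{1..n - 1}. linear_quiver_matrix k i * ?f k) =
      (\<Sum>k\<in>{1..n - 1}. (if k = i - 1 then of_bool (i \<ge> 1) * ?f k else 0)) -
      (\<Sum>k\<in>{1..n - 1}. (if k = i + 1 then ?f k else 0))"
    unfolding sum_subtractf[symmetric]
    by (intro sum.cong refl) (use assms in \<open>auto simp: linear_quiver_matrix_def\<close>)
  also have "\<dots> = (if i - 1 \<in> {1..n - 1} then ?f (i - 1) else 0) -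
      (if i + 1 \<in> {1..n - 1} then ?f (i + 1) else 0)"
    using assms by (simp add: sum.delta)
  also have "\<dots> = of_bool (i = j)"
  proof (cases "even i")
    case True
    then obtain m where "i = Suc m" "odd m" using assms by (cases i) auto
    then show ?thesis using assms by (auto simp: linear_quiver_form_def) presburger+
  next
    case False
    then have "i + 1 \<le> n - 1" using assms by simp presburger
    moreover obtain m where "i = Suc m" "even m" using False by (cases i) auto
    ultimately show ?thesis using assms by (auto simp: linear_quiver_form_def) presburger+
  qed
  finally show ?thesis .
qed

text \<open>Here \<open>D\<close> with \<open>\<iota>\<close> is the division ring of fractions of
  \<open>quantum_torus (n - 1) (r\<^sup>2) linear_quiver_form\<close>; the initial cluster consists of the images
  of the torus generators.\<close>

definition type_A_quantum_cluster_algebra :: "nat \<Rightarrow> 'k::field \<Rightarrow> ('d, 'm) ring_scheme \<Rightarrow>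
    (((nat \<Rightarrow>\<^sub>0 int) \<Rightarrow>\<^sub>0 'k) \<Rightarrow> 'd) \<Rightarrow> ('d, 'm) ring_scheme" where
  "type_A_quantum_cluster_algebra n r D \<iota> =
     quantum_cluster_algebra D (\<lambda>c. \<iota> (torus_scalar c)) r (n - 1)
       (\<lambda>i. \<iota> (torus_gen i), linear_quiver_matrix, linear_quiver_form)"

end

theory Submission
  imports Defs
begin

text \<open>
  Cluster variables correspond to the diagonals of a polygon with vertices \<open>0, \<dots>, n + 1\<close>. Expanding
  them as Laurent polynomials in the initial cluster, which belongs to the fan of diagonals at
  \<open>0\<close>, yields quantum Ptolemy relations, and by these every seed reached by mutations is the one
  attached to a triangulation. In particular all cluster variables are polynomials in the \<open>n\<close>
  short diagonals \<open>u\<^sub>1, \<dots>, u\<^sub>n\<close> (continuants). These satisfy \<open>u\<^sub>i u\<^sub>j = c u\<^sub>j u\<^sub>i + d\<close> with scalars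
  \<open>c \<noteq> 0\<close> and \<open>d\<close>, so a noncommutative version of Hilbert's basis theorem shows that the algebra is
  noetherian on both sides. As \<open>\<Lambda>\<close> is nondegenerate and \<open>q\<close> is not a root of unity, commutators with
  the initial variables \<open>y\<^sub>i\<close> reduce an element of a nonzero two-sided ideal to a monomial in the \<open>y\<^sub>i\<close>.
  Multiplying it from both sides by the short diagonal crossing \<open>y\<^sub>k\<close> alone and comparing the two results
  trades a factor \<open>y\<^sub>k\<close> for \<open>y\<^sub>k\<^sub>-\<^sub>1\<close>, and finally \<open>y\<^sub>1\<close> for \<open>1\<close>.
\<close>

section \<open>Hilbert's basis theorem for almost commuting extensions\<close>

text \<open>Mutation sequences are arbitrarily long, so clusters cannot be computed along them; the
  polygon supplies a closed description that every single mutation preserves. The division ring is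
  known only through its fractions, hence relations are proved in the torus and carried over, and
  division enters when an old variable is cancelled from an exchange relation. The square root of
  \<open>q\<close> is absorbed in a symmetric normalisation of monomials, after which products
  depend on the skew form alone. The form of each cluster turns out to be this same form evaluated
  on the leading exponents of its arcs. Oddness of \<open>n\<close> makes the number of variables
  even, without which the form could not be nondegenerate, and lets the two trivial sides of the fan
  obey the same parity formula as the variables. In the tower of short diagonals polynomial
  expressions are not claimed to be unique, so leading terms are controlled by filtrations. Finally,
  a monomial is a unit in the torus but need not be one in the algebra; this is why simplicity takes
  a second step after the reduction to a monomial.\<close>

locale total_ring =
  fixes mul :: "'a::ab_group_add \<Rightarrow> 'a \<Rightarrow> 'a" (infixl \<open>\<star>\<close> 70) and unit :: 'a
  assumes mul_assoc: "(x \<star> y) \<star> z = x \<star> (y \<star> z)"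
    and mul_add_left: "(x + y) \<star> z = x \<star> z + y \<star> z"
    and mul_add_right: "x \<star> (y + z) = x \<star> y + x \<star> z"
    and unit_mul [simp]: "unit \<star> x = x"
    and mul_unit [simp]: "x \<star> unit = x"
begin

lemma mul_zero [simp]: "x \<star> 0 = 0" "0 \<star> x = 0"
  using mul_add_right[of x 0 0] mul_add_left[of 0 0 x] by simp_all

lemma mul_minus: "x \<star> (- y) = - (x \<star> y)" "(- x) \<star> y = - (x \<star> y)"
  using mul_add_right[of x y "- y"] mul_add_left[of x "- x" y]
  by (simp_all add: eq_neg_iff_add_eq_0 add.commute)

lemma mul_diff: "x \<star> (y - z) = x \<star> y - x \<star> z" "(y - z) \<star> x = y \<star> x - z \<star> x"
  using mul_add_right[of x y "- z"] mul_add_left[of y "- z" x] by (simp_all add: mul_minus)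

text \<open>Multiplication is total on the type, so subrings and ideals are plain sets and one
  ambient ring serves a whole tower of extensions. The opposite ring is another instance of the same
  locale.\<close>

definition is_subring :: "'a set \<Rightarrow> bool" where
  "is_subring C \<longleftrightarrow> unit \<in> C \<and> (\<forall>x\<in>C. \<forall>y\<in>C. x - y \<in> C \<and> x \<star> y \<in> C)"

lemma is_subringD:
  assumes "is_subring C"
  shows "unit \<in> C" "0 \<in> C" "x \<in> C \<Longrightarrow> - x \<in> C" "x \<in> C \<Longrightarrow> y \<in> C \<Longrightarrow> x + y \<in> C"
    "x \<in> C \<Longrightarrow> y \<in> C \<Longrightarrow> x - y \<in> C" "x \<in> C \<Longrightarrow> y \<in> C \<Longrightarrow> x \<star> y \<in> C"
proof -
  note * = assms[unfolded is_subring_def]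
  show "unit \<in> C" using * by blast
  then show z: "0 \<in> C" using * by (metis diff_self)
  show m: "x \<in> C \<Longrightarrow> - x \<in> C" for x using * z by (metis diff_0)
  show "x \<in> C \<Longrightarrow> y \<in> C \<Longrightarrow> x + y \<in> C" using * m by (metis diff_minus_eq_add)
qed (use assms in \<open>auto simp: is_subring_def\<close>)

definition is_left_ideal :: "'a set \<Rightarrow> 'a set \<Rightarrow> bool" where
  "is_left_ideal C I \<longleftrightarrow> I \<subseteq> C \<and> 0 \<in> I \<and> (\<forall>x\<in>I. \<forall>y\<in>I. x - y \<in> I) \<and> (\<forall>c\<in>C. \<forall>x\<in>I. c \<star> x \<in> I)"

lemma is_left_idealD:
  assumes "is_left_ideal C I"
  shows "I \<subseteq> C" "0 \<in> I" "x \<in> I \<Longrightarrow> y \<in> I \<Longrightarrow> x - y \<in> I" "x \<in> I \<Longrightarrow> y \<in> I \<Longrightarrow> x + y \<in> I"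
    "c \<in> C \<Longrightarrow> x \<in> I \<Longrightarrow> c \<star> x \<in> I"
proof -
  note * = assms[unfolded is_left_ideal_def]
  show "x \<in> I \<Longrightarrow> y \<in> I \<Longrightarrow> x + y \<in> I" using * by (metis diff_0 diff_minus_eq_add)
qed (use assms in \<open>auto simp: is_left_ideal_def\<close>)

lemma is_left_ideal_Int: "is_left_ideal C I \<Longrightarrow> is_left_ideal C J \<Longrightarrow> is_left_ideal C (I \<inter> J)"
  by (auto simp: is_left_ideal_def)

text \<open>Quantifying over the ideals above \<open>G\<close> expresses finite generation without
  sums of multiples and matches the intersection form of \<open>left_noetherian\<close>.\<close>

definition is_left_noetherian :: "'a set \<Rightarrow> bool" where
  "is_left_noetherian C \<longleftrightarrow> (\<forall>I. is_left_ideal C I \<longrightarrow>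
     (\<exists>G. finite G \<and> G \<subseteq> I \<and> (\<forall>J. is_left_ideal C J \<longrightarrow> G \<subseteq> J \<longrightarrow> I \<subseteq> J)))"

lemma is_left_noetherian_division:
  assumes "\<And>x. x \<in> C \<Longrightarrow> x \<noteq> 0 \<Longrightarrow> \<exists>y\<in>C. y \<star> x = unit"
  shows "is_left_noetherian C"
  unfolding is_left_noetherian_def
proof (intro allI impI)
  fix I assume I: "is_left_ideal C I"
  show "\<exists>G. finite G \<and> G \<subseteq> I \<and> (\<forall>J. is_left_ideal C J \<longrightarrow> G \<subseteq> J \<longrightarrow> I \<subseteq> J)"
  proof (cases "I = {0}")
    case True
    then show ?thesis by (intro exI[of _ I]) auto
  next
    case False
    then obtain x where x: "x \<in> I" "x \<noteq> 0" using is_left_idealD(2)[OF I] by auto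
    then obtain y where y: "y \<in> C" "y \<star> x = unit" using assms is_left_idealD(1)[OF I] by blast
    have "I \<subseteq> J" if J: "is_left_ideal C J" "x \<in> J" for J
    proof
      fix z assume "z \<in> I"
      then have "z \<in> C" using is_left_idealD(1)[OF I] by blast
      moreover have "unit \<in> J" using is_left_idealD(5)[OF J(1) y(1) J(2)] y(2) by simp
      ultimately show "z \<in> J" using is_left_idealD(5)[OF J(1), of z unit] by simp
    qed
    with x show ?thesis by (intro exI[of _ "{x}"]) auto
  qed
qed

primrec pow :: "'a \<Rightarrow> nat \<Rightarrow> 'a" where
  "pow x 0 = unit"
| "pow x (Suc i) = x \<star> pow x i"

lemma pow_commute: "pow x i \<star> x = x \<star> pow x i"
  by (induction i) (simp_all add: mul_assoc)

text \<open>Index \<open>i\<close> stands for polynomial expressions of degree below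
  \<open>i\<close> with left coefficients. Such expressions may coincide, so leading terms are taken
  modulo a filtration step instead of by a degree function.\<close>

primrec filtration :: "'a set \<Rightarrow> 'a \<Rightarrow> nat \<Rightarrow> 'a set" where
  "filtration C x 0 = {0}"
| "filtration C x (Suc i) = {a + c \<star> pow x i | a c. a \<in> filtration C x i \<and> c \<in> C}"

definition adjoin :: "'a set \<Rightarrow> 'a \<Rightarrow> 'a set" where
  "adjoin C x = (\<Union>i. filtration C x i)"

text \<open>The first half moves \<open>x\<close> to the right past coefficients and makes
  \<open>adjoin C x\<close> a ring; the second moves it to the left, which the argument with leading
  coefficients needs. Together they are invariant under passing to the opposite ring.\<close>

definition almost_commutes :: "'a set \<Rightarrow> 'a \<Rightarrow> 'a \<Rightarrow> bool" where
  "almost_commutes C x s \<longleftrightarrow>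
     (\<exists>s1\<in>C. \<exists>s2\<in>C. x \<star> s = s1 \<star> x + s2) \<and> (\<exists>s1\<in>C. \<exists>s2\<in>C. s \<star> x = x \<star> s1 + s2)"

lemma almost_commutes_add:
  assumes "is_subring C" "almost_commutes C x s" "almost_commutes C x t"
  shows "almost_commutes C x (s + t)"
proof -
  obtain s1 s2 s3 s4 where s: "s1 \<in> C" "s2 \<in> C" "s3 \<in> C" "s4 \<in> C"
    "x \<star> s = s1 \<star> x + s2" "s \<star> x = x \<star> s3 + s4" using assms(2) unfolding almost_commutes_def by blast
  obtain t1 t2 t3 t4 where t: "t1 \<in> C" "t2 \<in> C" "t3 \<in> C" "t4 \<in> C"
    "x \<star> t = t1 \<star> x + t2" "t \<star> x = x \<star> t3 + t4" using assms(3) unfolding almost_commutes_def by blast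
  have "x \<star> (s + t) = (s1 + t1) \<star> x + (s2 + t2)" "(s + t) \<star> x = x \<star> (s3 + t3) + (s4 + t4)"
    using s t by (simp_all add: mul_add_left mul_add_right)
  moreover have "s1 + t1 \<in> C" "s2 + t2 \<in> C" "s3 + t3 \<in> C" "s4 + t4 \<in> C"
    using s(1-4) t(1-4) is_subringD(4)[OF assms(1)] by auto
  ultimately show ?thesis unfolding almost_commutes_def by blast
qed

lemma almost_commutes_mul:
  assumes "is_subring C" "almost_commutes C x s" "almost_commutes C x t" "s \<in> C" "t \<in> C"
  shows "almost_commutes C x (s \<star> t)"
proof -
  note sub = is_subringD[OF assms(1)]
  obtain s1 s2 s3 s4 where s: "s1 \<in> C" "s2 \<in> C" "s3 \<in> C" "s4 \<in> C"
    "x \<star> s = s1 \<star> x + s2" "s \<star> x = x \<star> s3 + s4" using assms(2) unfolding almost_commutes_def by blast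
  obtain t1 t2 t3 t4 where t: "t1 \<in> C" "t2 \<in> C" "t3 \<in> C" "t4 \<in> C"
    "x \<star> t = t1 \<star> x + t2" "t \<star> x = x \<star> t3 + t4" using assms(3) unfolding almost_commutes_def by blast
  have "x \<star> (s \<star> t) = s1 \<star> (x \<star> t) + s2 \<star> t"
    by (simp flip: mul_assoc add: s mul_add_left)
  also have "\<dots> = (s1 \<star> t1) \<star> x + (s1 \<star> t2 + s2 \<star> t)"
    by (simp add: t mul_add_right mul_assoc add.assoc)
  finally have 1: "x \<star> (s \<star> t) = (s1 \<star> t1) \<star> x + (s1 \<star> t2 + s2 \<star> t)" .
  have "(s \<star> t) \<star> x = (s \<star> x) \<star> t3 + s \<star> t4"
    by (simp add: t mul_add_right mul_assoc)
  also have "\<dots> = x \<star> (s3 \<star> t3) + (s4 \<star> t3 + s \<star> t4)"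
    by (simp add: s mul_add_left mul_assoc add.assoc)
  finally have 2: "(s \<star> t) \<star> x = x \<star> (s3 \<star> t3) + (s4 \<star> t3 + s \<star> t4)" .
  have "s1 \<star> t1 \<in> C" "s1 \<star> t2 + s2 \<star> t \<in> C" "s3 \<star> t3 \<in> C" "s4 \<star> t3 + s \<star> t4 \<in> C"
    using s(1-4) t(1-4) assms(4,5) sub(4,6) by auto
  with 1 2 show ?thesis unfolding almost_commutes_def
    by (meson bexI)
qed

lemma filtration_extend: "is_subring C \<Longrightarrow> filtration C x i \<subseteq> filtration C x (Suc i)"
  using is_subringD(2)[of C] by force

lemma filtration_mono: "is_subring C \<Longrightarrow> i \<le> j \<Longrightarrow> filtration C x i \<subseteq> filtration C x j"
  using lift_Suc_mono_le[of "filtration C x" i j] filtration_extend by blast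

lemma filtration_subset_subring:
  assumes "is_subring R" "C \<subseteq> R" "x \<in> R" shows "filtration C x i \<subseteq> R"
proof (induction i)
  case 0
  then show ?case using is_subringD(2)[OF assms(1)] by simp
next
  case (Suc i)
  have "pow x i \<in> R" for i by (induction i) (use is_subringD[OF assms(1)] assms in auto)
  then show ?case using Suc is_subringD(4,6)[OF assms(1)] assms by fastforce
qed

lemma adjoin_subset_subring:
  "is_subring R \<Longrightarrow> C \<subseteq> R \<Longrightarrow> x \<in> R \<Longrightarrow> adjoin C x \<subseteq> R"
  using filtration_subset_subring unfolding adjoin_def by blast

section \<open>Adjoining one almost commuting element\<close>

context
  fixes C :: "'a set" and x :: 'a
  assumes C: "is_subring C" and x: "\<And>s. s \<in> C \<Longrightarrow> almost_commutes C x s"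
begin

lemma C_closed [simp, intro]: "unit \<in> C" "0 \<in> C" "s \<in> C \<Longrightarrow> - s \<in> C" "s \<in> C \<Longrightarrow> t \<in> C \<Longrightarrow> s + t \<in> C"
    "s \<in> C \<Longrightarrow> t \<in> C \<Longrightarrow> s - t \<in> C" "s \<in> C \<Longrightarrow> t \<in> C \<Longrightarrow> s \<star> t \<in> C"
  using is_subringD[OF C] by auto

lemma filtration_zero: "0 \<in> filtration C x i"
  using filtration_mono[OF C, of 0 i x] by simp

lemma filtration_diff: "a \<in> filtration C x i \<Longrightarrow> b \<in> filtration C x i \<Longrightarrow> a - b \<in> filtration C x i"
proof (induction i arbitrary: a b)
  case (Suc i)
  then obtain a' c b' d where *: "a = a' + c \<star> pow x i" "b = b' + d \<star> pow x i"
    "a' \<in> filtration C x i" "b' \<in> filtration C x i" "c \<in> C" "d \<in> C" by auto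
  then have "a - b = (a' - b') + (c - d) \<star> pow x i" by (simp add: mul_diff)
  then show ?case using Suc.IH[OF *(3,4)] *(5,6) by (simp only: filtration.simps) blast
qed simp

lemma filtration_uminus: "a \<in> filtration C x i \<Longrightarrow> - a \<in> filtration C x i"
  using filtration_diff[OF filtration_zero, of a i] by simp

lemma filtration_add: "a \<in> filtration C x i \<Longrightarrow> b \<in> filtration C x i \<Longrightarrow> a + b \<in> filtration C x i"
  using filtration_diff[of a i "- b"] filtration_uminus by simp

lemma filtration_monomial: "c \<in> C \<Longrightarrow> i < j \<Longrightarrow> c \<star> pow x i \<in> filtration C x j"
proof -
  assume "c \<in> C" "i < j"
  then have "0 + c \<star> pow x i \<in> filtration C x (Suc i)"
    using filtration_zero[of i] by (simp only: filtration.simps) blast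
  then show ?thesis using filtration_mono[OF C, of "Suc i" j x] \<open>i < j\<close> by auto
qed

lemma filtration_mul_left: "c \<in> C \<Longrightarrow> a \<in> filtration C x i \<Longrightarrow> c \<star> a \<in> filtration C x i"
proof (induction i arbitrary: a)
  case (Suc i)
  then obtain a' d where *: "a = a' + d \<star> pow x i" "a' \<in> filtration C x i" "d \<in> C" by auto
  then have "c \<star> a = c \<star> a' + (c \<star> d) \<star> pow x i" by (simp add: mul_add_right mul_assoc)
  then show ?case using Suc.IH[OF Suc.prems(1) *(2)] *(3) Suc.prems(1) by (simp only: filtration.simps) blast
qed simp

lemma filtration_x_mul: "a \<in> filtration C x i \<Longrightarrow> x \<star> a \<in> filtration C x (Suc i)"
proof (induction i arbitrary: a)
  case 0
  then show ?case using filtration_zero[of "Suc 0"] by simp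
next
  case (Suc i)
  then obtain a' d where *: "a = a' + d \<star> pow x i" "a' \<in> filtration C x i" "d \<in> C" by auto
  obtain s1 s2 where s: "s1 \<in> C" "s2 \<in> C" "x \<star> d = s1 \<star> x + s2"
    using x[OF *(3)] unfolding almost_commutes_def by blast
  have "x \<star> (d \<star> pow x i) = s1 \<star> pow x (Suc i) + s2 \<star> pow x i"
    by (simp flip: mul_assoc add: s mul_add_left)
  then have "x \<star> a = x \<star> a' + (s1 \<star> pow x (Suc i) + s2 \<star> pow x i)"
    by (simp add: * mul_add_right)
  moreover have "x \<star> a' \<in> filtration C x (Suc (Suc i))"
    using Suc.IH[OF *(2)] filtration_extend[OF C] by blast
  ultimately show ?case using filtration_monomial[of s1 "Suc i"] filtration_monomial[of s2 i "Suc (Suc i)"] s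
    by (metis filtration_add lessI less_SucI)
qed

lemma filtration_mul_x: "a \<in> filtration C x i \<Longrightarrow> a \<star> x \<in> filtration C x (Suc i)"
proof (induction i arbitrary: a)
  case (Suc i)
  then obtain a' d where *: "a = a' + d \<star> pow x i" "a' \<in> filtration C x i" "d \<in> C" by auto
  have "a \<star> x = a' \<star> x + d \<star> pow x (Suc i)" by (simp add: * mul_add_left mul_assoc pow_commute)
  then show ?case using Suc.IH[OF *(2)] *(3) by (metis (mono_tags, lifting) filtration.simps(2) mem_Collect_eq)
qed (use filtration_zero[of "Suc 0"] in simp)

text \<open>Each of the \<open>i\<close> passages may change the coefficient, so only the existence
  of the resulting \<open>d\<close> is recorded; all corrections have lower degree.\<close>

lemma pow_mul_coeff:
  "c \<in> C \<Longrightarrow> \<exists>d\<in>C. \<exists>a\<in>filtration C x i. pow x i \<star> c = d \<star> pow x i + a"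
proof (induction i)
  case (Suc i)
  then obtain d a where *: "d \<in> C" "a \<in> filtration C x i" "pow x i \<star> c = d \<star> pow x i + a" by blast
  obtain s1 s2 where s: "s1 \<in> C" "s2 \<in> C" "x \<star> d = s1 \<star> x + s2"
    using x[OF *(1)] unfolding almost_commutes_def by blast
  have "pow x (Suc i) \<star> c = x \<star> d \<star> pow x i + x \<star> a"
    using * by (simp add: mul_assoc mul_add_right)
  also have "\<dots> = s1 \<star> pow x (Suc i) + (s2 \<star> pow x i + x \<star> a)"
    by (simp add: s mul_add_left mul_assoc add.assoc)
  finally show ?case using s filtration_add[OF filtration_monomial[OF s(2) lessI] filtration_x_mul[OF *(2)]]
    by blast
qed (use filtration_zero[of 0] in auto)

text \<open>Converts the left coefficients of \<open>filtration\<close> into the right coefficients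
  of \<open>leading\<close>, at the cost of a lower term.\<close>

lemma coeff_mul_power:
  "c \<in> C \<Longrightarrow> \<exists>d\<in>C. \<exists>a\<in>filtration C x i. c \<star> pow x i = pow x i \<star> d + a"
proof (induction i arbitrary: c)
  case (Suc i)
  obtain s1 s2 where s: "s1 \<in> C" "s2 \<in> C" "c \<star> x = x \<star> s1 + s2"
    using x[OF Suc.prems] unfolding almost_commutes_def by blast
  obtain d a where *: "d \<in> C" "a \<in> filtration C x i" "s1 \<star> pow x i = pow x i \<star> d + a"
    using Suc.IH[OF s(1)] by blast
  have "c \<star> pow x (Suc i) = x \<star> (s1 \<star> pow x i) + s2 \<star> pow x i"
    by (simp flip: mul_assoc add: s mul_add_left)
  also have "\<dots> = pow x (Suc i) \<star> d + (x \<star> a + s2 \<star> pow x i)"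
    by (simp add: * mul_add_right mul_assoc add.assoc)
  finally show ?case using * filtration_add[OF filtration_x_mul[OF *(2)] filtration_monomial[OF s(2) lessI]]
    by blast
qed (use filtration_zero[of 0] in auto)

lemma filtration_mul_right: "c \<in> C \<Longrightarrow> a \<in> filtration C x i \<Longrightarrow> a \<star> c \<in> filtration C x i"
proof (induction i arbitrary: a)
  case (Suc i)
  then obtain a' d where *: "a = a' + d \<star> pow x i" "a' \<in> filtration C x i" "d \<in> C" by auto
  obtain d' b where d': "d' \<in> C" "b \<in> filtration C x i" "pow x i \<star> c = d' \<star> pow x i + b"
    using pow_mul_coeff[OF Suc.prems(1)] by blast
  have "a \<star> c = (a' \<star> c + d \<star> b) + (d \<star> d') \<star> pow x i"
    using d' by (simp add: * mul_add_left mul_assoc mul_add_right)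
  moreover have "a' \<star> c + d \<star> b \<in> filtration C x i"
    using Suc.IH[OF Suc.prems(1) *(2)] filtration_mul_left[OF *(3) d'(2)] filtration_add by blast
  ultimately show ?case using *(3) d'(1) by (simp only: filtration.simps) blast
qed simp

lemma filtration_power: "pow x i \<in> filtration C x (Suc i)"
  using filtration_monomial[of unit i "Suc i"] by simp

lemma filtration_in_adjoin: "filtration C x i \<subseteq> adjoin C x"
  by (auto simp: adjoin_def)

lemma adjoin_contains: "C \<subseteq> adjoin C x" "x \<in> adjoin C x"
proof -
  have "c \<in> filtration C x 1" if "c \<in> C" for c using filtration_monomial[OF that, of 0 1] by simp
  then show "C \<subseteq> adjoin C x" using filtration_in_adjoin by blast
  show "x \<in> adjoin C x" using filtration_power[of 1] filtration_in_adjoin by fastforce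
qed

lemma adjoin_is_subring: "is_subring (adjoin C x)"
  unfolding is_subring_def
proof (intro conjI ballI)
  show "unit \<in> adjoin C x" using adjoin_contains by blast
  fix a b assume ab: "a \<in> adjoin C x" "b \<in> adjoin C x"
  then obtain i j where ij: "a \<in> filtration C x i" "b \<in> filtration C x j" by (auto simp: adjoin_def)
  then have "a - b \<in> filtration C x (max i j)"
    by (metis C filtration_diff filtration_mono max.cobounded1 max.cobounded2 subsetD)
  then show "a - b \<in> adjoin C x" using filtration_in_adjoin by blast
  have "a \<star> b \<in> filtration C x (i + j)" using ij
  proof (induction j arbitrary: b)
    case 0
    then show ?case using filtration_zero by simp
  next
    case (Suc j)
    then obtain b' d where *: "b = b' + d \<star> pow x j" "b' \<in> filtration C x j" "d \<in> C" by auto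
    have p: "u \<star> pow x j \<in> filtration C x (i + j)" if "u \<in> filtration C x i" for u
    proof (induction j)
      case (Suc j)
      have "u \<star> pow x (Suc j) = (u \<star> pow x j) \<star> x" by (simp add: mul_assoc pow_commute)
      then show ?case using filtration_mul_x[OF Suc] by simp
    qed (use that in simp)
    have "a \<star> b = a \<star> b' + (a \<star> d) \<star> pow x j" by (simp add: * mul_add_right mul_assoc)
    moreover have "(a \<star> d) \<star> pow x j \<in> filtration C x (i + j)"
      using p filtration_mul_right[OF *(3) Suc.prems(1)] by blast
    ultimately have "a \<star> b \<in> filtration C x (i + j)"
      using Suc.IH[OF Suc.prems(1) *(2)] filtration_add by simp
    then show ?case using filtration_extend[OF C, of x "i + j"] by (simp del: filtration.simps) blast
  qed
  then show "a \<star> b \<in> adjoin C x" using filtration_in_adjoin by blast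
qed

text \<open>The powers stand to the left of the coefficients so that the leading coefficients of
  a left ideal form an increasing sequence of left ideals.\<close>

definition leading :: "'a set \<Rightarrow> nat \<Rightarrow> 'a set" where
  "leading I i = {c \<in> C. \<exists>a\<in>filtration C x i. pow x i \<star> c + a \<in> I}"

lemma leading_left_ideal:
  assumes I: "is_left_ideal (adjoin C x) I"
  shows "is_left_ideal C (leading I i)"
  unfolding is_left_ideal_def
proof (intro conjI ballI)
  show "leading I i \<subseteq> C" by (auto simp: leading_def)
  show "0 \<in> leading I i" using is_left_idealD(2)[OF I] filtration_zero[of i] by (force simp: leading_def)
next
  fix c d assume "c \<in> leading I i" "d \<in> leading I i"
  then obtain a b where *: "c \<in> C" "d \<in> C" "a \<in> filtration C x i" "pow x i \<star> c + a \<in> I"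
    "b \<in> filtration C x i" "pow x i \<star> d + b \<in> I" by (auto simp: leading_def)
  have "pow x i \<star> (c - d) + (a - b) \<in> I"
    using is_left_idealD(3)[OF I *(4,6)] by (simp add: mul_diff algebra_simps)
  then show "c - d \<in> leading I i" using filtration_diff[OF *(3,5)] *(1,2) by (auto simp: leading_def)
next
  fix d c assume d: "d \<in> C" and "c \<in> leading I i"
  then obtain a where *: "c \<in> C" "a \<in> filtration C x i" "pow x i \<star> c + a \<in> I"
    by (auto simp: leading_def)
  \<comment> \<open>Multiplying by \<open>d\<close> itself would put it on the wrong side of the
    power. The multiplier \<open>d'\<close> satisfies
    \<open>d' \<star> pow x i = pow x i \<star> d - b\<close>, so it produces the coefficient
    \<open>d \<star> c\<close> up to lower terms.\<close>
  obtain d' b where d': "d' \<in> C" "b \<in> filtration C x i" "pow x i \<star> d = d' \<star> pow x i + b"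
    using pow_mul_coeff[OF d] by blast
  have "d' \<star> (pow x i \<star> c + a) = pow x i \<star> (d \<star> c) + (d' \<star> a - b \<star> c)"
    by (simp flip: mul_assoc add: d' mul_add_left mul_add_right)
  moreover have "d' \<star> (pow x i \<star> c + a) \<in> I"
    using is_left_idealD(5)[OF I] d'(1) *(3) adjoin_contains by blast
  moreover have "d' \<star> a - b \<star> c \<in> filtration C x i"
    using filtration_diff[OF filtration_mul_left[OF d'(1) *(2)] filtration_mul_right[OF *(1) d'(2)]] .
  ultimately show "d \<star> c \<in> leading I i" using d *(1) by (auto simp: leading_def)
qed

lemma leading_Suc:
  assumes I: "is_left_ideal (adjoin C x) I"
  shows "leading I i \<subseteq> leading I (Suc i)"
proof
  fix c assume "c \<in> leading I i"
  then obtain a where *: "c \<in> C" "a \<in> filtration C x i" "pow x i \<star> c + a \<in> I"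
    by (auto simp: leading_def)
  have "x \<star> (pow x i \<star> c + a) \<in> I" using is_left_idealD(5)[OF I] adjoin_contains *(3) by blast
  then have "pow x (Suc i) \<star> c + x \<star> a \<in> I" by (simp add: mul_add_right mul_assoc)
  then show "c \<in> leading I (Suc i)" using filtration_x_mul[OF *(2)] *(1) unfolding leading_def by blast
qed

lemma leading_mono:
  "is_left_ideal (adjoin C x) I \<Longrightarrow> i \<le> j \<Longrightarrow> leading I i \<subseteq> leading I j"
  using lift_Suc_mono_le[of "leading I" i j] leading_Suc by blast

text \<open>A division argument: subtracting an element of \<open>J\<close> with the same leading
  coefficient lowers the filtration step, and \<open>J \<subseteq> I\<close> keeps the difference
  inside \<open>I\<close> for the induction.\<close>

lemma left_ideal_eq_if_leading_subset:
  assumes I: "is_left_ideal (adjoin C x) I" and J: "is_left_ideal (adjoin C x) J"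
    and "J \<subseteq> I" and lead: "\<And>i. leading I i \<subseteq> leading J i"
  shows "I \<subseteq> J"
proof -
  have "I \<inter> filtration C x i \<subseteq> J" for i
  proof (induction i)
    case 0
    show ?case using is_left_idealD(2)[OF J] by auto
  next
    case (Suc i)
    show ?case
    proof
      fix f assume "f \<in> I \<inter> filtration C x (Suc i)"
      then obtain a c where f: "f \<in> I" "f = a + c \<star> pow x i" "a \<in> filtration C x i" "c \<in> C" by auto
      obtain d b where d: "d \<in> C" "b \<in> filtration C x i" "c \<star> pow x i = pow x i \<star> d + b"
        using coeff_mul_power[OF f(4)] by blast
      have "pow x i \<star> d + (b + a) = f" using f d by (simp add: algebra_simps)
      then have "d \<in> leading I i" using d f filtration_add unfolding leading_def by blast
      then have "d \<in> leading J i" using lead by blast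
      then obtain b' where b': "b' \<in> filtration C x i" "pow x i \<star> d + b' \<in> J" by (auto simp: leading_def)
      have "f - (pow x i \<star> d + b') = (b + a) - b'" using f d by (simp add: algebra_simps)
      then have "f - (pow x i \<star> d + b') \<in> filtration C x i"
        using filtration_diff filtration_add b'(1) d(2) f(3) by metis
      moreover have "f - (pow x i \<star> d + b') \<in> I"
        using is_left_idealD(3)[OF I] f(1) b'(2) \<open>J \<subseteq> I\<close> by blast
      ultimately have "f - (pow x i \<star> d + b') \<in> J" using Suc by blast
      then show "f \<in> J" using is_left_idealD(4)[OF J _ b'(2)] by fastforce
    qed
  qed
  moreover have "I \<subseteq> (\<Union>i. filtration C x i)" using is_left_idealD(1)[OF I] by (simp add: adjoin_def)
  ultimately show ?thesis by blast
qed

text \<open>The leading ideals increase, so their finitely generated union is reached at some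
  \<open>m\<close>; lifts of generators for the levels up to \<open>m\<close> then generate
  \<open>I\<close>.\<close>

theorem is_left_noetherian_adjoin:
  assumes noeth: "is_left_noetherian C"
  shows "is_left_noetherian (adjoin C x)"
  unfolding is_left_noetherian_def
proof (intro allI impI)
  fix I assume I: "is_left_ideal (adjoin C x) I"
  note lead = leading_left_ideal[OF I]
  have "\<forall>i. \<exists>G. finite G \<and> G \<subseteq> leading I i \<and>
      (\<forall>J. is_left_ideal C J \<longrightarrow> G \<subseteq> J \<longrightarrow> leading I i \<subseteq> J)"
    using noeth lead by (simp add: is_left_noetherian_def)
  then obtain G where G: "\<And>i. finite (G i)" "\<And>i. G i \<subseteq> leading I i"
    "\<And>i J. is_left_ideal C J \<Longrightarrow> G i \<subseteq> J \<Longrightarrow> leading I i \<subseteq> J" by metis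
  define U where "U = (\<Union>i. leading I i)"
  have "is_left_ideal C U"
    unfolding is_left_ideal_def
  proof (intro conjI ballI)
    show "U \<subseteq> C" by (auto simp: U_def leading_def)
    show "0 \<in> U" using is_left_idealD(2)[OF lead] by (auto simp: U_def)
  next
    fix c d assume "c \<in> U" "d \<in> U"
    then obtain i j where ij: "c \<in> leading I i" "d \<in> leading I j" by (auto simp: U_def)
    then have "c \<in> leading I (max i j)" "d \<in> leading I (max i j)"
      using leading_mono[OF I, of i "max i j"] leading_mono[OF I, of j "max i j"] by auto
    then have "c - d \<in> leading I (max i j)" using is_left_idealD(3)[OF lead] by blast
    then show "c - d \<in> U" by (auto simp: U_def)
  next
    fix d c assume "d \<in> C" "c \<in> U"
    then show "d \<star> c \<in> U" using is_left_idealD(5)[OF lead] by (auto simp: U_def)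
  qed
  then obtain H where H: "finite H" "H \<subseteq> U" "\<And>J. is_left_ideal C J \<Longrightarrow> H \<subseteq> J \<Longrightarrow> U \<subseteq> J"
    using noeth by (auto simp: is_left_noetherian_def)
  have "\<exists>m. H \<subseteq> leading I m"
    using H(1,2)
  proof (induction H rule: finite_induct)
    case (insert c F)
    then obtain m i where "F \<subseteq> leading I m" "c \<in> leading I i" by (auto simp: U_def)
    then have "insert c F \<subseteq> leading I (max i m)"
      using leading_mono[OF I, of i "max i m"] leading_mono[OF I, of m "max i m"] by auto
    then show ?case by blast
  qed simp
  then obtain m where m: "H \<subseteq> leading I m" by blast
  have stable: "leading I i \<subseteq> leading I m" for i
    using H(3)[OF lead m] by (auto simp: U_def)
  have "\<forall>i. \<forall>c\<in>G i. \<exists>w\<in>I. \<exists>a\<in>filtration C x i. w = pow x i \<star> c + a"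
    using G(2) unfolding leading_def by blast
  then obtain w where w: "\<And>i c. c \<in> G i \<Longrightarrow> w i c \<in> I"
    "\<And>i c. c \<in> G i \<Longrightarrow> \<exists>a\<in>filtration C x i. w i c = pow x i \<star> c + a" by metis
  define W where "W = (\<Union>i\<in>{..m}. w i ` G i)"
  have "I \<subseteq> J" if J: "is_left_ideal (adjoin C x) J" "W \<subseteq> J" for J
  proof -
    \<comment> \<open>The comparison of leading ideals needs a subideal of \<open>I\<close>, hence
      the intersection with the arbitrary \<open>J\<close>.\<close>
    have IJ: "is_left_ideal (adjoin C x) (I \<inter> J)" using is_left_ideal_Int I J by blast
    have le: "leading I i \<subseteq> leading (I \<inter> J) i" if "i \<le> m" for i
    proof (rule G(3)[OF leading_left_ideal[OF IJ]])
      show "G i \<subseteq> leading (I \<inter> J) i"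
      proof
        fix c assume c: "c \<in> G i"
        then have "w i c \<in> W" using that by (auto simp: W_def)
        then have "w i c \<in> I \<inter> J" using w(1)[OF c] J(2) by blast
        moreover have "c \<in> C" using c G(2) by (auto simp: leading_def)
        ultimately show "c \<in> leading (I \<inter> J) i" using w(2)[OF c] by (auto simp: leading_def)
      qed
    qed
    have "leading I i \<subseteq> leading (I \<inter> J) i" for i
    proof (cases "i \<le> m")
      case False
      then show ?thesis using stable[of i] le[of m] leading_mono[OF IJ, of m i] by auto
    qed (rule le)
    then show ?thesis using left_ideal_eq_if_leading_subset[OF I IJ] by blast
  qed
  moreover have "finite W" "W \<subseteq> I" using G(1) w(1) by (auto simp: W_def)
  ultimately show "\<exists>G. finite G \<and> G \<subseteq> I \<and> (\<forall>J. is_left_ideal (adjoin C x) J \<longrightarrow> G \<subseteq> J \<longrightarrow> I \<subseteq> J)"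
    by blast
qed

end

section \<open>Right ideals through the opposite ring\<close>

lemma opposite: "total_ring (\<lambda>x y. y \<star> x) unit"
  by unfold_locales (simp_all add: mul_assoc mul_add_left mul_add_right)

definition is_right_noetherian :: "'a set \<Rightarrow> bool" where
  "is_right_noetherian C \<longleftrightarrow> total_ring.is_left_noetherian (\<lambda>x y. y \<star> x) C"

lemma is_right_noetherian_adjoin:
  assumes C: "is_subring C" and x: "\<And>s. s \<in> C \<Longrightarrow> almost_commutes C x s" and "is_right_noetherian C"
  shows "is_right_noetherian (adjoin C x)"
proof -
  interpret opp: total_ring "\<lambda>x y. y \<star> x" unit by (rule opposite)
  have sub: "opp.is_subring R \<longleftrightarrow> is_subring R" for R
    unfolding is_subring_def opp.is_subring_def by blast
  have C': "opp.is_subring C" using C by (simp add: sub)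
  have x': "opp.almost_commutes C x s" if "s \<in> C" for s
    using x[OF that] by (auto simp: almost_commutes_def opp.almost_commutes_def)
  \<comment> \<open>The two constructions put the coefficients on opposite sides. They agree because
    each gives a subring containing \<open>C\<close> and \<open>x\<close> and is contained in every
    such subring.\<close>
  have "opp.adjoin C x \<subseteq> adjoin C x"
    by (rule opp.adjoin_subset_subring) (use sub adjoin_is_subring[OF C x] adjoin_contains[OF C x] in auto)
  moreover have "adjoin C x \<subseteq> opp.adjoin C x"
    by (rule adjoin_subset_subring) (use sub opp.adjoin_is_subring[OF C' x'] opp.adjoin_contains[OF C' x'] in auto)
  ultimately have "opp.adjoin C x = adjoin C x" by blast
  then show ?thesis
    using opp.is_left_noetherian_adjoin[OF C' x'] assms(3) by (simp add: is_right_noetherian_def)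
qed

text \<open>The elements of \<open>R\<close> that almost commute with \<open>y\<close> form a
  subring, so checking the condition on \<open>C\<close> and \<open>x\<close> suffices.\<close>

lemma adjoin_almost_commutes:
  assumes C: "is_subring C" "\<And>s. s \<in> C \<Longrightarrow> almost_commutes C x s"
    and R: "is_subring R" and "adjoin C x \<subseteq> R"
    and "\<And>s. s \<in> C \<Longrightarrow> almost_commutes R y s" "almost_commutes R y x"
    and "s \<in> adjoin C x"
  shows "almost_commutes R y s"
proof -
  let ?S = "{s \<in> R. almost_commutes R y s}"
  have CR: "C \<subseteq> R" "x \<in> R" using adjoin_contains[OF C] assms(4) by auto
  have unit: "almost_commutes R y unit" using assms(5) is_subringD(1)[OF C(1)] by blast
  have neg: "almost_commutes R y (- unit)" using assms(5) is_subringD(1,3)[OF C(1)] by blast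
  have "is_subring ?S"
    unfolding is_subring_def
  proof (intro conjI ballI)
    show "unit \<in> ?S" using unit is_subringD(1)[OF R] by simp
    fix s t assume st: "s \<in> ?S" "t \<in> ?S"
    have "almost_commutes R y ((- unit) \<star> t)"
      using almost_commutes_mul[OF R neg] st is_subringD(1,3)[OF R] by blast
    then have "almost_commutes R y (s + - t)"
      using almost_commutes_add[OF R, of y s "- t"] st by (simp add: mul_minus)
    then show "s - t \<in> ?S" using st is_subringD(5)[OF R] by simp
    show "s \<star> t \<in> ?S" using st almost_commutes_mul[OF R] is_subringD(6)[OF R] by simp
  qed
  then have "adjoin C x \<subseteq> ?S"
    by (rule adjoin_subset_subring) (use CR assms(5,6) in auto)
  then show ?thesis using assms(7) by blast
qed

end

section \<open>Normalised monomials of the quantum torus\<close>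

lemma torus_twist_single:
  assumes "i \<in> {1..N}" "j \<in> {1..N}"
  shows "torus_twist N \<Lambda> (Poly_Mapping.single i 1) (Poly_Mapping.single j 1) = (if j < i then \<Lambda> i j else 0)"
proof -
  have "torus_twist N \<Lambda> (Poly_Mapping.single i 1) (Poly_Mapping.single j 1) =
      (\<Sum>i'\<in>{1..N}. if i' = j then (\<Sum>l\<in>{i'<..N}. if l = i then \<Lambda> l i' else 0) else 0)"
    unfolding torus_twist_def
    by (intro sum.cong refl) (auto simp: lookup_single when_def if_distrib[of "times _"] cong: if_cong)
  then show ?thesis using assms by (simp only: sum.delta finite_atLeastAtMost finite_greaterThanAtMost) simp
qed

lemma torus_twist_uminus:
  "torus_twist N \<Lambda> (- a) b = - torus_twist N \<Lambda> a b" "torus_twist N \<Lambda> a (- b) = - torus_twist N \<Lambda> a b"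
  by (simp_all add: torus_twist_def sum_negf)

locale type_A_torus =
  fixes n :: nat and q r :: "'k::field"
  assumes n_ge: "n \<ge> 3" and n_odd: "odd n" and q_nz: "q \<noteq> 0" and r_sq: "r ^ 2 = q"
begin

lemma r_nz: "r \<noteq> 0" using q_nz r_sq by auto

definition tmul (infixl \<open>\<star>\<close> 70) where "tmul = torus_mult (n - 1) q linear_quiver_form"
definition tw where "tw = torus_twist (n - 1) linear_quiver_form"
definition T where "T = quantum_torus (n - 1) q linear_quiver_form"

lemma T_simps: "carrier T = {f. \<forall>a\<in>Poly_Mapping.keys f. Poly_Mapping.keys a \<subseteq> {1..n - 1}}"
    "monoid.mult T = tmul" "one T = torus_scalar 1" "ring.zero T = 0" "ring.add T = (+)"
  by (simp_all add: T_def quantum_torus_def tmul_def torus_scalar_def)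

sublocale total_ring tmul "torus_scalar 1"
  unfolding tmul_def
  by unfold_locales
    (simp_all add: torus_mult_assoc[OF q_nz] torus_mult_add_left torus_mult_add_right torus_mult_one
      torus_scalar_def del: single_one)

lemmas tw_simps = torus_twist_add_left[of "n - 1" linear_quiver_form, folded tw_def]
  torus_twist_add_right[of "n - 1" linear_quiver_form, folded tw_def]
  torus_twist_uminus[of "n - 1" linear_quiver_form, folded tw_def]
  torus_twist_zero[of "n - 1" linear_quiver_form, folded tw_def]

lemma tmul_single: "Poly_Mapping.single a x \<star> Poly_Mapping.single b y =
    Poly_Mapping.single (a + b) (x * y * q powi tw a b)"
  unfolding tmul_def tw_def by (rule torus_mult_single)

text \<open>Multiplying ordered monomials costs \<open>tw\<close>, which depends on the order of the
  generators; its skew part governs commutation, as X^v X^w equals \<open>q powi omega v w\<close>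
  times X^w X^v.\<close>

definition omega :: "(nat \<Rightarrow>\<^sub>0 int) \<Rightarrow> (nat \<Rightarrow>\<^sub>0 int) \<Rightarrow> int" where
  "omega v w = tw v w - tw w v"

lemma omega_linear:
  "omega (u + v) w = omega u w + omega v w" "omega u (v + w) = omega u v + omega u w"
  "omega (- u) w = - omega u w" "omega u (- w) = - omega u w"
  "omega (u - v) w = omega u w - omega v w" "omega u (v - w) = omega u v - omega u w"
  "omega 0 w = 0" "omega u 0 = 0"
  using tw_simps(1)[of u "- v"] tw_simps(2)[of _ v "- w"] tw_simps(1)[of v "- w"] tw_simps(2)[of _ u "- v"]
  by (simp_all add: omega_def tw_simps)

lemma omega_self [simp]: "omega v v = 0" by (simp add: omega_def)

lemma omega_skew: "omega v w = - omega w v" by (simp add: omega_def)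

text \<open>Here \<open>tw v v\<close> is minus the sum over \<open>i < j\<close> of
  \<open>linear_quiver_form i j\<close> times the entries of \<open>v\<close> at \<open>i\<close>
  and \<open>j\<close>. So \<open>Mon 1 v\<close> is the normalised monomial of the initial seed,
  and its products involve the skew form alone.\<close>

definition Mon :: "'k \<Rightarrow> (nat \<Rightarrow>\<^sub>0 int) \<Rightarrow> ((nat \<Rightarrow>\<^sub>0 int) \<Rightarrow>\<^sub>0 'k)" where
  "Mon c v = Poly_Mapping.single v (c * r powi tw v v)"

lemma q_powi: "q powi k = r powi (2 * k)"
  using r_sq by (metis power_int_mult power_int_numeral)

lemma Mon_mul: "Mon c v \<star> Mon d w = Mon (c * d * r powi omega v w) (v + w)"
proof -
  have "tw v v + (tw w w + 2 * tw v w) = omega v w + tw (v + w) (v + w)"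
    by (simp add: omega_def tw_simps)
  then have "r powi tw v v * (r powi tw w w * q powi tw v w) = r powi omega v w * r powi tw (v + w) (v + w)"
    by (simp add: q_powi r_nz flip: power_int_add)
  then show ?thesis by (simp add: Mon_def tmul_single mult_ac)
qed

lemma Mon_add: "Mon (c + d) v = Mon c v + Mon d v"
  by (simp add: Mon_def distrib_right single_add)

lemma Mon_scalar: "Mon c 0 = torus_scalar c" by (simp add: Mon_def torus_scalar_def tw_simps)

lemma scalar_Mon: "torus_scalar c \<star> Mon d v = Mon (c * d) v" "Mon d v \<star> torus_scalar c = Mon (c * d) v"
  by (simp_all add: Mon_mul omega_linear mult_ac flip: Mon_scalar)

lemma scalar_mul: "torus_scalar c \<star> torus_scalar d = torus_scalar (c * d)"
  using scalar_Mon(1)[of c d 0] by (simp add: Mon_scalar)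

lemma scalar_diff: "torus_scalar (c - d) = torus_scalar c - torus_scalar d"
  by (simp add: torus_scalar_def single_diff)

lemma scalar_zero [simp]: "torus_scalar 0 = 0" by (simp add: torus_scalar_def)

lemma Mon_induct [case_names zero Mon add]:
  assumes "P 0" "\<And>c v. P (Mon c v)" "\<And>f g. P f \<Longrightarrow> P g \<Longrightarrow> P (f + g)"
  shows "P f"
proof (induction f rule: poly_mapping_add_induct)
  case (single v x)
  have "Poly_Mapping.single v x = Mon (x / r powi tw v v) v" by (simp add: Mon_def r_nz)
  then show ?case using assms(2) by simp
qed (use assms in auto)

lemma scalar_commute: "torus_scalar c \<star> x = x \<star> torus_scalar c"
  by (induction x rule: Mon_induct) (simp_all add: scalar_Mon mul_add_left mul_add_right)

lemma scalar_left_commute: "x \<star> (torus_scalar c \<star> y) = torus_scalar c \<star> (x \<star> y)"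
  by (metis mul_assoc scalar_commute)

lemma mul_sum: "x \<star> sum g A = (\<Sum>a\<in>A. x \<star> g a)" "sum g A \<star> x = (\<Sum>a\<in>A. g a \<star> x)"
  by (induction A rule: infinite_finite_induct) (simp_all add: mul_add_left mul_add_right)

lemma carrier_subring: "is_subring (carrier T)"
proof -
  have "x - y \<in> carrier T" if "x \<in> carrier T" "y \<in> carrier T" for x y
    using that by (auto simp: T_simps dest!: subsetD[OF Poly_Mapping.keys_diff])
  moreover have "x \<star> y \<in> carrier T" if "x \<in> carrier T" "y \<in> carrier T" for x y
    using torus_mult_closed that unfolding T_def tmul_def by blast
  moreover have "torus_scalar 1 \<in> carrier T" by (simp add: T_simps(1) torus_scalar_def)
  ultimately show ?thesis unfolding is_subring_def by (intro conjI ballI)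
qed

lemma Mon_closed: "Poly_Mapping.keys v \<subseteq> {1..n - 1} \<Longrightarrow> Mon c v \<in> carrier T"
  by (simp add: T_simps Mon_def)

section \<open>The arcs of a polygon with vertices \<open>0, \<dots>, n + 1\<close>\<close>

text \<open>The initial cluster variable \<open>y\<^sub>i\<close> belongs to the arc from \<open>0\<close> to \<open>i + 1\<close>. The boundary edges
  get the value \<open>1\<close>, which is why the vectors with index \<open>1\<close> and \<open>n + 1\<close> vanish.\<close>

definition fan :: "nat \<Rightarrow> (nat \<Rightarrow>\<^sub>0 int)" where
  "fan a = (if 2 \<le> a \<and> a \<le> n then Poly_Mapping.single (a - 1) 1 else 0)"

definition fan2 :: "nat \<Rightarrow> (nat \<Rightarrow>\<^sub>0 int)" where "fan2 t = fan t + fan (t + 1)"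

text \<open>The index \<open>t\<close> names the triangle with vertices 0, t, t + 1. An arc at 0
  crosses none of them; the dummy index 0, with \<open>fan2 0 = 0\<close>, turns its expansion into
  the single monomial of \<open>fan b\<close>.\<close>

definition wedges :: "nat \<Rightarrow> nat \<Rightarrow> nat set" where
  "wedges a b = (if a = 0 then {0} else {a..<b})"

text \<open>For \<open>a > 0\<close> this is the quantised form of the expansion
  \<open>x\<^sub>a\<^sub>b = \<Sum>t. x\<^sub>0\<^sub>a x\<^sub>0\<^sub>b / (x\<^sub>0\<^sub>t x\<^sub>0\<^sub>,\<^sub>t\<^sub>+\<^sub>1)\<close> over the triangles of the fan at \<open>0\<close> crossed by the arc.\<close>

definition arc :: "nat \<Rightarrow> nat \<Rightarrow> ((nat \<Rightarrow>\<^sub>0 int) \<Rightarrow>\<^sub>0 'k)" where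
  "arc a b = (\<Sum>t\<in>wedges a b. Mon 1 (fan a + fan b - fan2 t))"

text \<open>The degree of the first term of the expansion.\<close>

definition arc_deg :: "nat \<Rightarrow> nat \<Rightarrow> (nat \<Rightarrow>\<^sub>0 int)" where
  "arc_deg a b = fan b - fan (a + 1)"

lemma fan_trivial [simp]: "fan 0 = 0" "fan (Suc 0) = 0" "fan (Suc n) = 0" "fan2 0 = 0"
  by (simp_all add: fan_def fan2_def)

lemma arc_deg_alt: "arc_deg a b = fan a + fan b - fan2 a"
  by (simp add: arc_deg_def fan2_def)

lemma keys_fan: "Poly_Mapping.keys (fan a) \<subseteq> {1..n - 1}"
  by (auto simp: fan_def)

lemma arc_closed: "arc a b \<in> carrier T"
proof -
  have "Poly_Mapping.keys (fan a + fan b - fan2 t) \<subseteq> {1..n - 1}" for t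
    unfolding fan2_def
    using keys_fan Poly_Mapping.keys_add Poly_Mapping.keys_diff by (meson Un_least order_trans)
  then have "Mon 1 (fan a + fan b - fan2 t) \<in> carrier T" for t by (rule Mon_closed)
  then have "sum (\<lambda>t. Mon 1 (fan a + fan b - fan2 t)) A \<in> carrier T" for A
    by (induction A rule: infinite_finite_induct) (simp_all add: is_subringD[OF carrier_subring])
  then show ?thesis by (simp add: arc_def)
qed

section \<open>The commutation form on the fan\<close>

lemma omega_gen:
  assumes "i \<in> {1..n - 1}" "j \<in> {1..n - 1}"
  shows "omega (Poly_Mapping.single i 1) (Poly_Mapping.single j 1) = linear_quiver_form i j"
  using assms linear_quiver_form_skew[of i j]
  unfolding omega_def tw_def torus_twist_single[OF assms] torus_twist_single[OF assms(2,1)]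
  by (cases i j rule: linorder_cases) (auto simp: linear_quiver_form_def)

text \<open>Vertex \<open>a\<close> carries the variable with index \<open>a - 1\<close>, so the
  parities are swapped against \<open>linear_quiver_form\<close>. The formula survives at the
  trivial sides because 1 is odd and, with \<open>n\<close> odd, \<open>n + 1\<close> is
  even.\<close>

lemma omega_fan:
  assumes "1 \<le> a" "a \<le> n + 1" "1 \<le> b" "b \<le> n + 1"
  shows "omega (fan a) (fan b) =
    of_bool (a < b \<and> even a \<and> odd b) - of_bool (b < a \<and> even b \<and> odd a)"
proof (cases "2 \<le> a \<and> a \<le> n \<and> 2 \<le> b \<and> b \<le> n")
  case True
  then obtain i j where "a = Suc i" "b = Suc j" by (metis Suc_le_D numeral_2_eq_2)
  with True show ?thesis using omega_gen[of i j] by (auto simp: fan_def linear_quiver_form_def)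
next
  case False
  then consider "a = 1" | "a = n + 1" | "b = 1" | "b = n + 1" using assms by linarith
  then show ?thesis using assms n_odd by cases (auto simp: omega_linear)
qed

text \<open>Neighbouring vertices have opposite parities, so the two contributions complement each
  other and the parity of \<open>t\<close> drops out.\<close>

lemma omega_fan2_fan:
  assumes "1 \<le> t" "t \<le> n" "1 \<le> s" "s \<le> n + 1"
  shows "omega (fan2 t) (fan s) = of_bool (odd s) - of_bool (s \<le> t)"
proof -
  consider "s < t" | "s = t" | "s = t + 1" | "s > t + 1" by linarith
  then show ?thesis
    by cases (use assms omega_fan[of t s] omega_fan[of "t + 1" s] in \<open>auto simp: fan2_def omega_linear\<close>)
qed

lemma omega_fan_fan2:
  assumes "1 \<le> t" "t \<le> n" "1 \<le> s" "s \<le> n + 1"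
  shows "omega (fan s) (fan2 t) = of_bool (s \<le> t) - of_bool (odd s)"
  using omega_fan2_fan[OF assms] omega_skew[of "fan s" "fan2 t"] by simp

text \<open>The same cancellation in the second argument leaves only the order of the two triangles;
  this makes the exponents in products of expansions comparable.\<close>

lemma omega_fan2_fan2:
  assumes "1 \<le> t" "t \<le> n" "1 \<le> s" "s \<le> n"
  shows "omega (fan2 t) (fan2 s) = of_bool (t < s) - of_bool (s < t)"
proof -
  have "omega (fan2 t) (fan2 s) = omega (fan2 t) (fan s) + omega (fan2 t) (fan (s + 1))"
    by (simp add: fan2_def[of s] omega_linear)
  then show ?thesis using omega_fan2_fan[of t s] omega_fan2_fan[of t "s + 1"] assms by auto
qed

text \<open>The parameter \<open>\<rho>\<close> takes the values \<open>r\<close> and \<open>1/r\<close>, which treats products in both orders at once.\<close>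

definition twisted :: "'k \<Rightarrow> int \<Rightarrow> nat \<Rightarrow> nat \<Rightarrow> nat \<Rightarrow> nat \<Rightarrow> ((nat \<Rightarrow>\<^sub>0 int) \<Rightarrow>\<^sub>0 'k)" where
  "twisted \<rho> k a b c d = (\<Sum>t\<in>wedges a b. \<Sum>s\<in>wedges c d.
     Mon (\<rho> powi (k + omega (fan a + fan b - fan2 t) (fan c + fan d - fan2 s)))
       (fan a + fan b + fan c + fan d - fan2 t - fan2 s))"

section \<open>Quantum Ptolemy relations\<close>

lemma arc_mul:
  "torus_scalar (r powi k) \<star> (arc a b \<star> arc c d) = twisted r k a b c d"
  "torus_scalar (r powi k) \<star> (arc c d \<star> arc a b) = twisted (inverse r) (- k) a b c d"
proof -
  have "arc a b \<star> arc c d = (\<Sum>t\<in>wedges a b. \<Sum>s\<in>wedges c d.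
      Mon 1 (fan a + fan b - fan2 t) \<star> Mon 1 (fan c + fan d - fan2 s))"
    unfolding arc_def mul_sum by (rule sum.swap)
  then show "torus_scalar (r powi k) \<star> (arc a b \<star> arc c d) = twisted r k a b c d"
    by (simp add: twisted_def mul_sum Mon_mul scalar_Mon r_nz power_int_add algebra_simps)
  have "arc c d \<star> arc a b = (\<Sum>t\<in>wedges a b. \<Sum>s\<in>wedges c d.
      Mon 1 (fan c + fan d - fan2 s) \<star> Mon 1 (fan a + fan b - fan2 t))"
    unfolding arc_def mul_sum by (rule refl)
  then show "torus_scalar (r powi k) \<star> (arc c d \<star> arc a b) = twisted (inverse r) (- k) a b c d"
    by (simp add: twisted_def mul_sum Mon_mul scalar_Mon omega_skew[of "fan c + fan d - fan2 _"]
        power_int_inverse power_int_minus r_nz power_int_diff power_int_add field_simps)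
qed

text \<open>These are the exponents that a mutation produces: multiplying an exchange monomial by
  \<open>arc a c\<close> from the left gives the first form, normalising the product of two opposite
  sides gives the second.\<close>

definition ptolemy_exp1 :: "nat \<Rightarrow> nat \<Rightarrow> nat \<Rightarrow> nat \<Rightarrow> int" where
  "ptolemy_exp1 a b c d = omega (arc_deg a c) (arc_deg a b + arc_deg c d) - omega (arc_deg a b) (arc_deg c d)"

definition ptolemy_exp2 :: "nat \<Rightarrow> nat \<Rightarrow> nat \<Rightarrow> nat \<Rightarrow> int" where
  "ptolemy_exp2 a b c d = omega (arc_deg a c) (arc_deg a d + arc_deg b c) - omega (arc_deg a d) (arc_deg b c)"

text \<open>Terms are compared one by one. For \<open>a > 0\<close> the pairs \<open>(t, s)\<close>
  on the left fill the rectangle {a..<c} x {b..<d}. Its block {a..<b} x {c..<d} is the first product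
  on the right; the other three blocks make up {a..<d} x {b..<c}, one of them after exchanging
  \<open>t\<close> and \<open>s\<close>, which leaves the monomial unchanged. The exponents agree as
  integers, hence the identity holds for any \<open>\<rho>\<close>.\<close>

lemma twisted_ptolemy:
  assumes "a < b" "b < c" "c < d" "d \<le> n + 1"
  shows "twisted \<rho> 0 a c b d =
    twisted \<rho> (ptolemy_exp1 a b c d) a b c d + twisted \<rho> (ptolemy_exp2 a b c d) a d b c"
proof -
  define F where "F = (\<lambda>e t s. Mon (\<rho> powi e) (fan a + fan b + fan c + fan d - fan2 t - fan2 s))"
  define A where "A = (\<lambda>t s. omega (fan a + fan c - fan2 t) (fan b + fan d - fan2 s))"
  define B where "B = (\<lambda>t s. ptolemy_exp1 a b c d + omega (fan a + fan b - fan2 t) (fan c + fan d - fan2 s))"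
  define C where "C = (\<lambda>t s. ptolemy_exp2 a b c d + omega (fan a + fan d - fan2 t) (fan b + fan c - fan2 s))"
  have twA: "twisted \<rho> 0 a c b d = (\<Sum>t\<in>wedges a c. \<Sum>s\<in>wedges b d. F (A t s) t s)"
    by (simp add: twisted_def F_def A_def add_ac)
  have twB: "twisted \<rho> (ptolemy_exp1 a b c d) a b c d = (\<Sum>t\<in>wedges a b. \<Sum>s\<in>wedges c d. F (B t s) t s)"
    by (simp add: twisted_def F_def B_def add_ac)
  have twC: "twisted \<rho> (ptolemy_exp2 a b c d) a d b c = (\<Sum>t\<in>wedges a d. \<Sum>s\<in>wedges b c. F (C t s) t s)"
    by (simp add: twisted_def F_def C_def add_ac)
  have swap: "F e t s = F e s t" for e t s by (simp add: F_def algebra_simps)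
  note om = omega_linear omega_fan_fan2 omega_fan2_fan omega_fan2_fan2
    omega_skew[of "fan b" "fan a"] omega_skew[of "fan c" "fan a"] omega_skew[of "fan d" "fan a"]
    omega_skew[of "fan c" "fan b"] omega_skew[of "fan d" "fan b"] omega_skew[of "fan d" "fan c"]
    ptolemy_exp1_def ptolemy_exp2_def arc_deg_alt A_def B_def C_def
  have split: "{x..<z} = {x..<y} \<union> {y..<z}" "{x..<y} \<inter> {y..<z} = {}" if "x \<le> y" "y \<le> z" for x y z :: nat
    using that by auto
  have bd: "(\<Sum>s\<in>{b..<d}. g s) = (\<Sum>s\<in>{b..<c}. g s) + (\<Sum>s\<in>{c..<d}. g s)" for g :: "nat \<Rightarrow> (nat \<Rightarrow>\<^sub>0 int) \<Rightarrow>\<^sub>0 'k"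
    using split[of b c d] assms by (simp add: sum.union_disjoint)
  have ac: "(\<Sum>s\<in>{a..<c}. g s) = (\<Sum>s\<in>{a..<b}. g s) + (\<Sum>s\<in>{b..<c}. g s)" for g :: "nat \<Rightarrow> (nat \<Rightarrow>\<^sub>0 int) \<Rightarrow>\<^sub>0 'k"
    using split[of a b c] assms by (simp add: sum.union_disjoint)
  have ad: "(\<Sum>s\<in>{a..<d}. g s) = (\<Sum>s\<in>{a..<b}. g s) + (\<Sum>s\<in>{b..<c}. g s) + (\<Sum>s\<in>{c..<d}. g s)"
    for g :: "nat \<Rightarrow> (nat \<Rightarrow>\<^sub>0 int) \<Rightarrow>\<^sub>0 'k"
    using split[of a c d] ac[of g] assms by (simp add: sum.union_disjoint)
  show ?thesis
  proof (cases "a = 0")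
    case True
    have 1: "A 0 s = B 0 s" if "s \<in> {c..<d}" for s
      using that assms True by (simp add: om)
    have 2: "A 0 s = C 0 s" if "s \<in> {b..<c}" for s
      using that assms True by (simp add: om)
    show ?thesis unfolding twA twB twC
      using assms True by (simp add: wedges_def bd 1 2 add.commute)
  next
    case False
    have 1: "A t s = B t s" if "t \<in> {a..<b}" "s \<in> {c..<d}" for t s
      using that assms False by (simp add: om)
    have 2: "A t s = C t s" if "t \<in> {a..<b}" "s \<in> {b..<c}" for t s
      using that assms False by (simp add: om)
    have 3: "A t s = C t s" if "t \<in> {b..<c}" "s \<in> {b..<c}" for t s
      using that assms False by (simp add: om)
    have 4: "A t s = C s t" if "t \<in> {b..<c}" "s \<in> {c..<d}" for t s
      using that assms False by (simp add: om)
    have "(\<Sum>t\<in>{b..<c}. \<Sum>s\<in>{c..<d}. F (C s t) t s) = (\<Sum>t\<in>{c..<d}. \<Sum>s\<in>{b..<c}. F (C t s) t s)"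
      by (subst sum.swap) (simp add: swap)
    then show ?thesis unfolding twA twB twC
      using assms False by (simp add: wedges_def bd ac ad sum.distrib 1 2 3 4 add_ac)
  qed
qed

lemma ptolemy:
  assumes "a < b" "b < c" "c < d" "d \<le> n + 1"
  shows "arc a c \<star> arc b d =
      torus_scalar (r powi ptolemy_exp1 a b c d) \<star> (arc a b \<star> arc c d) +
      torus_scalar (r powi ptolemy_exp2 a b c d) \<star> (arc a d \<star> arc b c)"
    and "arc b d \<star> arc a c =
      torus_scalar (r powi - ptolemy_exp1 a b c d) \<star> (arc c d \<star> arc a b) +
      torus_scalar (r powi - ptolemy_exp2 a b c d) \<star> (arc b c \<star> arc a d)"
  using twisted_ptolemy[OF assms, of r] twisted_ptolemy[OF assms, of "inverse r"]
    arc_mul(1)[of 0 a c b d] arc_mul(2)[of 0 b d a c]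
    arc_mul(1)[of "ptolemy_exp1 a b c d" a b c d] arc_mul(1)[of "ptolemy_exp2 a b c d" a d b c]
    arc_mul(2)[of "- ptolemy_exp1 a b c d" c d a b] arc_mul(2)[of "- ptolemy_exp2 a b c d" b c a d]
  by simp_all

lemma arc_boundary: "arc a (Suc a) = torus_scalar 1" "arc 0 (Suc n) = torus_scalar 1"
  by (simp_all add: arc_def wedges_def fan2_def Mon_scalar)

text \<open>For arcs lying side by side all indices of the first expansion come before those of the
  second, so every pair of terms commutes with the power read off from the leading degrees.\<close>

lemma arc_commute_disjoint:
  assumes "a < b" "b \<le> c" "c < d" "d \<le> n + 1"
  shows "arc a b \<star> arc c d = torus_scalar (r powi (2 * omega (arc_deg a b) (arc_deg c d))) \<star> (arc c d \<star> arc a b)"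
proof -
  have "omega (fan a + fan b - fan2 t) (fan c + fan d - fan2 s) = omega (arc_deg a b) (arc_deg c d)"
    if "t \<in> wedges a b" "s \<in> wedges c d" for t s
    using that assms
    by (auto simp: wedges_def arc_deg_alt omega_linear omega_fan_fan2 omega_fan2_fan omega_fan2_fan2
        split: if_splits)
  then have "twisted r 0 a b c d =
      twisted (inverse r) (- (2 * omega (arc_deg a b) (arc_deg c d))) a b c d"
    by (simp add: twisted_def power_int_inverse power_int_minus)
  then show ?thesis
    using arc_mul(1)[of 0 a b c d] arc_mul(2)[of "2 * omega (arc_deg a b) (arc_deg c d)" c d a b] by simp
qed

section \<open>The algebra generated by the short arcs\<close>

primrec chain :: "nat \<Rightarrow> ((nat \<Rightarrow>\<^sub>0 int) \<Rightarrow>\<^sub>0 'k) set" where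
  "chain 0 = range torus_scalar"
| "chain (Suc k) = adjoin (chain k) (arc k (k + 2))"

text \<open>Neighbouring short arcs cross. Ptolemy's relation for the vertices \<open>j\<close> to
  \<open>j + 3\<close>, taken in both orders, contains the same arc \<open>w\<close>; eliminating it
  leaves a scalar. Other short arcs lie side by side.\<close>

lemma short_arcs_almost_commute:
  assumes "j < k" "k < n"
  shows "\<exists>c d. c \<noteq> 0 \<and> arc k (k + 2) \<star> arc j (j + 2) =
    torus_scalar c \<star> (arc j (j + 2) \<star> arc k (k + 2)) + torus_scalar d"
proof (cases "k = j + 1")
  case True
  define u v w where "u = arc j (j + 2)" and "v = arc k (k + 2)" and "w = arc j (j + 3)"
  obtain e1 e2 where
    "u \<star> v = torus_scalar (r powi e1) + torus_scalar (r powi e2) \<star> w"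
    "v \<star> u = torus_scalar (r powi - e1) + torus_scalar (r powi - e2) \<star> w"
    using ptolemy[of j "j + 1" "j + 2" "j + 3"] True assms arc_boundary(1)[of j]
      arc_boundary(1)[of "Suc j"] arc_boundary(1)[of "Suc (Suc j)"]
    by (simp add: u_def v_def w_def numeral_3_eq_3)
  \<comment> \<open>The factor turns the coefficient of \<open>w\<close> into the one of the
    reversed product, since - 2 e2 + e2 = - e2.\<close>
  moreover from this(1) have "torus_scalar (r powi - (2 * e2)) \<star> (u \<star> v) =
      torus_scalar (r powi (- (2 * e2) + e1)) + torus_scalar (r powi - e2) \<star> w"
    by (simp add: mul_add_right scalar_mul r_nz flip: mul_assoc power_int_add)
  ultimately have "v \<star> u = torus_scalar (r powi - (2 * e2)) \<star> (u \<star> v) +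
      torus_scalar (r powi - e1 - r powi (- (2 * e2) + e1))"
    by (simp add: scalar_diff)
  then show ?thesis using r_nz unfolding u_def v_def by (metis power_int_not_zero)
next
  case False
  define e where "e = 2 * omega (arc_deg j (j + 2)) (arc_deg k (k + 2))"
  have "arc j (j + 2) \<star> arc k (k + 2) = torus_scalar (r powi e) \<star> (arc k (k + 2) \<star> arc j (j + 2))"
    unfolding e_def by (rule arc_commute_disjoint) (use assms False in auto)
  then have "arc k (k + 2) \<star> arc j (j + 2) = torus_scalar (r powi - e) \<star> (arc j (j + 2) \<star> arc k (k + 2)) + torus_scalar 0"
    by (simp add: scalar_mul r_nz flip: mul_assoc power_int_add)
  then show ?thesis using r_nz by (metis power_int_not_zero)
qed

lemma scalars_subring: "is_subring (chain 0)"
  unfolding is_subring_def chain.simps using scalar_mul scalar_diff by (metis (no_types, lifting) rangeE rangeI)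

text \<open>The claims are proved together: that a level is a subring needs almost commutation at
  the level below, which in turn relies on the inclusions in the tower.\<close>

lemma chain_invariant:
  assumes "k \<le> n"
  shows "is_subring (chain k) \<and> (\<forall>j<k. chain j \<subseteq> chain k \<and> arc j (j + 2) \<in> chain k) \<and>
    range torus_scalar \<subseteq> chain k \<and>
    (k < n \<longrightarrow> (\<forall>s\<in>chain k. almost_commutes (chain k) (arc k (k + 2)) s))"
  using assms
proof (induction k rule: less_induct)
  case (less k)
  note IH = less.IH
  have prev: "is_subring (chain j)" "\<And>s. s \<in> chain j \<Longrightarrow> almost_commutes (chain j) (arc j (j + 2)) s"
    if "j < k" for j using IH[OF that] that less.prems by auto
  have sub: "is_subring (chain k)"
  proof (cases k)
    case (Suc j)
    then show ?thesis using adjoin_is_subring[OF prev] by simp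
  qed (simp only: scalars_subring)
  have mono: "chain j \<subseteq> chain k \<and> arc j (j + 2) \<in> chain k" if "j < k" for j
  proof (cases k)
    case (Suc i)
    have "chain i \<subseteq> chain k" "arc i (i + 2) \<in> chain k" using adjoin_contains[OF prev, of i] Suc by auto
    moreover have "j < i \<Longrightarrow> chain j \<subseteq> chain i \<and> arc j (j + 2) \<in> chain i"
      using IH[of i] Suc less.prems by auto
    ultimately show ?thesis using that Suc by (cases "j = i") auto
  qed (use that in simp)
  have scal: "range torus_scalar \<subseteq> chain k"
    using mono[of 0] by (cases "k = 0") auto
  \<comment> \<open>Climbs the tower inside \<open>chain k\<close>: each level is generated by the
    previous one and one more short arc, for which almost commutation with the new arc is
    known.\<close>
  have comm: "almost_commutes (chain k) (arc k (k + 2)) s" if "k < n" "j \<le> k" "s \<in> chain j" for j s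
    using that(2,3)
  proof (induction j arbitrary: s)
    case 0
    then have "s \<in> chain k" and "arc k (k + 2) \<star> s = s \<star> arc k (k + 2) + 0" "s \<star> arc k (k + 2) = arc k (k + 2) \<star> s + 0"
      using scal scalar_commute by auto
    with is_subringD(2)[OF sub] show ?case unfolding almost_commutes_def by blast
  next
    case (Suc j)
    obtain c d where cd: "c \<noteq> 0" "arc k (k + 2) \<star> arc j (j + 2) =
        torus_scalar c \<star> (arc j (j + 2) \<star> arc k (k + 2)) + torus_scalar d"
      using short_arcs_almost_commute[of j k] Suc.prems \<open>k < n\<close> by auto
    have a: "arc j (j + 2) \<in> chain k" using mono Suc.prems by simp
    have "torus_scalar (inverse c) \<star> (arc k (k + 2) \<star> arc j (j + 2)) =
        arc j (j + 2) \<star> arc k (k + 2) + torus_scalar (inverse c * d)"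
      using cd by (simp add: mul_add_right scalar_mul flip: mul_assoc)
    then have "arc j (j + 2) \<star> arc k (k + 2) =
        arc k (k + 2) \<star> (torus_scalar (inverse c) \<star> arc j (j + 2)) + torus_scalar (- (inverse c * d))"
      using scalar_diff[of 0 "inverse c * d"] by (simp add: scalar_left_commute algebra_simps)
    moreover have "arc k (k + 2) \<star> arc j (j + 2) =
        (torus_scalar c \<star> arc j (j + 2)) \<star> arc k (k + 2) + torus_scalar d"
      using cd by (simp add: mul_assoc)
    moreover have "torus_scalar x \<in> chain k" "torus_scalar x \<star> arc j (j + 2) \<in> chain k" for x
      using scal a is_subringD(6)[OF sub] by auto
    ultimately have x: "almost_commutes (chain k) (arc k (k + 2)) (arc j (j + 2))"
      unfolding almost_commutes_def by blast
    have "adjoin (chain j) (arc j (j + 2)) \<subseteq> chain k"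
      using mono[of j] Suc.prems by (intro adjoin_subset_subring sub) auto
    then show ?case
      using adjoin_almost_commutes[OF prev(1,2)[of j] sub _ Suc.IH x] Suc.prems by simp
  qed
  show ?case using sub mono scal comm[of k] by blast
qed

lemma chain_subring: "is_subring (chain n)"
  and scalar_in_chain: "torus_scalar c \<in> chain n"
  using chain_invariant[of n] by auto

lemma chain_mono: "j \<le> k \<Longrightarrow> k \<le> n \<Longrightarrow> chain j \<subseteq> chain k"
  using chain_invariant[of k] by (cases "j = k") auto

text \<open>With \<open>b = m + 2\<close>, Ptolemy's relation for \<open>a\<close>,
  \<open>m\<close>, \<open>m + 1\<close>, \<open>b\<close> contains two boundary edges and becomes
  the three-term recurrence of continuants, which is solved for \<open>arc a b\<close>.\<close>

lemma arc_in_chain: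
  assumes "a < b" "b \<le> n + 1"
  shows "arc a b \<in> chain (b - 1)"
  using assms
proof (induction b rule: less_induct)
  case (less b)
  have inv: "is_subring (chain (b - 1))" "range torus_scalar \<subseteq> chain (b - 1)"
    using chain_invariant[of "b - 1"] less.prems by auto
  consider "b = a + 1" | "b = a + 2" | "b > a + 2" using less.prems by linarith
  then show ?case
  proof cases
    case 1
    then show ?thesis using inv arc_boundary by auto
  next
    case 2
    then show ?thesis using chain_invariant[of "a + 1"] less.prems by auto
  next
    case 3
    then obtain m where m: "b = m + 2" "a < m" using that[of "b - 2"] by auto
    let ?e = "ptolemy_exp2 a m (m + 1) b" and ?e' = "ptolemy_exp1 a m (m + 1) b"
    have "arc a (m + 1) \<star> arc m b = torus_scalar (r powi ?e') \<star> arc a m + torus_scalar (r powi ?e) \<star> arc a b"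
      using ptolemy(1)[of a m "m + 1" b] m less.prems arc_boundary(1)[of m] arc_boundary(1)[of "Suc m"] by simp
    then have "torus_scalar (r powi ?e) \<star> arc a b = arc a (m + 1) \<star> arc m b - torus_scalar (r powi ?e') \<star> arc a m"
      by simp
    then have "torus_scalar (r powi - ?e) \<star> (torus_scalar (r powi ?e) \<star> arc a b) =
        torus_scalar (r powi - ?e) \<star> (arc a (m + 1) \<star> arc m b - torus_scalar (r powi ?e') \<star> arc a m)" by simp
    then have "arc a b = torus_scalar (r powi - ?e) \<star> (arc a (m + 1) \<star> arc m b - torus_scalar (r powi ?e') \<star> arc a m)"
      by (simp add: scalar_mul r_nz flip: mul_assoc power_int_add)
    moreover have "arc a (m + 1) \<in> chain (b - 1)" "arc a m \<in> chain (b - 1)"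
    proof -
      have "m + 1 < b" "m - 1 \<le> b - 1" "m \<le> b - 1" "b - 1 \<le> n" using m less.prems by arith+
      then show "arc a (m + 1) \<in> chain (b - 1)" "arc a m \<in> chain (b - 1)"
        using less.IH[of "m + 1"] less.IH[of m] m less.prems chain_mono[of m "b - 1"] chain_mono[of "m - 1" "b - 1"]
        by auto
    qed
    moreover have "arc m b \<in> chain (b - 1)" using chain_invariant[of "b - 1"] m less.prems by auto
    moreover have "torus_scalar c \<in> chain (b - 1)" for c using inv(2) by blast
    ultimately show ?thesis by (simp only: is_subringD(5,6)[OF inv(1)])
  qed
qed

lemma arc_in_chain_n: "a < b \<Longrightarrow> b \<le> n + 1 \<Longrightarrow> arc a b \<in> chain n"
  using arc_in_chain[of a b] chain_mono[of "b - 1" n] by (metis le_diff_conv order_refl subsetD)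

lemma chain_least:
  assumes "is_subring R" "range torus_scalar \<subseteq> R" "\<And>k. k < n \<Longrightarrow> arc k (k + 2) \<in> R" "m \<le> n"
  shows "chain m \<subseteq> R"
  using assms(4)
proof (induction m)
  case (Suc m)
  then show ?case using adjoin_subset_subring[OF assms(1)] assms(3) by simp
qed (use assms in simp)

lemma chain_carrier: "chain n \<subseteq> carrier T"
proof (rule chain_least[OF carrier_subring])
  show "range torus_scalar \<subseteq> carrier T" by (auto simp: T_simps torus_scalar_def split: if_splits)
qed (simp_all add: arc_closed)

lemma chain_noetherian: "m \<le> n \<Longrightarrow> is_left_noetherian (chain m) \<and> is_right_noetherian (chain m)"
proof (induction m)
  case 0
  interpret opp: total_ring "\<lambda>x y. y \<star> x" "torus_scalar 1" by (rule opposite)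
  have inv: "\<exists>y\<in>chain 0. y \<star> x = torus_scalar 1 \<and> x \<star> y = torus_scalar 1" if x: "x \<in> chain 0" "x \<noteq> 0" for x
  proof -
    obtain c where c: "x = torus_scalar c" using x(1) by auto
    with x(2) have "c \<noteq> 0" by auto
    with c show ?thesis by (intro bexI[of _ "torus_scalar (inverse c)"]) (auto simp: scalar_mul)
  qed
  have "is_left_noetherian (chain 0)"
    by (rule is_left_noetherian_division) (use inv in blast)
  moreover have "is_right_noetherian (chain 0)" unfolding is_right_noetherian_def
    by (rule opp.is_left_noetherian_division) (use inv in blast)
  ultimately show ?case by blast
next
  case (Suc m)
  have "is_subring (chain m)" "\<And>s. s \<in> chain m \<Longrightarrow> almost_commutes (chain m) (arc m (m + 2)) s"
    using chain_invariant[of m] Suc.prems by auto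
  then show ?case using Suc is_left_noetherian_adjoin is_right_noetherian_adjoin by simp
qed

section \<open>Two-sided ideals\<close>

lemma omega_scale: "omega v (Poly_Mapping.single a x) = x * omega v (Poly_Mapping.single a 1)"
proof -
  have "Poly_Mapping.lookup (Poly_Mapping.single a x) l = x * Poly_Mapping.lookup (Poly_Mapping.single a 1) l" for l
    by (simp add: lookup_single when_def)
  then show ?thesis
    by (simp add: omega_def tw_def torus_twist_def sum_distrib_left right_diff_distrib mult_ac)
qed

lemma omega_outside: "a \<notin> {1..n - 1} \<Longrightarrow> omega v (Poly_Mapping.single a 1) = 0"
  by (auto simp: omega_def tw_def torus_twist_def lookup_single when_def intro!: sum.neutral)

lemma fan_single: "a \<in> {1..n - 1} \<Longrightarrow> fan (a + 1) = Poly_Mapping.single a 1"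
  by (auto simp: fan_def)

text \<open>The first argument is \<open>fan (k + 2) - fan k\<close>, minus column \<open>k\<close>
  of the exchange matrix; the pairing is the identity \<open>B^T \<Lambda> = I\<close> in
  coordinates, up to sign.\<close>

lemma omega_fan2_diff:
  assumes "k \<in> {1..n - 1}"
  shows "omega (fan2 (k + 1) - fan2 k) z = - Poly_Mapping.lookup z k"
proof (induction z rule: poly_mapping_add_induct)
  case (single a x)
  have "omega (fan2 (k + 1) - fan2 k) (Poly_Mapping.single a 1) = - of_bool (a = k)"
  proof (cases "a \<in> {1..n - 1}")
    case True
    then show ?thesis using assms omega_fan2_fan[of "k + 1" "a + 1"] omega_fan2_fan[of k "a + 1"]
      unfolding fan_single[OF True, symmetric] by (auto simp: omega_linear)
  next
    case False
    then have "a \<noteq> k" using assms by blast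
    then show ?thesis using omega_outside[OF False] by simp
  qed
  then show ?case using omega_scale[of _ a x] by (simp add: lookup_single when_def)
qed (simp_all add: omega_linear lookup_add)

lemma omega_nondegenerate:
  assumes "Poly_Mapping.keys z \<subseteq> {1..n - 1}" "z \<noteq> 0"
  shows "\<exists>i\<in>{1..n - 1}. omega (Poly_Mapping.single i 1) z \<noteq> 0"
proof (rule ccontr)
  assume "\<not> ?thesis"
  then have "omega (fan a) z = 0" for a
    by (cases "a - 1 \<in> {1..n - 1}") (auto simp: fan_def omega_linear)
  then have "omega (fan2 t) z = 0" for t by (simp add: fan2_def omega_linear)
  then have "Poly_Mapping.lookup z k = 0" if "k \<in> {1..n - 1}" for k
    using omega_fan2_diff[OF that, of z] by (simp add: omega_linear)
  then have "Poly_Mapping.keys z = {}" using assms(1) by (metis (no_types) in_keys_iff subsetD subset_empty subsetI)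
  with assms(2) show False by simp
qed

lemma lookup_Mon_mul:
  "Poly_Mapping.lookup (Mon 1 e \<star> f) (e + v) = r powi tw e e * q powi tw e v * Poly_Mapping.lookup f v"
  "Poly_Mapping.lookup (f \<star> Mon 1 e) (e + v) = r powi tw e e * q powi tw v e * Poly_Mapping.lookup f v"
proof -
  show "Poly_Mapping.lookup (Mon 1 e \<star> f) (e + v) = r powi tw e e * q powi tw e v * Poly_Mapping.lookup f v"
    by (induction f rule: poly_mapping_add_induct)
      (auto simp: Mon_def tmul_single lookup_single when_def mul_add_right lookup_add algebra_simps)
  show "Poly_Mapping.lookup (f \<star> Mon 1 e) (e + v) = r powi tw e e * q powi tw v e * Poly_Mapping.lookup f v"
    by (induction f rule: poly_mapping_add_induct)
      (auto simp: Mon_def tmul_single lookup_single when_def mul_add_left lookup_add algebra_simps)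
qed

lemma lookup_scalar_mul: "Poly_Mapping.lookup (torus_scalar c \<star> f) v = c * Poly_Mapping.lookup f v"
  by (induction f rule: poly_mapping_add_induct)
      (auto simp: torus_scalar_def tmul_single lookup_single when_def mul_add_right lookup_add algebra_simps tw_simps)

lemma arc_fan: "arc 0 b = Mon 1 (fan b)" by (simp add: arc_def wedges_def)

lemma fan_in_chain: "i \<in> {1..n - 1} \<Longrightarrow> Mon 1 (Poly_Mapping.single i 1) \<in> chain n"
  using arc_in_chain_n[of 0 "i + 1"] fan_single[of i] by (simp add: arc_fan) arith

lemma short_arc:
  assumes "k \<ge> 1"
  shows "arc k (k + 2) = Mon 1 (fan (k + 2) - fan (k + 1)) + Mon 1 (fan k - fan (k + 1))"
proof -
  have "{k..<k + 2} = {k, k + 1}" by auto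
  then show ?thesis using assms by (simp add: arc_def wedges_def fan2_def)
qed

section \<open>Two-sided ideals of the chain, seen inside the torus\<close>

context
  fixes I :: "((nat \<Rightarrow>\<^sub>0 int) \<Rightarrow>\<^sub>0 'k) set"
  assumes q_generic: "\<forall>m::nat. m > 0 \<longrightarrow> q ^ m \<noteq> 1"
    and I_carrier: "I \<subseteq> carrier T"
    and I_diff: "\<And>x y. x \<in> I \<Longrightarrow> y \<in> I \<Longrightarrow> x - y \<in> I"
    and I_mul: "\<And>c x. c \<in> chain n \<Longrightarrow> x \<in> I \<Longrightarrow> c \<star> x \<in> I" "\<And>c x. c \<in> chain n \<Longrightarrow> x \<in> I \<Longrightarrow> x \<star> c \<in> I"
begin

lemma q_powi_inj: "q powi i = q powi j \<longleftrightarrow> i = j"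
proof
  have *: "i = j" if "q powi i = q powi j" "j \<le> i" for i j
  proof -
    have "q powi (i - j) = 1" using that q_nz by (simp add: power_int_diff)
    then have "q ^ nat (i - j) = 1" using that by (simp add: power_int_def)
    then show ?thesis using q_generic that by (cases "nat (i - j) = 0") auto
  qed
  assume "q powi i = q powi j"
  then show "i = j" using *[of i j] *[of j i] by (cases "j \<le> i") auto
qed simp

lemma I_scalar: "x \<in> I \<Longrightarrow> torus_scalar c \<star> x \<in> I"
  using I_mul(1) scalar_in_chain by blast

lemma I_Mon: "Mon c v \<in> I \<Longrightarrow> c \<noteq> 0 \<Longrightarrow> Mon 1 v \<in> I"
  using I_scalar[of "Mon c v" "inverse c"] by (simp add: scalar_Mon)

text \<open>An element of minimal support is a monomial: two exponents \<open>v\<close> and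
  \<open>w\<close> would be told apart by some initial variable, and a twisted commutator with it
  kills the term at \<open>v\<close> but not the one at \<open>w\<close>.\<close>

lemma I_contains_monomial:
  assumes "f \<in> I" "f \<noteq> 0"
  shows "\<exists>v. Mon 1 v \<in> I \<and> Poly_Mapping.keys v \<subseteq> {1..n - 1}"
proof -
  obtain f where f: "f \<in> I" "f \<noteq> 0"
    and min: "\<And>g. g \<in> I \<Longrightarrow> g \<noteq> 0 \<Longrightarrow> card (Poly_Mapping.keys f) \<le> card (Poly_Mapping.keys g)"
    using ex_has_least_nat[of "\<lambda>f. f \<in> I \<and> f \<noteq> 0" f "\<lambda>f. card (Poly_Mapping.keys f)"] assms by blast
  have sub: "Poly_Mapping.keys v \<subseteq> {1..n - 1}" if "v \<in> Poly_Mapping.keys f" for v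
    using I_carrier f(1) that by (auto simp: T_simps)
  obtain v where v: "v \<in> Poly_Mapping.keys f" using f(2) by fastforce
  have "w = v" if w: "w \<in> Poly_Mapping.keys f" for w
  proof (rule ccontr)
    assume "w \<noteq> v"
    then have "w - v \<noteq> 0" by simp
    moreover have "Poly_Mapping.keys (w - v) \<subseteq> {1..n - 1}"
      using sub[OF v] sub[OF w] Poly_Mapping.keys_diff[of w v] by blast
    ultimately obtain i where i: "i \<in> {1..n - 1}" "omega (Poly_Mapping.single i 1) (w - v) \<noteq> 0"
      using omega_nondegenerate by blast
    define e :: "nat \<Rightarrow>\<^sub>0 int" where "e = Poly_Mapping.single i 1"
    have e: "omega e w \<noteq> omega e v" using i(2) by (simp add: e_def omega_linear)
    have y: "Mon 1 e \<in> chain n" unfolding e_def by (rule fan_in_chain[OF i(1)])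
    \<comment> \<open>The scalar is the one by which \<open>Mon 1 e\<close> commutes with the term
      at \<open>v\<close>, so exactly the terms sharing this scalar vanish.\<close>
    define g where "g = Mon 1 e \<star> f - torus_scalar (q powi omega e v) \<star> (f \<star> Mon 1 e)"
    have "g \<in> I" unfolding g_def by (intro I_diff I_scalar I_mul y f(1))
    have look: "Poly_Mapping.lookup g (e + u) =
        r powi tw e e * q powi tw u e * (q powi omega e u - q powi omega e v) * Poly_Mapping.lookup f u" for u
      unfolding g_def lookup_minus lookup_scalar_mul lookup_Mon_mul omega_def[of e u]
      using q_nz by (simp add: power_int_diff field_simps)
    then have "Poly_Mapping.lookup g (e + w) \<noteq> 0"
      using w e q_nz r_nz by (simp add: in_keys_iff q_powi_inj)
    then have "g \<noteq> 0" by auto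
    have "Poly_Mapping.keys g \<subseteq> (\<lambda>u. e + u) ` (Poly_Mapping.keys f - {v})"
    proof
      fix x assume x: "x \<in> Poly_Mapping.keys g"
      have "x = e + (x - e)" by simp
      moreover have "x - e \<in> Poly_Mapping.keys f - {v}"
        using x look[of "x - e"] by (auto simp: in_keys_iff)
      ultimately show "x \<in> (\<lambda>u. e + u) ` (Poly_Mapping.keys f - {v})" by blast
    qed
    then have "card (Poly_Mapping.keys g) \<le> card (Poly_Mapping.keys f - {v})"
      by (meson card_image_le card_mono finite_Diff finite_imageI finite_keys order_trans)
    also have "\<dots> < card (Poly_Mapping.keys f)" using v by (intro psubset_card_mono) auto
    finally show False using min[OF \<open>g \<in> I\<close> \<open>g \<noteq> 0\<close>] by simp
  qed
  then have "f = Poly_Mapping.single v (Poly_Mapping.lookup f v)"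
    by (intro poly_mapping_eqI) (auto simp: lookup_single when_def in_keys_iff)
  also have "\<dots> = Mon (Poly_Mapping.lookup f v / r powi tw v v) v" by (simp add: Mon_def r_nz)
  finally have "Mon (Poly_Mapping.lookup f v / r powi tw v v) v \<in> I" using f(1) by simp
  then have "Mon 1 v \<in> I" using I_Mon v r_nz by (auto simp: in_keys_iff)
  then show ?thesis using sub[OF v] by blast
qed

text \<open>Multiplying by an initial variable raises its exponent by one; the total negative part
  is the measure.\<close>

lemma I_contains_positive_monomial:
  assumes "Mon 1 v \<in> I" "Poly_Mapping.keys v \<subseteq> {1..n - 1}"
  shows "\<exists>w. Mon 1 w \<in> I \<and> Poly_Mapping.keys w \<subseteq> {1..n - 1} \<and> (\<forall>i. Poly_Mapping.lookup w i \<ge> 0)"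
  using assms
proof (induction "\<Sum>i\<in>{1..n - 1}. nat (- Poly_Mapping.lookup v i)" arbitrary: v rule: less_induct)
  case less
  show ?case
  proof (cases "\<forall>i. Poly_Mapping.lookup v i \<ge> 0")
    case False
    then obtain i where i: "Poly_Mapping.lookup v i < 0" by (auto simp: not_le)
    then have i': "i \<in> {1..n - 1}" using less.prems(2) by (metis in_keys_iff less_irrefl subsetD)
    let ?w = "Poly_Mapping.single i 1 + v"
    have "Mon 1 ?w \<in> I"
      using I_mul(1)[OF fan_in_chain[OF i'] less.prems(1)] r_nz
      by (intro I_Mon[of "r powi omega (Poly_Mapping.single i 1) v"]) (auto simp: Mon_mul)
    moreover have "Poly_Mapping.keys ?w \<subseteq> {1..n - 1}"
      using less.prems(2) i' Poly_Mapping.keys_add[of "Poly_Mapping.single i 1" v] by auto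
    moreover have "(\<Sum>i\<in>{1..n - 1}. nat (- Poly_Mapping.lookup ?w i)) < (\<Sum>i\<in>{1..n - 1}. nat (- Poly_Mapping.lookup v i))"
      by (rule sum_strict_mono_ex1) (use i i' in \<open>auto simp: lookup_add lookup_single when_def\<close>)
    ultimately show ?thesis using less.hyps by blast
  qed (use less.prems in blast)
qed

lemma I_monomial_descent:
  assumes "Mon 1 w \<in> I" "Poly_Mapping.keys w \<subseteq> {1..n - 1}" "\<forall>i. Poly_Mapping.lookup w i \<ge> 0"
  shows "torus_scalar 1 \<in> I"
  using assms
\<comment> \<open>The weight gives \<open>y_i\<close> the value \<open>i\<close>: trading
  \<open>y_k\<close> for its predecessor lowers it by one, and so does dropping
  \<open>y_1\<close>.\<close>
proof (induction "\<Sum>i\<in>{1..n - 1}. i * nat (Poly_Mapping.lookup w i)" arbitrary: w rule: less_induct)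
  case less
  show ?case
  proof (cases "w = 0")
    case True
    then show ?thesis using less.prems by (simp add: Mon_scalar)
  next
    case False
    then obtain k where k: "k \<in> Poly_Mapping.keys w" by fastforce
    have k': "k \<in> {1..n - 1}" using less.prems(2) k by blast
    have wk: "Poly_Mapping.lookup w k > 0" using k less.prems(3) by (simp add: in_keys_iff order_less_le)
    \<comment> \<open>The two terms of the short arc trade \<open>y_k\<close> for
      \<open>y_(k+1)\<close> and for \<open>y_(k-1)\<close>; at the ends of the fan the new factor
      is 1.\<close>
    define v1 v2 where "v1 = fan (k + 2) - fan (k + 1)" and "v2 = fan k - fan (k + 1)"
    have arc: "arc k (k + 2) = Mon 1 v1 + Mon 1 v2" using short_arc k' by (simp add: v1_def v2_def)
    have "v1 - v2 = fan2 (k + 1) - fan2 k" by (simp add: v1_def v2_def fan2_def)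
    \<comment> \<open>The difference is minus the exponent of \<open>y_k\<close> in
      \<open>w\<close>, so the scalar that cancels the first term leaves the second.\<close>
    then have "omega v1 w - omega v2 w \<noteq> 0"
      using omega_fan2_diff[OF k', of w] wk by (simp flip: omega_linear(5))
    then have ne: "q powi omega v1 w \<noteq> q powi omega v2 w" by (simp add: q_powi_inj)
    have u: "arc k (k + 2) \<in> chain n" using arc_in_chain_n k' by auto
    have "arc k (k + 2) \<star> Mon 1 w - torus_scalar (q powi omega v1 w) \<star> (Mon 1 w \<star> arc k (k + 2)) \<in> I"
      using I_diff I_scalar I_mul[OF u less.prems(1)] by blast
    also have "arc k (k + 2) \<star> Mon 1 w - torus_scalar (q powi omega v1 w) \<star> (Mon 1 w \<star> arc k (k + 2)) =
        Mon (r powi - omega v2 w * (q powi omega v2 w - q powi omega v1 w)) (v2 + w)"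
    proof -
      have "Mon (q powi omega v1 w * r powi omega w v1) (w + v1) = Mon (r powi omega v1 w) (v1 + w)"
        by (simp add: q_powi r_nz omega_skew[of w v1] add.commute flip: power_int_add)
      moreover have "Mon (r powi omega v2 w) (v2 + w) - Mon (q powi omega v1 w * r powi omega w v2) (w + v2) =
          Mon (r powi - omega v2 w * (q powi omega v2 w - q powi omega v1 w)) (v2 + w)"
      proof -
        have "r powi omega v2 w = r powi - omega v2 w * q powi omega v2 w"
          by (simp add: q_powi r_nz flip: power_int_add)
        then show ?thesis
          using Mon_add[of "r powi omega v2 w - q powi omega v1 w * r powi omega w v2"
              "q powi omega v1 w * r powi omega w v2" "v2 + w"]
          by (simp add: omega_skew[of w v2] algebra_simps)
      qed
      moreover have "arc k (k + 2) \<star> Mon 1 w = Mon (r powi omega v1 w) (v1 + w) + Mon (r powi omega v2 w) (v2 + w)"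
        unfolding arc mul_add_left Mon_mul by simp
      moreover have "torus_scalar (q powi omega v1 w) \<star> (Mon 1 w \<star> arc k (k + 2)) =
          Mon (q powi omega v1 w * r powi omega w v1) (w + v1) + Mon (q powi omega v1 w * r powi omega w v2) (w + v2)"
        unfolding arc mul_add_right Mon_mul scalar_Mon by simp
      ultimately show ?thesis by (simp only: add_diff_add diff_self add_0)
    qed
    finally have "Mon 1 (v2 + w) \<in> I" using I_Mon ne r_nz by auto
    moreover have "Poly_Mapping.keys (v2 + w) \<subseteq> {1..n - 1}"
      using keys_fan less.prems(2) unfolding v2_def
      by (meson Poly_Mapping.keys_add Poly_Mapping.keys_diff Un_least order_trans)
    moreover have look: "Poly_Mapping.lookup (v2 + w) i =
        Poly_Mapping.lookup w i + of_bool (k \<ge> 2 \<and> i = k - 1) - of_bool (i = k)" for i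
      using k' by (auto simp: v2_def fan_def lookup_add lookup_minus lookup_single when_def)
    then have "\<forall>i. Poly_Mapping.lookup (v2 + w) i \<ge> 0" using less.prems(3) wk by auto
    moreover have "(\<Sum>i\<in>{1..n - 1}. i * nat (Poly_Mapping.lookup (v2 + w) i)) <
        (\<Sum>i\<in>{1..n - 1}. i * nat (Poly_Mapping.lookup w i))"
    proof -
      have eq: "int (\<Sum>i\<in>{1..n - 1}. i * nat (Poly_Mapping.lookup x i)) =
          (\<Sum>i\<in>{1..n - 1}. int i * Poly_Mapping.lookup x i)" if "\<forall>i. Poly_Mapping.lookup x i \<ge> 0" for x
        using that by simp
      have "(\<Sum>i\<in>{1..n - 1}. int i * Poly_Mapping.lookup (v2 + w) i) =
          (\<Sum>i\<in>{1..n - 1}. int i * Poly_Mapping.lookup w i) +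
          (\<Sum>i\<in>{1..n - 1}. if i = k - 1 then (if k \<ge> 2 then int i else 0) else 0) -
          (\<Sum>i\<in>{1..n - 1}. if i = k then int i else 0)"
        unfolding look sum.distrib[symmetric] sum_subtractf[symmetric]
        by (intro sum.cong refl) (auto simp: algebra_simps)
      also have "\<dots> < (\<Sum>i\<in>{1..n - 1}. int i * Poly_Mapping.lookup w i)"
        using k' by (auto simp: sum.delta)
      finally show ?thesis
        using eq[OF less.prems(3)] eq[OF \<open>\<forall>i. Poly_Mapping.lookup (v2 + w) i \<ge> 0\<close>] by linarith
    qed
    ultimately show ?thesis using less.hyps by blast
  qed
qed

lemma I_trivial: "f \<in> I \<Longrightarrow> f \<noteq> 0 \<Longrightarrow> torus_scalar 1 \<in> I"
  using I_contains_monomial I_contains_positive_monomial I_monomial_descent by blast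

end

end

section \<open>Monomials in quasi-commuting units\<close>

text \<open>The intended model is the unit group of the division ring, with \<open>s k\<close> the
  image of \<open>r powi k\<close>. Normalised monomials need only products and inverses, so their
  calculus takes place in a group.\<close>

locale scalar_group = group G for G (structure) +
  fixes s :: "int \<Rightarrow> 'a"
  assumes s_closed [simp]: "s k \<in> carrier G"
    and s_add: "s (k + l) = s k \<otimes> s l"
    and s_central: "x \<in> carrier G \<Longrightarrow> s k \<otimes> x = x \<otimes> s k"
begin

lemma s_zero [simp]: "s 0 = \<one>"
  using s_add[of 0 0] r_cancel_one'[of "s 0" "s 0"] by simp

lemma s_left: "x \<in> carrier G \<Longrightarrow> y \<in> carrier G \<Longrightarrow> x \<otimes> (s k \<otimes> y) = s k \<otimes> (x \<otimes> y)"
  by (metis m_assoc s_central s_closed)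

lemma s_merge: "x \<in> carrier G \<Longrightarrow> s k \<otimes> (s l \<otimes> x) = s (k + l) \<otimes> x"
  by (simp add: s_add m_assoc)

definition qcomm :: "int \<Rightarrow> 'a \<Rightarrow> 'a \<Rightarrow> bool" where
  "qcomm k x y \<longleftrightarrow> x \<otimes> y = s k \<otimes> (y \<otimes> x)"

lemma qcomm_sym: "x \<in> carrier G \<Longrightarrow> y \<in> carrier G \<Longrightarrow> qcomm k x y \<Longrightarrow> qcomm (- k) y x"
  by (simp add: qcomm_def s_merge)

lemma qcomm_mult:
  assumes "x \<in> carrier G" "y \<in> carrier G" "z \<in> carrier G" "qcomm k x y" "qcomm l x z"
  shows "qcomm (k + l) x (y \<otimes> z)"
proof -
  have "x \<otimes> (y \<otimes> z) = (x \<otimes> y) \<otimes> z" using assms by (simp add: m_assoc)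
  also have "\<dots> = s k \<otimes> (y \<otimes> (x \<otimes> z))"
    using assms by (simp add: qcomm_def m_assoc)
  also have "\<dots> = s (k + l) \<otimes> (y \<otimes> z \<otimes> x)"
    using assms s_left[of y "z \<otimes> x" l] by (simp add: qcomm_def s_merge m_assoc)
  finally show ?thesis by (simp add: qcomm_def)
qed

lemma qcomm_one: "x \<in> carrier G \<Longrightarrow> qcomm 0 x \<one>"
  by (simp add: qcomm_def)

lemma qcomm_inv:
  assumes "x \<in> carrier G" "y \<in> carrier G" "qcomm k x y"
  shows "qcomm (- k) x (inv y)"
proof -
  have "inv y \<otimes> (x \<otimes> y) \<otimes> inv y = inv y \<otimes> (s k \<otimes> (y \<otimes> x)) \<otimes> inv y"
    using assms(3) by (simp add: qcomm_def)
  then have "inv y \<otimes> x = s k \<otimes> (x \<otimes> inv y)"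
    using assms(1,2) by (simp add: s_left m_assoc flip: m_assoc[of "inv y" y])
  then show ?thesis using assms(1,2) by (simp add: qcomm_def s_merge)
qed

lemma qcomm_pow:
  assumes "x \<in> carrier G" "y \<in> carrier G" "qcomm k x y"
  shows "qcomm (k * b) x (y [^] (b::int))"
proof -
  have nat: "qcomm (l * int m) x (z [^] m)" if "z \<in> carrier G" "qcomm l x z" for l z and m :: nat
  proof (induction m)
    case (Suc m)
    then show ?case using qcomm_mult[OF assms(1) _ that(1) Suc that(2)] that(1) by (simp add: algebra_simps)
  qed (simp add: qcomm_one assms)
  show ?thesis
  proof (cases b rule: int_cases2)
    case (nonneg m)
    then show ?thesis using nat[OF assms(2,3), of m] by (simp add: int_pow_int)
  next
    case (nonpos m)
    have "x \<in> carrier G" "inv y \<in> carrier G" using assms by auto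
    then show ?thesis
      using nat[of "inv y" "- k" m] qcomm_inv[OF assms] assms(2) nonpos
      by (simp add: int_pow_neg_int nat_pow_inv)
  qed
qed

lemma qcomm_pow_pow:
  assumes "x \<in> carrier G" "y \<in> carrier G" "qcomm k x y"
  shows "qcomm (k * a * b) (x [^] (a::int)) (y [^] (b::int))"
proof -
  have "qcomm (- k * a) y (x [^] a)" using qcomm_pow[of y x "- k" a] qcomm_sym assms by simp
  then have "qcomm (k * a) (x [^] a) y" using qcomm_sym[of y "x [^] a"] assms by force
  then show ?thesis using qcomm_pow[of "x [^] a" y "k * a" b] assms by simp
qed

end

definition upper_form :: "nat \<Rightarrow> int_matrix \<Rightarrow> (nat \<Rightarrow> int) \<Rightarrow> (nat \<Rightarrow> int) \<Rightarrow> int" where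
  "upper_form N \<Lambda> c d = (\<Sum>i\<in>{1..N}. \<Sum>l\<in>{i<..N}. c i * d l * \<Lambda> i l)"

lemma upper_form_add:
  "upper_form N \<Lambda> (\<lambda>i. c i + c' i) d = upper_form N \<Lambda> c d + upper_form N \<Lambda> c' d"
  "upper_form N \<Lambda> d (\<lambda>i. c i + c' i) = upper_form N \<Lambda> d c + upper_form N \<Lambda> d c'"
  by (simp_all add: upper_form_def algebra_simps sum.distrib)

lemma upper_form_cong:
  assumes "\<And>i. i \<in> {1..N} \<Longrightarrow> c i = c' i" "\<And>i. i \<in> {1..N} \<Longrightarrow> d i = d' i"
  shows "upper_form N \<Lambda> c d = upper_form N \<Lambda> c' d'"
  unfolding upper_form_def by (intro sum.cong refl) (use assms in auto)

text \<open>Pairs \<open>i < j\<close> come from the first sum, pairs \<open>j < i\<close> from the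
  second by skew symmetry, and the diagonal of \<open>\<Lambda>\<close> vanishes.\<close>

lemma upper_form_skew:
  assumes "\<And>i j. i \<in> {1..N} \<Longrightarrow> j \<in> {1..N} \<Longrightarrow> \<Lambda> j i = - \<Lambda> i j"
  shows "upper_form N \<Lambda> c d - upper_form N \<Lambda> d c = (\<Sum>i\<in>{1..N}. \<Sum>j\<in>{1..N}. c i * d j * \<Lambda> i j)"
proof -
  let ?g = "\<lambda>i l. c i * d l * \<Lambda> i l"
  have tri: "upper_form N \<Lambda> c d = (\<Sum>i\<in>{1..N}. \<Sum>l\<in>{1..N}. if i < l then c i * d l * \<Lambda> i l else 0)" for c d
    unfolding upper_form_def
    by (intro sum.cong refl sum.mono_neutral_cong_left) auto
  have "upper_form N \<Lambda> d c = (\<Sum>l\<in>{1..N}. \<Sum>i\<in>{1..N}. if i < l then d i * c l * \<Lambda> i l else 0)"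
    unfolding tri by (rule sum.swap)
  then have "upper_form N \<Lambda> c d - upper_form N \<Lambda> d c = (\<Sum>i\<in>{1..N}. \<Sum>j\<in>{1..N}.
      (if i < j then c i * d j * \<Lambda> i j else 0) - (if j < i then d j * c i * \<Lambda> j i else 0))"
    by (simp add: tri sum_subtractf)
  also have "\<dots> = (\<Sum>i\<in>{1..N}. \<Sum>j\<in>{1..N}. c i * d j * \<Lambda> i j)"
  proof (intro sum.cong refl)
    fix i j assume "i \<in> {1..N}" "j \<in> {1..N}"
    then have "\<Lambda> j i = - \<Lambda> i j" using assms by blast
    then show "(if i < j then c i * d j * \<Lambda> i j else 0) - (if j < i then d j * c i * \<Lambda> j i else 0) =
        c i * d j * \<Lambda> i j"
      by (cases i j rule: linorder_cases) auto
  qed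
  finally show ?thesis .
qed

text \<open>The factor 2 in \<open>qcommute\<close> appears because \<open>s\<close> counts powers
  of the square root of \<open>q\<close>.\<close>

locale quasi_cluster = scalar_group +
  fixes N :: nat and x :: "nat \<Rightarrow> 'a" and \<Lambda> :: int_matrix
  assumes x_closed: "i \<in> {1..N} \<Longrightarrow> x i \<in> carrier G"
    and skew: "i \<in> {1..N} \<Longrightarrow> j \<in> {1..N} \<Longrightarrow> \<Lambda> j i = - \<Lambda> i j"
    and qcommute: "i \<in> {1..N} \<Longrightarrow> j \<in> {1..N} \<Longrightarrow> qcomm (2 * \<Lambda> i j) (x i) (x j)"
begin

text \<open>Letting the ordered product start at any index makes an induction from the last factor
  downwards possible.\<close>

definition tail :: "nat \<Rightarrow> (nat \<Rightarrow> int) \<Rightarrow> 'a" where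
  "tail m c = foldr (\<lambda>i y. (x i [^] c i) \<otimes> y) [m..<Suc N] \<one>"

lemma tail_rec: "tail (Suc N) c = \<one>" "m \<le> N \<Longrightarrow> tail m c = (x m [^] c m) \<otimes> tail (Suc m) c"
  unfolding tail_def by (simp, simp only: upt_conv_Cons le_imp_less_Suc foldr_Cons o_apply)

lemma tail_induct [consumes 1, case_names top step]:
  assumes "1 \<le> m \<and> m \<le> Suc N" "P (Suc N)" "\<And>m. m \<in> {1..N} \<Longrightarrow> P (Suc m) \<Longrightarrow> P m"
  shows "P m"
proof -
  have "m \<le> Suc N" using assms(1) by simp
  then show ?thesis by (induction rule: inc_induct) (use assms in auto)
qed

lemma tail_closed: "1 \<le> m \<and> m \<le> Suc N \<Longrightarrow> tail m c \<in> carrier G"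
  by (induction rule: tail_induct) (auto simp: tail_rec x_closed)

lemma qcomm_tail:
  assumes "1 \<le> m \<and> m \<le> Suc N" "j \<in> {1..N}"
  shows "qcomm (2 * (\<Sum>i\<in>{m..N}. a * c i * \<Lambda> j i)) (x j [^] (a::int)) (tail m c)"
  using assms(1)
proof (induction rule: tail_induct)
  case top
  then show ?case using assms(2) by (simp add: tail_rec qcomm_one x_closed)
next
  case (step m)
  have "qcomm (2 * \<Lambda> j m * a * c m) (x j [^] a) (x m [^] c m)"
    using qcomm_pow_pow[of "x j" "x m" "2 * \<Lambda> j m"] qcommute x_closed step(1) assms(2) by simp
  moreover have "(\<Sum>i\<in>{m..N}. a * c i * \<Lambda> j i) = a * c m * \<Lambda> j m + (\<Sum>i\<in>{Suc m..N}. a * c i * \<Lambda> j i)"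
    using step(1) by (simp add: sum.atLeast_Suc_atMost)
  ultimately show ?case
    using qcomm_mult[OF _ _ _ _ step(2), of "x m [^] c m" "2 * \<Lambda> j m * a * c m"] step(1) assms(2)
    by (simp add: tail_rec x_closed tail_closed algebra_simps)
qed

text \<open>One step moves the power \<open>x m [^] d m\<close> to the left past the later factors
  of the first product; no other pairs have to be reordered at that index.\<close>

lemma tail_mult:
  assumes "1 \<le> m \<and> m \<le> Suc N"
  shows "tail m c \<otimes> tail m d =
    s (- 2 * (\<Sum>i\<in>{m..N}. \<Sum>l\<in>{i<..N}. d i * c l * \<Lambda> i l)) \<otimes> tail m (\<lambda>i. c i + d i)"
  using assms
proof (induction rule: tail_induct)
  case top
  then show ?case by (simp add: tail_rec)
next
  case (step m)
  define e where "e = 2 * (\<Sum>i\<in>{m<..N}. d m * c i * \<Lambda> m i)"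
  define f where "f = - 2 * (\<Sum>i\<in>{Suc m..N}. \<Sum>l\<in>{i<..N}. d i * c l * \<Lambda> i l)"
  define u v p p' where "u = x m [^] c m" and "v = x m [^] d m"
    and "p = tail (Suc m) c" and "p' = tail (Suc m) d"
  have cl: "u \<in> carrier G" "v \<in> carrier G" "p \<in> carrier G" "p' \<in> carrier G"
    "tail (Suc m) (\<lambda>i. c i + d i) \<in> carrier G"
    using step(1) by (auto simp: u_def v_def p_def p'_def x_closed tail_closed)
  have "{m<..N} = {Suc m..N}" by auto
  then have "qcomm (- e) p v"
    using qcomm_tail[of "Suc m" m "d m" c] step(1) qcomm_sym[of v p] cl
    by (simp add: e_def v_def p_def)
  then have pv: "p \<otimes> v = s (- e) \<otimes> (v \<otimes> p)" by (simp add: qcomm_def)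
  have uv: "u \<otimes> v = x m [^] (c m + d m)" using step(1) by (simp add: u_def v_def int_pow_mult x_closed)
  have "tail m c \<otimes> tail m d = u \<otimes> ((p \<otimes> v) \<otimes> p')"
    using step(1) cl by (simp add: tail_rec u_def v_def p_def p'_def m_assoc)
  also have "\<dots> = s (- e) \<otimes> ((u \<otimes> v) \<otimes> (p \<otimes> p'))"
    using cl by (simp add: pv m_assoc s_left)
  also have "p \<otimes> p' = s f \<otimes> tail (Suc m) (\<lambda>i. c i + d i)"
    using step(2) by (simp add: p_def p'_def f_def)
  also have "s (- e) \<otimes> ((u \<otimes> v) \<otimes> (s f \<otimes> tail (Suc m) (\<lambda>i. c i + d i))) =
      s (- e + f) \<otimes> ((u \<otimes> v) \<otimes> tail (Suc m) (\<lambda>i. c i + d i))"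
    using cl s_left[of "u \<otimes> v" "tail (Suc m) (\<lambda>i. c i + d i)" f] by (simp add: s_merge)
  also have "(u \<otimes> v) \<otimes> tail (Suc m) (\<lambda>i. c i + d i) = tail m (\<lambda>i. c i + d i)"
    using step(1) by (simp add: uv tail_rec)
  also have "- e + f = - 2 * (\<Sum>i\<in>{m..N}. \<Sum>l\<in>{i<..N}. d i * c l * \<Lambda> i l)"
    using step(1) by (simp add: e_def f_def sum.atLeast_Suc_atMost)
  finally show ?case .
qed

definition monomial :: "(nat \<Rightarrow> int) \<Rightarrow> 'a" where
  "monomial c = s (- upper_form N \<Lambda> c c) \<otimes> tail 1 c"

lemma monomial_closed [simp]: "monomial c \<in> carrier G"
  by (simp add: monomial_def tail_closed)

text \<open>With \<open>Q\<close> for \<open>upper_form\<close>: reordering costs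
  \<open>- 2 * Q d c\<close>, and the normalisations contribute the polarisation
  \<open>Q c d + Q d c\<close>. The sum is the skew form.\<close>

lemma monomial_mult:
  "monomial c \<otimes> monomial d =
    s (\<Sum>i\<in>{1..N}. \<Sum>j\<in>{1..N}. c i * d j * \<Lambda> i j) \<otimes> monomial (\<lambda>i. c i + d i)"
proof -
  let ?Q = "upper_form N \<Lambda>"
  have "monomial c \<otimes> monomial d = s (- ?Q c c + - ?Q d d) \<otimes> (tail 1 c \<otimes> tail 1 d)"
    using s_left[of "tail 1 c" "tail 1 d" "- ?Q d d"] by (simp add: monomial_def tail_closed m_assoc s_merge)
  also have "\<dots> = s (- ?Q c c + - ?Q d d + - 2 * ?Q d c) \<otimes> tail 1 (\<lambda>i. c i + d i)"
    using tail_mult[of 1 c d] by (simp add: upper_form_def s_merge tail_closed)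
  also have "- ?Q c c + - ?Q d d + - 2 * ?Q d c =
      (?Q c d - ?Q d c) + - ?Q (\<lambda>i. c i + d i) (\<lambda>i. c i + d i)"
    by (simp add: upper_form_add)
  also have "s \<dots> \<otimes> tail 1 (\<lambda>i. c i + d i) = s (?Q c d - ?Q d c) \<otimes> monomial (\<lambda>i. c i + d i)"
    by (simp only: monomial_def s_merge tail_closed le_refl le_add1 plus_1_eq_Suc[symmetric] simp_thms)
  also have "?Q c d - ?Q d c = (\<Sum>i\<in>{1..N}. \<Sum>j\<in>{1..N}. c i * d j * \<Lambda> i j)"
    by (rule upper_form_skew[OF skew])
  finally show ?thesis .
qed

lemma monomial_cong:
  assumes "\<And>i. i \<in> {1..N} \<Longrightarrow> c i = d i"
  shows "monomial c = monomial d"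
proof -
  have "1 \<le> m \<and> m \<le> Suc N \<Longrightarrow> tail m c = tail m d" for m
    by (induction rule: tail_induct) (use assms in \<open>auto simp: tail_rec\<close>)
  then have "tail 1 c = tail 1 d" by simp
  moreover have "upper_form N \<Lambda> c c = upper_form N \<Lambda> d d" by (rule upper_form_cong[OF assms assms])
  ultimately show ?thesis by (simp add: monomial_def)
qed

lemma monomial_zero: "monomial (\<lambda>i. 0) = \<one>"
proof -
  have "1 \<le> m \<and> m \<le> Suc N \<Longrightarrow> tail m (\<lambda>i. 0) = \<one>" for m
    by (induction rule: tail_induct) (auto simp: tail_rec)
  then have "tail 1 (\<lambda>i. 0) = \<one>" by simp
  then show ?thesis by (simp add: monomial_def upper_form_def)
qed

lemma monomial_gen:
  assumes "k \<in> {1..N}"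
  shows "monomial (\<lambda>i. of_bool (i = k)) = x k"
proof -
  have "1 \<le> m \<and> m \<le> Suc N \<Longrightarrow> tail m (\<lambda>i. of_bool (i = k)) = (if m \<le> k then x k else \<one>)" for m
    by (induction rule: tail_induct) (use assms in \<open>auto simp: tail_rec x_closed le_less Suc_le_eq\<close>)
  then have "tail 1 (\<lambda>i. of_bool (i = k)) = x k" using assms by simp
  moreover have "upper_form N \<Lambda> (\<lambda>i. of_bool (i = k)) (\<lambda>i. of_bool (i = k)) = 0"
    by (auto simp: upper_form_def intro!: sum.neutral)
  ultimately show ?thesis using assms by (simp add: monomial_def x_closed)
qed

lemma monomial_mult_gen:
  assumes "k \<in> {1..N}"
  shows "monomial c \<otimes> x k = s (\<Sum>i\<in>{1..N}. c i * \<Lambda> i k) \<otimes> monomial (\<lambda>i. c i + of_bool (i = k))"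
    and "x k \<otimes> monomial c = s (- (\<Sum>i\<in>{1..N}. c i * \<Lambda> i k)) \<otimes> monomial (\<lambda>i. c i + of_bool (i = k))"
proof -
  let ?e = "\<lambda>i. of_bool (i = k) :: int"
  have 1: "(\<Sum>i\<in>{1..N}. \<Sum>j\<in>{1..N}. c i * ?e j * \<Lambda> i j) = (\<Sum>i\<in>{1..N}. c i * \<Lambda> i k)"
  proof (intro sum.cong refl)
    fix i
    have "(\<Sum>j\<in>{1..N}. c i * ?e j * \<Lambda> i j) = (\<Sum>j\<in>{1..N}. if j = k then c i * \<Lambda> i j else 0)"
      by (intro sum.cong) auto
    then show "(\<Sum>j\<in>{1..N}. c i * ?e j * \<Lambda> i j) = c i * \<Lambda> i k" using assms by simp
  qed
  have "(\<Sum>i\<in>{1..N}. \<Sum>j\<in>{1..N}. ?e i * c j * \<Lambda> i j) = (\<Sum>j\<in>{1..N}. \<Sum>i\<in>{1..N}. ?e i * c j * \<Lambda> i j)"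
    by (rule sum.swap)
  also have "\<dots> = (\<Sum>j\<in>{1..N}. - (c j * \<Lambda> j k))"
  proof (intro sum.cong refl)
    fix j assume j: "j \<in> {1..N}"
    have "(\<Sum>i\<in>{1..N}. ?e i * c j * \<Lambda> i j) = (\<Sum>i\<in>{1..N}. if i = k then c j * \<Lambda> i j else 0)"
      by (intro sum.cong) auto
    then show "(\<Sum>i\<in>{1..N}. ?e i * c j * \<Lambda> i j) = - (c j * \<Lambda> j k)" using assms skew[OF j assms] by simp
  qed
  finally have 2: "(\<Sum>i\<in>{1..N}. \<Sum>j\<in>{1..N}. ?e i * c j * \<Lambda> i j) = - (\<Sum>j\<in>{1..N}. c j * \<Lambda> j k)"
    by (simp add: sum_negf)
  show "monomial c \<otimes> x k = s (\<Sum>i\<in>{1..N}. c i * \<Lambda> i k) \<otimes> monomial (\<lambda>i. c i + ?e i)"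
    using monomial_mult[of c ?e] 1 monomial_gen[OF assms] by simp
  show "x k \<otimes> monomial c = s (- (\<Sum>i\<in>{1..N}. c i * \<Lambda> i k)) \<otimes> monomial (\<lambda>i. c i + ?e i)"
    using monomial_mult[of ?e c] 2 monomial_gen[OF assms] by (simp add: add.commute)
qed

lemma monomial_qcomm:
  assumes "k \<in> {1..N}"
  shows "qcomm (2 * (\<Sum>i\<in>{1..N}. c i * \<Lambda> i k)) (monomial c) (x k)"
  unfolding qcomm_def monomial_mult_gen[OF assms] by (simp add: s_merge)

end

section \<open>Triangulations\<close>

definition boundary :: "nat \<Rightarrow> nat \<times> nat \<Rightarrow> bool" where
  "boundary n e \<longleftrightarrow> snd e = fst e + 1 \<or> e = (0, n + 1)"

definition crosses :: "nat \<times> nat \<Rightarrow> nat \<times> nat \<Rightarrow> bool" where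
  "crosses e f \<longleftrightarrow> fst e < fst f \<and> fst f < snd e \<and> snd e < snd f \<or>
     fst f < fst e \<and> fst e < snd f \<and> snd f < snd e"

definition is_edge :: "nat \<Rightarrow> nat \<times> nat \<Rightarrow> bool" where
  "is_edge n e \<longleftrightarrow> fst e < snd e \<and> snd e \<le> n + 1"

text \<open>Triangulations are encoded as maximal non-crossing sets, so that an edge is shown to be
  present by checking that nothing crosses it.\<close>

definition triangulation :: "nat \<Rightarrow> (nat \<times> nat) set \<Rightarrow> bool" where
  "triangulation n S \<longleftrightarrow> (\<forall>e\<in>S. is_edge n e \<and> \<not> boundary n e) \<and> (\<forall>e\<in>S. \<forall>f\<in>S. \<not> crosses e f) \<and>
     (\<forall>e. is_edge n e \<longrightarrow> (\<forall>f\<in>S. \<not> crosses e f) \<longrightarrow> e \<in> S \<or> boundary n e)"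

definition is_side :: "nat \<Rightarrow> (nat \<times> nat) set \<Rightarrow> nat \<times> nat \<Rightarrow> bool" where
  "is_side n S e \<longleftrightarrow> e \<in> S \<or> boundary n e"

definition quadrilateral :: "nat \<Rightarrow> (nat \<times> nat) set \<Rightarrow> nat \<Rightarrow> nat \<Rightarrow> nat \<Rightarrow> nat \<Rightarrow> bool" where
  "quadrilateral n S a b c e \<longleftrightarrow> a < b \<and> b < c \<and> c < e \<and> e \<le> n + 1 \<and>
     is_side n S (a, b) \<and> is_side n S (b, c) \<and> is_side n S (c, e) \<and> is_side n S (a, e)"

lemma boundary_not_crosses: "boundary n e \<Longrightarrow> is_edge n f \<Longrightarrow> \<not> crosses f e"
  by (cases e; cases f) (auto simp: boundary_def is_edge_def crosses_def)

lemma side_not_crosses: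
  "triangulation n S \<Longrightarrow> is_side n S e \<Longrightarrow> f \<in> S \<Longrightarrow> \<not> crosses f e"
  using boundary_not_crosses unfolding triangulation_def is_side_def by blast

lemma triangulationI_edge:
  assumes "triangulation n S" "u < w" "w \<le> n + 1"
    "\<And>x y. (x, y) \<in> S \<Longrightarrow> x < y \<Longrightarrow> \<not> (u < x \<and> x < w \<and> w < y) \<and> \<not> (x < u \<and> u < y \<and> y < w)"
  shows "is_side n S (u, w)"
proof -
  have "\<not> crosses (u, w) f" if "f \<in> S" for f
    using assms(4)[of "fst f" "snd f"] that assms(1) unfolding triangulation_def crosses_def is_edge_def by force
  then show ?thesis using assms(1-3) unfolding triangulation_def is_side_def is_edge_def by auto
qed

text \<open>The apices of the triangles on both sides of the diagonal are the neighbours of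
  \<open>u\<close> next to \<open>w\<close> in the cyclic order around \<open>u\<close>; this
  extremality keeps the third sides from being crossed.\<close>

lemma quadrilateral_exists:
  assumes S: "triangulation n S" and uw: "(u, w) \<in> S"
  obtains a b c e where "quadrilateral n S a b c e" "(u, w) = (a, c) \<or> (u, w) = (b, e)"
proof -
  have edge: "x < y" "y \<le> n + 1" "\<not> boundary n (x, y)" if "(x, y) \<in> S" for x y
    using S that unfolding triangulation_def is_edge_def by force+
  have nc: "\<not> (x < x' \<and> x' < y \<and> y < y')" if "is_side n S (x, y)" "(x', y') \<in> S" for x y x' y'
    using side_not_crosses[OF S that(1), of "(x', y')"] that by (auto simp: crosses_def)
  have nc': "\<not> (x' < x \<and> x < y' \<and> y' < y)" if "is_side n S (x, y)" "(x', y') \<in> S" for x y x' y'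
    using side_not_crosses[OF S that(1), of "(x', y')"] that by (auto simp: crosses_def)
  have side: "is_side n S (x, y)" if "(x, y) \<in> S" for x y using that by (simp add: is_side_def)
  have uw': "u + 1 < w" "w \<le> n + 1" "(u, w) \<noteq> (0, n + 1)"
    using edge[OF uw] by (auto simp: boundary_def)
  define P where "P = (\<lambda>b. u < b \<and> b < w \<and> is_side n S (u, b))"
  have "P (u + 1)" using uw' by (simp add: P_def is_side_def boundary_def)
  moreover have "\<And>b. P b \<Longrightarrow> b \<le> w" by (simp add: P_def)
  ultimately obtain b where b: "P b" "\<And>b'. P b' \<Longrightarrow> b' \<le> b"
    using GreatestI_nat[of P "u + 1" w] Greatest_le_nat[of P _ w] by metis
  have bw: "is_side n S (b, w)"
  proof (rule triangulationI_edge[OF S])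
    fix x y assume xy: "(x, y) \<in> S" "x < y"
    have "is_side n S (u, b)" "u < b" using b(1) by (auto simp: P_def)
    moreover have "\<not> (x = u \<and> b < y \<and> y < w)" using b(2)[of y] side[OF xy(1)] xy(2) by (auto simp: P_def)
    ultimately show "\<not> (b < x \<and> x < w \<and> w < y) \<and> \<not> (x < b \<and> b < y \<and> y < w)"
      using nc[OF side[OF uw] xy(1)] nc'[OF side[OF uw] xy(1)] nc'[of u b x y] nc[of u b x y] xy by linarith
  qed (use b(1) uw' in \<open>auto simp: P_def\<close>)
  have ub: "is_side n S (u, b)" "u < b" "b < w" using b(1) by (auto simp: P_def)
  show ?thesis
  proof (cases "\<exists>e>w. is_side n S (u, e) \<and> e \<le> n + 1")
    case True
    define Q where "Q = (\<lambda>e. w < e \<and> e \<le> n + 1 \<and> is_side n S (u, e))"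
    have "\<exists>e. Q e" using True by (auto simp: Q_def)
    then obtain e where e: "Q e" "\<And>e'. Q e' \<Longrightarrow> e \<le> e'"
      using LeastI_ex[of Q] Least_le[of Q] by metis
    have "is_side n S (w, e)"
    proof (rule triangulationI_edge[OF S])
      fix x y assume xy: "(x, y) \<in> S" "x < y"
      have "is_side n S (u, e)" "w < e" using e(1) by (auto simp: Q_def)
      moreover have "\<not> (x = u \<and> w < y \<and> y < e)"
        using e(2)[of y] side[OF xy(1)] edge[OF xy(1)] by (auto simp: Q_def)
      ultimately show "\<not> (w < x \<and> x < e \<and> e < y) \<and> \<not> (x < w \<and> w < y \<and> y < e)"
        using nc[OF side[OF uw] xy(1)] nc'[OF side[OF uw] xy(1)] nc'[of u e x y] nc[of u e x y] xy uw'
        by linarith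
    qed (use e(1) in \<open>auto simp: Q_def\<close>)
    then have "quadrilateral n S u b w e" using ub bw e(1) by (simp add: quadrilateral_def Q_def)
    then show ?thesis using that by blast
  next
    case False
    have "u > 0"
    proof (rule ccontr)
      assume "\<not> u > 0"
      then have "is_side n S (u, n + 1)" by (simp add: is_side_def boundary_def)
      moreover have "n + 1 > w" using uw' \<open>\<not> u > 0\<close> by auto
      ultimately show False using False by blast
    qed
    \<comment> \<open>No side leads from \<open>u\<close> past \<open>w\<close>, so the cyclic order
      wraps around and the next neighbour of \<open>u\<close> is the smallest one below it.\<close>
    define Q where "Q = (\<lambda>e. e < u \<and> is_side n S (e, u))"
    have "Q (u - 1)" using \<open>u > 0\<close> by (simp add: Q_def is_side_def boundary_def)
    then obtain e where e: "Q e" "\<And>e'. Q e' \<Longrightarrow> e \<le> e'"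
      using LeastI[of Q] Least_le[of Q] by metis
    have "is_side n S (e, w)"
    proof (rule triangulationI_edge[OF S])
      fix x y assume xy: "(x, y) \<in> S" "x < y"
      have "\<not> (x = u \<and> w < y)" using False side[OF xy(1)] edge[OF xy(1)] by blast
      moreover have "is_side n S (e, u)" "e < u" using e(1) by (auto simp: Q_def)
      moreover have "\<not> (y = u \<and> x < e)" using e(2)[of x] side[OF xy(1)] xy(2) by (auto simp: Q_def)
      ultimately show "\<not> (e < x \<and> x < w \<and> w < y) \<and> \<not> (x < e \<and> e < y \<and> y < w)"
        using nc[OF side[OF uw] xy(1)] nc'[OF side[OF uw] xy(1)] nc'[of e u x y] nc[of e u x y] xy uw'
        by linarith
    qed (use e(1) uw' in \<open>auto simp: Q_def\<close>)
    then have "quadrilateral n S e u b w" using ub bw e(1) uw' by (simp add: quadrilateral_def Q_def)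
    then show ?thesis using that by blast
  qed
qed

text \<open>An arc that crosses no side can leave the quadrilateral only at a vertex, so an arc
  crossing one diagonal joins the other two vertices.\<close>

lemma crosses_diagonal:
  assumes "a < b" "b < c" "c < e" "fst f < snd f"
    "\<not> crosses f (a, b)" "\<not> crosses f (b, c)" "\<not> crosses f (c, e)" "\<not> crosses f (a, e)"
  shows "crosses f (b, e) \<Longrightarrow> f = (a, c)" and "crosses f (a, c) \<Longrightarrow> f = (b, e)"
proof -
  obtain x y where f: "f = (x, y)" by (cases f)
  have ab: "\<not> (a < x \<and> x < b \<and> b < y)" and bc: "\<not> (x < b \<and> b < y \<and> y < c)" "\<not> (b < x \<and> x < c \<and> c < y)"
    and ce: "\<not> (x < c \<and> c < y \<and> y < e)"
    and ae: "\<not> (x < a \<and> a < y \<and> y < e)" "\<not> (a < x \<and> x < e \<and> e < y)"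
    using assms(5-8) by (auto simp: f crosses_def)
  show "f = (a, c)" if "crosses f (b, e)"
  proof -
    have *: "x < b" "b < y" "y < e"
      using that ae(2) assms(1-3) by (auto simp: f crosses_def)
    then have "y = c" using bc(1) ce assms(2) by linarith
    moreover have "x = a" using * ae(1) ab assms(1) by linarith
    ultimately show ?thesis by (simp add: f)
  qed
  show "f = (b, e)" if "crosses f (a, c)"
  proof -
    have *: "a < x" "x < c" "c < y"
      using that ae(1) assms(1-3) by (auto simp: f crosses_def)
    then have "x = b" using ab bc(2) assms(2) by linarith
    moreover have "y = e" using * ce ae(2) assms(3) by linarith
    ultimately show ?thesis by (simp add: f)
  qed
qed

lemma crosses_sym: "crosses e f \<longleftrightarrow> crosses f e"
  by (auto simp: crosses_def)

text \<open>Maximality is inherited because the four sides stay: an arc crossing nothing in the new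
  set either avoids the removed diagonal too or, crossing it but no side, is the new
  diagonal.\<close>

lemma triangulation_flip:
  assumes S: "triangulation n S" and quad: "quadrilateral n S a b c e"
    and diag: "(f = (a, c) \<and> f' = (b, e)) \<or> (f = (b, e) \<and> f' = (a, c))" and f: "f \<in> S"
  shows "triangulation n (insert f' (S - {f}))" "f' \<notin> S"
proof -
  have ord: "a < b" "b < c" "c < e" "e \<le> n + 1" using quad by (auto simp: quadrilateral_def)
  have sides: "is_side n S (a, b)" "is_side n S (b, c)" "is_side n S (c, e)" "is_side n S (a, e)"
    using quad by (auto simp: quadrilateral_def)
  have S1: "\<And>g. g \<in> S \<Longrightarrow> is_edge n g \<and> \<not> boundary n g" "\<And>g h. g \<in> S \<Longrightarrow> h \<in> S \<Longrightarrow> \<not> crosses g h"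
    and S2: "\<And>g. is_edge n g \<Longrightarrow> \<forall>h\<in>S. \<not> crosses g h \<Longrightarrow> g \<in> S \<or> boundary n g"
    using S unfolding triangulation_def by blast+
  have cr: "crosses f f'" "crosses f' f" using diag ord by (auto simp: crosses_def)
  show f': "f' \<notin> S" using S1(2)[OF f] cr by blast
  have self: "\<not> crosses g g" for g by (auto simp: crosses_def)
  have edge: "is_edge n f'" "\<not> boundary n f'" "f' \<noteq> (a, b)" "f' \<noteq> (b, c)" "f' \<noteq> (c, e)" "f' \<noteq> (a, e)"
    using diag ord by (auto simp: is_edge_def boundary_def)
  have new: "crosses g f' \<Longrightarrow> g = f" "crosses g f \<Longrightarrow> g = f'"
    if "is_edge n g" "\<not> crosses g (a, b)" "\<not> crosses g (b, c)" "\<not> crosses g (c, e)" "\<not> crosses g (a, e)" for g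
    using crosses_diagonal[OF ord(1-3) _ that(2-5)] that(1) diag unfolding is_edge_def by blast+
  have old: "\<not> crosses g f'" if "g \<in> S - {f}" for g
    using new(1)[of g] that S1(1)[of g] side_not_crosses[OF S sides(1), of g]
      side_not_crosses[OF S sides(2), of g] side_not_crosses[OF S sides(3), of g]
      side_not_crosses[OF S sides(4), of g] by blast
  show "triangulation n (insert f' (S - {f}))"
    unfolding triangulation_def
  proof (intro conjI ballI allI impI)
    fix g assume "g \<in> insert f' (S - {f})"
    then show "is_edge n g" "\<not> boundary n g" using S1(1) edge by blast+
  next
    fix g h assume "g \<in> insert f' (S - {f})" "h \<in> insert f' (S - {f})"
    then show "\<not> crosses g h" using S1(2) old self crosses_sym by blast
  next
    fix g assume g: "is_edge n g" "\<forall>h\<in>insert f' (S - {f}). \<not> crosses g h"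
    have "\<not> crosses g h" if "is_side n S h" "h \<noteq> f" for h
      using that g boundary_not_crosses unfolding is_side_def by blast
    moreover have "(a, b) \<noteq> f" "(b, c) \<noteq> f" "(c, e) \<noteq> f" "(a, e) \<noteq> f" using diag ord by auto
    ultimately have "crosses g f \<Longrightarrow> g = f'" using new(2)[OF g(1)] sides by blast
    then show "g \<in> insert f' (S - {f}) \<or> boundary n g"
      using S2[OF g(1)] g(2) cr(1) by blast
  qed
qed

lemma fan_triangulation: "triangulation n ((\<lambda>i. (0, i + 1)) ` {1..n - 1})" (is "triangulation n ?S")
proof -
  have S: "?S = {(0, j) | j. 2 \<le> j \<and> j \<le> n}"
  proof (intro equalityI subsetI)
    fix p :: "nat \<times> nat" assume "p \<in> {(0, j) | j. 2 \<le> j \<and> j \<le> n}"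
    then obtain j where "p = (0, j)" "2 \<le> j" "j \<le> n" by blast
    then show "p \<in> ?S" by (intro image_eqI[of _ _ "j - 1"]) auto
  qed auto
  show ?thesis unfolding triangulation_def S
  proof (intro conjI allI impI ballI)
    fix e assume e: "is_edge n e" "\<forall>f\<in>{(0, j) | j. 2 \<le> j \<and> j \<le> n}. \<not> crosses e f"
    obtain x y where xy: "e = (x, y)" "x < y" "y \<le> n + 1" using e(1) by (cases e) (auto simp: is_edge_def)
    have "y = x + 1" if "x \<noteq> 0"
    proof (rule ccontr)
      assume "y \<noteq> x + 1"
      \<comment> \<open>Here \<open>x + 1 < y\<close>, so the fan diagonal ending at
        \<open>x + 1\<close> separates \<open>x\<close> from \<open>y\<close>.\<close>
      then have "crosses e (0, x + 1)" using xy that by (simp add: crosses_def)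
      then show False using e(2) xy that \<open>y \<noteq> x + 1\<close> by force
    qed
    then show "e \<in> {(0, j) | j. 2 \<le> j \<and> j \<le> n} \<or> boundary n e"
      using xy by (cases "x = 0") (auto simp: boundary_def)
  qed (auto simp: is_edge_def boundary_def crosses_def)
qed

section \<open>Mutation of compatible pairs\<close>

definition compatible_pair :: "nat \<Rightarrow> int_matrix \<Rightarrow> int_matrix \<Rightarrow> bool" where
  "compatible_pair N B \<Lambda> \<longleftrightarrow> (\<forall>i\<in>{1..N}. \<forall>j\<in>{1..N}. B j i = - B i j \<and> \<Lambda> j i = - \<Lambda> i j \<and>
     (\<Sum>s\<in>{1..N}. B s i * \<Lambda> s j) = of_bool (i = j))"

lemma compatible_pairD:
  assumes "compatible_pair N B \<Lambda>" "i \<in> {1..N}" "j \<in> {1..N}"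
  shows "B j i = - B i j" "\<Lambda> j i = - \<Lambda> i j" "(\<Sum>s\<in>{1..N}. B s i * \<Lambda> s j) = of_bool (i = j)"
  using assms unfolding compatible_pair_def by blast+

text \<open>The form is invertible: \<open>v\<close> times \<open>\<Lambda>\<close> times
  \<open>B\<close> is evaluated once by the hypothesis on \<open>v\<close> and once by
  compatibility, and skew symmetry turns the row into the column.\<close>

lemma compatible_pair_column:
  assumes cp: "compatible_pair N B \<Lambda>" and k: "k \<in> {1..N}" and l: "l \<in> {1..N}"
    and v: "\<And>j. j \<in> {1..N} \<Longrightarrow> (\<Sum>i\<in>{1..N}. v i * \<Lambda> i j) = of_bool (j = k)"
  shows "B l k = v l"
proof -
  have "(\<Sum>j\<in>{1..N}. \<Sum>i\<in>{1..N}. v i * \<Lambda> i j * B j l) = (\<Sum>j\<in>{1..N}. of_bool (j = k) * B j l)"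
    using v by (simp flip: sum_distrib_right)
  also have "\<dots> = B k l" using k by (simp add: of_bool_def if_distrib[of "\<lambda>x. x * _"] sum.delta cong: if_cong)
  finally have 1: "(\<Sum>j\<in>{1..N}. \<Sum>i\<in>{1..N}. v i * \<Lambda> i j * B j l) = B k l" .
  have "(\<Sum>j\<in>{1..N}. \<Sum>i\<in>{1..N}. v i * \<Lambda> i j * B j l) = (\<Sum>i\<in>{1..N}. \<Sum>j\<in>{1..N}. v i * \<Lambda> i j * B j l)"
    by (rule sum.swap)
  also have "\<dots> = (\<Sum>i\<in>{1..N}. - (v i * (\<Sum>j\<in>{1..N}. B j l * \<Lambda> j i)))"
    unfolding sum_distrib_left sum_negf[symmetric]
  proof (intro sum.cong refl)
    fix i j assume "i \<in> {1..N}" "j \<in> {1..N}"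
    then have "\<Lambda> i j = - \<Lambda> j i" by (rule compatible_pairD(2)[OF cp, rotated])
    then show "v i * \<Lambda> i j * B j l = - (v i * (B j l * \<Lambda> j i))" by simp
  qed
  also have "\<dots> = (\<Sum>i\<in>{1..N}. if i = l then - v i else 0)"
    by (intro sum.cong refl) (use compatible_pairD(3)[OF cp l] in auto)
  also have "\<dots> = - v l" using l by simp
  finally show ?thesis using 1 compatible_pairD(1)[OF cp k l] by simp
qed

text \<open>One-sided application of the transpose of \<open>E\<close>. The congruence
  \<open>mutate_form\<close> applies it in both indices, so these can be treated one at a
  time.\<close>

definition mutate_row :: "nat \<Rightarrow> nat \<Rightarrow> int_matrix \<Rightarrow> (nat \<Rightarrow> int) \<Rightarrow> nat \<Rightarrow> int" where
  "mutate_row N k B \<phi> i = (\<Sum>s\<in>{1..N}. form_change k B s i * \<phi> s)"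

lemma mutate_row_other: "i \<in> {1..N} \<Longrightarrow> i \<noteq> k \<Longrightarrow> mutate_row N k B \<phi> i = \<phi> i"
proof -
  assume "i \<in> {1..N}" "i \<noteq> k"
  then have "mutate_row N k B \<phi> i = (\<Sum>s\<in>{1..N}. if s = i then \<phi> s else 0)"
    unfolding mutate_row_def by (intro sum.cong refl) (auto simp: form_change_def)
  then show ?thesis using \<open>i \<in> {1..N}\<close> by simp
qed

lemma mutate_row_k:
  assumes "k \<in> {1..N}" "B k k = 0"
  shows "mutate_row N k B \<phi> k = (\<Sum>s\<in>{1..N}. max (- B s k) 0 * \<phi> s) - \<phi> k"
proof -
  have "mutate_row N k B \<phi> k = (\<Sum>s\<in>{1..N}. max (- B s k) 0 * \<phi> s - (if s = k then \<phi> s else 0))"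
    unfolding mutate_row_def by (intro sum.cong refl) (auto simp: form_change_def assms)
  then show ?thesis using assms by (simp add: sum_subtractf)
qed

lemma mutate_form_row:
  "mutate_form N k B \<Lambda> i j = mutate_row N k B (\<lambda>s. mutate_row N k B (\<Lambda> s) j) i"
  unfolding mutate_form_def mutate_row_def sum_distrib_left by (intro sum.cong refl) (simp add: mult_ac)

text \<open>With \<open>B'\<close> the mutated matrix this is the matrix identity
  \<open>B'^T E^T = E B^T\<close>, applied to the vector \<open>\<phi>\<close>.\<close>

lemma mutate_matrix_row:
  assumes k: "k \<in> {1..N}" and l: "l \<in> {1..N}" and B: "B k k = 0" "\<And>i. i \<in> {1..N} \<Longrightarrow> B i l = - B l i"
  shows "(\<Sum>i\<in>{1..N}. mutate_matrix k B i l * mutate_row N k B \<phi> i) =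
    (if l = k then - (\<Sum>i\<in>{1..N}. B i k * \<phi> i)
     else (\<Sum>i\<in>{1..N}. B i l * \<phi> i) + max (B k l) 0 * (\<Sum>i\<in>{1..N}. B i k * \<phi> i))"
proof -
  let ?b = "mutate_matrix k B k l"
  have "(\<Sum>i\<in>{1..N}. mutate_matrix k B i l * mutate_row N k B \<phi> i) =
      ?b * mutate_row N k B \<phi> k + (\<Sum>i\<in>{1..N} - {k}. mutate_matrix k B i l * \<phi> i)"
    using k by (subst sum.remove[of _ k]) (auto intro!: sum.cong simp: mutate_row_other)
  also have "(\<Sum>i\<in>{1..N} - {k}. mutate_matrix k B i l * \<phi> i) =
      (\<Sum>i\<in>{1..N}. mutate_matrix k B i l * \<phi> i) - ?b * \<phi> k"
    using k by (subst sum.remove[of "{1..N}" k]) auto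
  \<comment> \<open>The entry at \<open>k\<close> is itself a sum over all \<open>i\<close>.
    Spreading it over the other summands makes the identity checkable index by index, according to
    the signs of \<open>B i k\<close> and \<open>B k l\<close>.\<close>
  also have "?b * mutate_row N k B \<phi> k + ((\<Sum>i\<in>{1..N}. mutate_matrix k B i l * \<phi> i) - ?b * \<phi> k) =
      (\<Sum>i\<in>{1..N}. ?b * max (- B i k) 0 * \<phi> i + mutate_matrix k B i l * \<phi> i) - 2 * ?b * \<phi> k"
    unfolding mutate_row_k[where B=B, OF k B(1)] by (simp add: sum.distrib sum_distrib_left algebra_simps)
  also have "(\<Sum>i\<in>{1..N}. ?b * max (- B i k) 0 * \<phi> i + mutate_matrix k B i l * \<phi> i) - 2 * ?b * \<phi> k =
    (\<Sum>i\<in>{1..N}. ?b * max (- B i k) 0 * \<phi> i + mutate_matrix k B i l * \<phi> i - (if i = k then 2 * ?b * \<phi> i else 0))"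
    using k by (simp add: sum_subtractf)
  also have "\<dots> = (\<Sum>i\<in>{1..N}. if l = k then - B i k * \<phi> i else B i l * \<phi> i + max (B k l) 0 * (B i k * \<phi> i))"
  proof (intro sum.cong refl)
    fix i
    show "?b * max (- B i k) 0 * \<phi> i + mutate_matrix k B i l * \<phi> i - (if i = k then 2 * ?b * \<phi> i else 0) =
      (if l = k then - B i k * \<phi> i else B i l * \<phi> i + max (B k l) 0 * (B i k * \<phi> i))"
      using B(1) by (cases "l = k"; cases "i = k"; cases "B i k \<ge> 0"; cases "B k l \<ge> 0")
        (simp_all add: mutate_matrix_def algebra_simps)
  qed
  also have "\<dots> = (if l = k then - (\<Sum>i\<in>{1..N}. B i k * \<phi> i)
     else (\<Sum>i\<in>{1..N}. B i l * \<phi> i) + max (B k l) 0 * (\<Sum>i\<in>{1..N}. B i k * \<phi> i))"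
    by (simp add: sum.distrib sum_distrib_left sum_negf)
  finally show ?thesis .
qed

lemma compatible_pair_mutate:
  assumes cp: "compatible_pair N B \<Lambda>" and k: "k \<in> {1..N}"
  shows "compatible_pair N (mutate_matrix k B) (mutate_form N k B \<Lambda>)"
  unfolding compatible_pair_def
proof (intro ballI conjI)
  fix l j assume l: "l \<in> {1..N}" and j: "j \<in> {1..N}"
  note skew = compatible_pairD(1)[OF cp]
  have B0: "B k k = 0" using skew[OF k k] by simp
  show "mutate_matrix k B j l = - mutate_matrix k B l j"
    using skew[OF l j] skew[OF l k] skew[OF j k] by (simp add: mutate_matrix_def mult.commute)
  show "mutate_form N k B \<Lambda> j l = - mutate_form N k B \<Lambda> l j"
  proof -
    have "mutate_form N k B \<Lambda> j l = (\<Sum>t\<in>{1..N}. \<Sum>s\<in>{1..N}. form_change k B s j * \<Lambda> s t * form_change k B t l)"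
      unfolding mutate_form_def by (rule sum.swap)
    also have "\<dots> = (\<Sum>t\<in>{1..N}. \<Sum>s\<in>{1..N}. - (form_change k B t l * \<Lambda> t s * form_change k B s j))"
    proof (intro sum.cong refl)
      fix t s assume "t \<in> {1..N}" "s \<in> {1..N}"
      then have "\<Lambda> s t = - \<Lambda> t s" by (rule compatible_pairD(2)[OF cp])
      then show "form_change k B s j * \<Lambda> s t * form_change k B t l =
          - (form_change k B t l * \<Lambda> t s * form_change k B s j)" by simp
    qed
    finally show ?thesis by (simp add: mutate_form_def sum_negf)
  qed
  let ?\<phi> = "\<lambda>s. mutate_row N k B (\<Lambda> s) j"
  have pair: "(\<Sum>s\<in>{1..N}. B s i * ?\<phi> s) = form_change k B i j" if i: "i \<in> {1..N}" for i
  proof -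
    have "(\<Sum>s\<in>{1..N}. B s i * ?\<phi> s) = (\<Sum>s\<in>{1..N}. \<Sum>t\<in>{1..N}. form_change k B t j * (B s i * \<Lambda> s t))"
      unfolding mutate_row_def sum_distrib_left by (simp add: mult_ac)
    also have "\<dots> = (\<Sum>t\<in>{1..N}. form_change k B t j * (\<Sum>s\<in>{1..N}. B s i * \<Lambda> s t))"
      unfolding sum_distrib_left by (rule sum.swap)
    also have "\<dots> = (\<Sum>t\<in>{1..N}. if t = i then form_change k B t j else 0)"
      by (intro sum.cong refl) (use compatible_pairD(3)[OF cp i] in auto)
    finally show ?thesis using i by simp
  qed
  \<comment> \<open>Compatibility reduces \<open>B^T \<Lambda> E\<close> to \<open>E\<close>, so the
    new pairing is \<open>E\<close> times \<open>E\<close>; this is the identity.\<close>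
  have "(\<Sum>i\<in>{1..N}. mutate_matrix k B i l * mutate_form N k B \<Lambda> i j) =
      (if l = k then - form_change k B k j else form_change k B l j + max (B k l) 0 * form_change k B k j)"
    unfolding mutate_form_row using mutate_matrix_row[where B=B and \<phi>="?\<phi>", OF k l B0] skew[OF l] pair[OF k] pair[OF l] by simp
  then show "(\<Sum>i\<in>{1..N}. mutate_matrix k B i l * mutate_form N k B \<Lambda> i j) = of_bool (l = j)"
    using skew[OF l k] by (auto simp: form_change_def)
qed

section \<open>Seeds in the division ring of fractions\<close>

locale type_A_fractions = type_A_torus n q r for n and q r :: "'k::field" +
  fixes D :: "('d, 'm) ring_scheme" (structure) and \<iota> :: "((nat \<Rightarrow>\<^sub>0 int) \<Rightarrow>\<^sub>0 'k) \<Rightarrow> 'd"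
  assumes fractions: "division_ring_of_fractions T D \<iota>"
begin

lemma division_ring: "is_division_ring D"
  using fractions by (simp add: division_ring_of_fractions_def)

sublocale R: ring D using division_ring by (simp add: is_division_ring_def)

lemma Units_D: "Units D = carrier D - {\<zero>}"
  using division_ring by (simp add: is_division_ring_def)

lemma \<iota>_hom: "\<iota> \<in> ring_hom T D" and \<iota>_inj: "inj_on \<iota> (carrier T)"
  using fractions by (auto simp: division_ring_of_fractions_def)

lemma \<iota>_closed [simp]: "x \<in> carrier T \<Longrightarrow> \<iota> x \<in> carrier D"
  by (rule ring_hom_closed[OF \<iota>_hom])

lemma \<iota>_mult: "x \<in> carrier T \<Longrightarrow> y \<in> carrier T \<Longrightarrow> \<iota> (x \<star> y) = \<iota> x \<otimes> \<iota> y"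
  using ring_hom_mult[OF \<iota>_hom] by (simp add: T_simps)

lemma \<iota>_add: "x \<in> carrier T \<Longrightarrow> y \<in> carrier T \<Longrightarrow> \<iota> (x + y) = \<iota> x \<oplus> \<iota> y"
  using ring_hom_add[OF \<iota>_hom] by (simp add: T_simps)

lemma \<iota>_one: "\<iota> (torus_scalar 1) = \<one>"
  using ring_hom_one[OF \<iota>_hom] by (simp add: T_simps)

lemmas T_sub = is_subringD[OF carrier_subring]

lemma \<iota>_zero: "\<iota> 0 = \<zero>"
  using \<iota>_add[of 0 0] T_sub(2) R.add.r_cancel_one'[of "\<iota> 0" "\<iota> 0"] by simp

lemma \<iota>_uminus: "x \<in> carrier T \<Longrightarrow> \<iota> (- x) = \<ominus> \<iota> x"
  using \<iota>_add[of "- x" x] T_sub(3)[of x] by (simp add: \<iota>_zero R.minus_equality)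

lemma \<iota>_diff: "x \<in> carrier T \<Longrightarrow> y \<in> carrier T \<Longrightarrow> \<iota> (x - y) = \<iota> x \<ominus> \<iota> y"
  using \<iota>_add[of x "- y"] T_sub(3)[of y] by (simp add: \<iota>_uminus a_minus_def)

lemma \<iota>_unit: "x \<in> carrier T \<Longrightarrow> x \<noteq> 0 \<Longrightarrow> \<iota> x \<in> Units D"
  using inj_onD[OF \<iota>_inj, of x 0] T_sub(2) by (auto simp: Units_D \<iota>_zero)

lemma scalar_closed [simp]: "torus_scalar c \<in> carrier T"
  using Mon_closed[of 0 c] by (simp add: Mon_scalar)

lemma fraction_cases:
  assumes "z \<in> carrier D"
  obtains x y where "x \<in> carrier T" "y \<in> carrier T" "y \<noteq> 0" "z = \<iota> x \<otimes> inv (\<iota> y)"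
  using assms fractions unfolding division_ring_of_fractions_def T_simps by blast

text \<open>Commuting with \<open>\<iota> y\<close> passes to its inverse, and every element of
  \<open>D\<close> is a fraction.\<close>

lemma scalar_central:
  assumes "z \<in> carrier D"
  shows "\<iota> (torus_scalar c) \<otimes> z = z \<otimes> \<iota> (torus_scalar c)"
proof -
  obtain x y where xy: "x \<in> carrier T" "y \<in> carrier T" "y \<noteq> 0" "z = \<iota> x \<otimes> inv (\<iota> y)"
    by (rule fraction_cases[OF assms])
  let ?c = "\<iota> (torus_scalar c)"
  have comm: "?c \<otimes> \<iota> w = \<iota> w \<otimes> ?c" if "w \<in> carrier T" for w
    using that by (simp add: scalar_commute flip: \<iota>_mult)
  have y: "\<iota> y \<in> Units D" using \<iota>_unit xy by blast
  have "inv (\<iota> y) \<otimes> (?c \<otimes> \<iota> y) \<otimes> inv (\<iota> y) = inv (\<iota> y) \<otimes> (\<iota> y \<otimes> ?c) \<otimes> inv (\<iota> y)"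
    using comm xy(2) by simp
  moreover have "inv (\<iota> y) \<otimes> (?c \<otimes> \<iota> y) \<otimes> inv (\<iota> y) = inv (\<iota> y) \<otimes> ?c"
    using y xy(2) by (simp add: R.m_assoc R.Units_r_inv)
  moreover have "inv (\<iota> y) \<otimes> (\<iota> y \<otimes> ?c) \<otimes> inv (\<iota> y) = ?c \<otimes> inv (\<iota> y)"
    using y xy(2) by (simp add: R.Units_l_inv flip: R.m_assoc[of _ "\<iota> y"])
  ultimately have "?c \<otimes> inv (\<iota> y) = inv (\<iota> y) \<otimes> ?c" by simp
  then show ?thesis using xy y comm[OF xy(1)]
    by (metis R.Units_inv_closed R.m_assoc \<iota>_closed scalar_closed)
qed

definition sc :: "int \<Rightarrow> 'd" where "sc k = \<iota> (torus_scalar (r powi k))"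

lemma sc_unit: "sc k \<in> Units D"
proof -
  have "torus_scalar (r powi k) \<noteq> 0"
    using r_nz by (metis lookup_single_eq lookup_zero power_int_not_zero torus_scalar_def)
  then show ?thesis unfolding sc_def by (intro \<iota>_unit scalar_closed)
qed

lemma scalar_group: "scalar_group (units_of D) sc"
proof -
  interpret G: group "units_of D" by (rule R.units_group)
  show ?thesis
    by unfold_locales
      (use sc_unit scalar_central r_nz in \<open>auto simp: units_of_carrier units_of_mult sc_def scalar_mul power_int_add
        R.Units_closed simp flip: \<iota>_mult\<close>)
qed

lemma int_pow_units: "x \<in> Units D \<Longrightarrow> x [^]\<^bsub>units_of D\<^esub> (k::int) = x [^] k"
proof -
  assume x: "x \<in> Units D"
  interpret G: group "units_of D" by (rule R.units_group)
  have "x [^] m \<in> Units D" for m :: nat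
    using G.nat_pow_closed[of x m] R.units_of_pow[OF x, of m] x by (simp add: units_of_carrier)
  then show ?thesis
    using x by (cases k rule: int_cases2)
      (auto simp: int_pow_int R.units_of_pow int_pow_def2 R.units_of_inv units_of_one simp del: pow_nat)
qed

text \<open>On units, integer powers in \<open>D\<close> agree with those of the unit group, so the
  monomials of a mutation can be computed in the group.\<close>

lemma cluster_monomial_eq:
  assumes "quasi_cluster (units_of D) sc (n - 1) x \<Lambda>"
  shows "cluster_monomial D (\<lambda>c. \<iota> (torus_scalar c)) r (n - 1) x \<Lambda> c =
    quasi_cluster.monomial (units_of D) sc (n - 1) x \<Lambda> c"
proof -
  interpret quasi_cluster "units_of D" sc "n - 1" x \<Lambda> by (rule assms)
  have fold: "foldr (\<lambda>i y. (x i [^] c i) \<otimes> y) l \<one> =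
      foldr (\<lambda>i y. (x i [^]\<^bsub>units_of D\<^esub> c i) \<otimes>\<^bsub>units_of D\<^esub> y) l \<one>\<^bsub>units_of D\<^esub>" if "set l \<subseteq> {1..n - 1}" for l
    using that
  proof (induction l)
    case (Cons i l)
    then have "x i \<in> Units D" using x_closed[of i] by (simp add: units_of_carrier)
    then show ?case using Cons by (simp add: int_pow_units units_of_mult)
  qed (simp add: units_of_one)
  have *: "foldr (\<lambda>i y. (x i [^] c i) \<otimes> y) [1..<Suc (n - 1)] \<one> = tail 1 c"
    unfolding tail_def by (rule fold) auto
  show ?thesis
    unfolding cluster_monomial_def monomial_def upper_form_def sc_def units_of_mult * ..
qed

section \<open>Arcs and their leading degrees as seed data\<close>

definition arcp :: "nat \<times> nat \<Rightarrow> ((nat \<Rightarrow>\<^sub>0 int) \<Rightarrow>\<^sub>0 'k)" where "arcp e = arc (fst e) (snd e)"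
definition degp :: "nat \<times> nat \<Rightarrow> (nat \<Rightarrow>\<^sub>0 int)" where "degp e = arc_deg (fst e) (snd e)"

lemma arcp_closed [simp]: "arcp e \<in> carrier T" by (simp add: arcp_def arc_closed)

text \<open>The term at \<open>a\<close> cannot cancel: \<open>omega\<close> takes the value 1 or -1
  on two different triangles, so their exponents differ. Nonvanishing makes arcs invertible in
  \<open>D\<close>.\<close>

lemma arcp_nonzero:
  assumes "is_edge n e" shows "arcp e \<noteq> 0"
proof -
  obtain a b where e: "e = (a, b)" "a < b" "b \<le> n + 1" using assms by (cases e) (auto simp: is_edge_def)
  define v where "v = (\<lambda>t. fan a + fan b - fan2 t)"
  have a: "a \<in> wedges a b" using e by (simp add: wedges_def)
  have "t = a" if "t \<in> wedges a b" "v t = v a" for t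
  proof (rule ccontr)
    assume ne: "t \<noteq> a"
    then have "1 \<le> a" "1 \<le> t" "t \<le> n" "a \<le> n" using that(1) e by (auto simp: wedges_def split: if_splits)
    moreover have "omega (fan2 t) (fan2 a) = 0" using that(2) by (simp add: v_def)
    ultimately show False using omega_fan2_fan2[of t a] ne by (cases t a rule: linorder_cases) auto
  qed
  then have "Poly_Mapping.lookup (Mon 1 (v t)) (v a) = (if t = a then r powi tw (v a) (v a) else 0)"
    if "t \<in> wedges a b" for t using that by (auto simp: Mon_def lookup_single when_def)
  then have "(\<Sum>t\<in>wedges a b. Poly_Mapping.lookup (Mon 1 (v t)) (v a)) =
      (\<Sum>t\<in>wedges a b. if t = a then r powi tw (v a) (v a) else 0)" by (intro sum.cong refl)
  also have "\<dots> = r powi tw (v a) (v a)" using a by (subst sum.delta) (auto simp: wedges_def)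
  finally have "Poly_Mapping.lookup (arc a b) (v a) = r powi tw (v a) (v a)"
    by (simp add: arc_def lookup_sum v_def)
  then show ?thesis using r_nz by (auto simp: e arcp_def)
qed

lemma boundary_trivial: "boundary n p \<Longrightarrow> arcp p = torus_scalar 1 \<and> degp p = 0"
  by (cases p) (auto simp: boundary_def arcp_def degp_def arc_boundary arc_deg_def)

text \<open>By the second identity both diagonals together have the degree of the sides
  \<open>(a, e)\<close> and \<open>(b, c)\<close>, which gives the degree of the flipped diagonal.
  The first gives the difference vector that detects the two diagonals.\<close>

lemma quadrilateral_degrees:
  "degp (a, b) + degp (c, e) - (degp (a, e) + degp (b, c)) = fan2 b - fan2 c"
  "degp (a, c) + degp (b, e) = degp (a, e) + degp (b, c)"
  by (simp_all add: degp_def arc_deg_def fan2_def)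

text \<open>This determines the exchange matrix: a compatible pair is determined by its form, so the
  column of a diagonal is read off from the sides of the quadrilateral around it and never has to
  be computed from the mutation rule.\<close>

lemma quadrilateral_pairing:
  assumes S: "triangulation n S" and quad: "quadrilateral n S a b c e" and p: "p \<in> S \<or> boundary n p \<and> is_edge n p"
  shows "omega (fan2 b - fan2 c) (degp p) = of_bool (p = (a, c)) - of_bool (p = (b, e))"
proof -
  have ord: "a < b" "b < c" "c < e" "e \<le> n + 1" using quad by (auto simp: quadrilateral_def)
  obtain x y where xy: "p = (x, y)" by (cases p)
  have edge: "x < y" "y \<le> n + 1" using S p by (auto simp: triangulation_def is_edge_def xy)
  have "\<not> crosses p f" if "is_side n S f" "is_edge n f" for f
    using p side_not_crosses[OF S that(1)] boundary_not_crosses[of n p f] that(2) crosses_sym by blast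
  then have nc: "\<not> crosses p (a, b)" "\<not> crosses p (b, c)" "\<not> crosses p (c, e)" "\<not> crosses p (a, e)"
    using quad by (auto simp: quadrilateral_def is_edge_def)
  \<comment> \<open>The parity contributions of \<open>fan2 b\<close> and \<open>fan2 c\<close>
    cancel, and each endpoint of \<open>p\<close> counts by its position relative to the interval
    from \<open>b\<close> to \<open>c\<close>.\<close>
  have om: "omega (fan2 b - fan2 c) (degp p) = of_bool (b < y \<and> y \<le> c) - of_bool (b \<le> x \<and> x < c)"
    using ord edge by (simp add: xy degp_def arc_deg_def omega_linear omega_fan2_fan)
  show ?thesis
  proof (cases "p = (a, c) \<or> p = (b, e)")
    case True
    then show ?thesis unfolding om using ord by (auto simp: xy)
  next
    case False
    have "fst p < snd p" using edge(1) xy by simp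
    then have "\<not> crosses p (b, e)" "\<not> crosses p (a, c)"
      using crosses_diagonal[OF ord(1-3) _ nc] False by blast+
    then have be: "\<not> (x < b \<and> b < y \<and> y < e)" and ac: "\<not> (a < x \<and> x < c \<and> c < y)"
      by (auto simp: crosses_def xy)
    have "b \<le> x \<and> x < c" if "b < y \<and> y \<le> c" using that be edge(1) ord(3) by linarith
    moreover have "b < y \<and> y \<le> c" if "b \<le> x \<and> x < c" using that ac edge(1) ord(1) by linarith
    ultimately have "b < y \<and> y \<le> c \<longleftrightarrow> b \<le> x \<and> x < c" by blast
    then show ?thesis unfolding om using False by simp
  qed
qed

text \<open>The invariant of all mutation sequences: \<open>d\<close> names the arcs of the cluster,
  and the form is that of their leading degrees. \<open>B\<close> enters through compatibility,
  which determines it.\<close>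

definition seed_ok :: "(nat \<Rightarrow> nat \<times> nat) \<Rightarrow> (nat \<Rightarrow> 'd) \<Rightarrow> int_matrix \<Rightarrow> int_matrix \<Rightarrow> bool" where
  "seed_ok d x B \<Lambda> \<longleftrightarrow> inj_on d {1..n - 1} \<and> triangulation n (d ` {1..n - 1}) \<and>
     compatible_pair (n - 1) B \<Lambda> \<and>
     (\<forall>i\<in>{1..n - 1}. x i = \<iota> (arcp (d i))) \<and>
     (\<forall>i\<in>{1..n - 1}. \<forall>j\<in>{1..n - 1}. \<Lambda> i j = omega (degp (d i)) (degp (d j)) \<and>
        x i \<otimes> x j = sc (2 * \<Lambda> i j) \<otimes> (x j \<otimes> x i))"

lemma seed_ok_mutate:
  assumes ok: "seed_ok d x B \<Lambda>" and k: "k \<in> {1..n - 1}"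
    and quad: "quadrilateral n (d ` {1..n - 1}) a b c e"
    and diag: "d k = (a, c) \<and> f' = (b, e) \<or> d k = (b, e) \<and> f' = (a, c)"
  shows "seed_ok (d(k := f')) (mutate_cluster D (\<lambda>c. \<iota> (torus_scalar c)) r (n - 1) k x B \<Lambda>)
    (mutate_matrix k B) (mutate_form (n - 1) k B \<Lambda>)"
proof -
  define N where "N = n - 1"
  define S where "S = d ` {1..N}"
  note ok' = ok[unfolded seed_ok_def, folded N_def]
  have inj: "inj_on d {1..N}" and S: "triangulation n S" and cp: "compatible_pair N B \<Lambda>"
    using ok' by (auto simp: S_def)
  have x: "x i = \<iota> (arcp (d i))" if "i \<in> {1..N}" for i using ok' that by blast
  have Lam: "\<Lambda> i j = omega (degp (d i)) (degp (d j))" if "i \<in> {1..N}" "j \<in> {1..N}" for i j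
    using ok' that by blast
  have xx: "x i \<otimes> x j = sc (2 * \<Lambda> i j) \<otimes> (x j \<otimes> x i)" if "i \<in> {1..N}" "j \<in> {1..N}" for i j
    using ok' that by blast
  have k: "k \<in> {1..N}" and quad: "quadrilateral n S a b c e"
    using k quad by (auto simp: N_def S_def)
  have ord: "a < b" "b < c" "c < e" "e \<le> n + 1" using quad by (auto simp: quadrilateral_def)
  have sides: "is_side n S (a, b)" "is_side n S (b, c)" "is_side n S (c, e)" "is_side n S (a, e)"
    using quad by (auto simp: quadrilateral_def)
  have dS: "d i \<in> S" if "i \<in> {1..N}" for i using that by (simp add: S_def)
  have edge: "is_edge n (d i)" if "i \<in> {1..N}" for i using dS[OF that] S by (auto simp: triangulation_def)
  have xU: "x i \<in> Units D" if "i \<in> {1..N}" for i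
    using \<iota>_unit[OF arcp_closed arcp_nonzero[OF edge[OF that]]] x[OF that] by simp
  have xC: "x i \<in> carrier D" if "i \<in> {1..N}" for i using x[OF that] by simp
  interpret sg: scalar_group "units_of D" sc by (rule scalar_group)
  have qc: "quasi_cluster (units_of D) sc N x \<Lambda>"
  proof unfold_locales
    fix i j assume ij: "i \<in> {1..N}" "j \<in> {1..N}"
    show "\<Lambda> j i = - \<Lambda> i j" by (rule compatible_pairD(2)[OF cp ij])
    show "sg.qcomm (2 * \<Lambda> i j) (x i) (x j)" unfolding sg.qcomm_def units_of_mult by (rule xx[OF ij])
  qed (simp add: units_of_carrier xU)
  interpret Q: quasi_cluster "units_of D" sc N x \<Lambda> by (rule qc)
  note cm = cluster_monomial_eq[folded N_def, OF qc]
  have MU: "Q.monomial c \<in> Units D" and MC: "Q.monomial c \<in> carrier D" for c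
    using Q.monomial_closed[of c] by (auto simp: units_of_carrier R.Units_closed)
  \<comment> \<open>The exponent vector of the edge \<open>p\<close> in the current cluster; it is
    zero for boundary edges, whose value is 1.\<close>
  define I where "I = (\<lambda>p i. of_bool (d i = p) :: int)"
  have I_sum: "(\<Sum>i\<in>{1..N}. I p i * g (degp (d i))) = g (degp p)"
    if "is_side n S p" and g: "g 0 = 0" for p and g :: "(nat \<Rightarrow>\<^sub>0 int) \<Rightarrow> int"
  proof (cases "p \<in> S")
    case True
    then obtain i0 where i0: "i0 \<in> {1..N}" "p = d i0" by (auto simp: S_def)
    have "d i = p \<longleftrightarrow> i = i0" if "i \<in> {1..N}" for i
      using inj_on_eq_iff[OF inj that i0(1)] i0(2) by simp
    then have "(\<Sum>i\<in>{1..N}. I p i * g (degp (d i))) = (\<Sum>i\<in>{1..N}. if i = i0 then g (degp (d i)) else 0)"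
      by (intro sum.cong refl) (simp add: I_def)
    then show ?thesis using i0 by simp
  next
    case False
    then have "(\<Sum>i\<in>{1..N}. I p i * g (degp (d i))) = 0" by (auto simp: I_def S_def intro!: sum.neutral)
    moreover have "degp p = 0" using False that boundary_trivial by (simp add: is_side_def)
    ultimately show ?thesis using g by simp
  qed
  have I_mon: "Q.monomial (I p) = \<iota> (arcp p)" if "is_side n S p" for p
  proof (cases "p \<in> S")
    case True
    then obtain i0 where i0: "i0 \<in> {1..N}" "p = d i0" by (auto simp: S_def)
    have "d i = p \<longleftrightarrow> i = i0" if "i \<in> {1..N}" for i
      using inj_on_eq_iff[OF inj that i0(1)] i0(2) by simp
    then have "Q.monomial (I p) = Q.monomial (\<lambda>i. of_bool (i = i0))"
      by (intro Q.monomial_cong) (simp add: I_def)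
    then show ?thesis using Q.monomial_gen[OF i0(1)] x[OF i0(1)] i0(2) by simp
  next
    case False
    then have "Q.monomial (I p) = Q.monomial (\<lambda>i. 0)"
      by (intro Q.monomial_cong) (auto simp: I_def S_def)
    moreover have "arcp p = torus_scalar 1" using False that boundary_trivial by (simp add: is_side_def)
    ultimately show ?thesis using Q.monomial_zero \<iota>_one by (simp add: units_of_one)
  qed
  define \<delta>k where "\<delta>k = degp (d k)"
  \<comment> \<open>The exponents of the two exchange monomials: a pair of opposite sides divided by
    the old diagonal.\<close>
  define c1 c2 where "c1 = (\<lambda>i. I (a, b) i + I (c, e) i - of_bool (i = k))"
    and "c2 = (\<lambda>i. I (a, e) i + I (b, c) i - of_bool (i = k))"
  define D1 D2 where "D1 = degp (a, b) + degp (c, e)" and "D2 = degp (a, e) + degp (b, c)"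
  have k_sum: "(\<Sum>i\<in>{1..N}. of_bool (i = k) * g i) = g k" for g :: "nat \<Rightarrow> int"
  proof -
    have "(\<Sum>i\<in>{1..N}. of_bool (i = k) * g i) = (\<Sum>i\<in>{1..N}. if i = k then g i else 0)"
      by (intro sum.cong) auto
    then show ?thesis using k by simp
  qed
  have pair_sum: "(\<Sum>i\<in>{1..N}. (I p i + I p' i - of_bool (i = k)) * g (degp (d i))) =
      g (degp p) + g (degp p') - g \<delta>k"
    if "is_side n S p" "is_side n S p'" "g 0 = 0" for p p' and g :: "(nat \<Rightarrow>\<^sub>0 int) \<Rightarrow> int"
    using I_sum[where g=g, OF that(1,3)] I_sum[where g=g, OF that(2,3)] k_sum[of "\<lambda>i. g (degp (d i))"]
    by (simp add: distrib_right left_diff_distrib sum.distrib sum_subtractf \<delta>k_def)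
  have L: "(\<Sum>i\<in>{1..N}. c1 i * \<Lambda> i j) = omega (D1 - \<delta>k) (degp (d j))"
      "(\<Sum>i\<in>{1..N}. c2 i * \<Lambda> i j) = omega (D2 - \<delta>k) (degp (d j))" if j: "j \<in> {1..N}" for j
    using pair_sum[OF sides(1,3), of "\<lambda>v. omega v (degp (d j))"]
      pair_sum[OF sides(4,2), of "\<lambda>v. omega v (degp (d j))"] Lam[OF _ j]
    by (simp_all add: c1_def c2_def D1_def D2_def omega_linear)
  have D12: "D1 - D2 = fan2 b - fan2 c" and D2': "D2 = degp (a, c) + degp (b, e)"
    using quadrilateral_degrees(1)[of a b c e] quadrilateral_degrees(2)[of a c b e]
    by (simp_all add: D1_def D2_def)
  have orth: "omega (D1 - D2) (degp p) = of_bool (p = (a, c)) - of_bool (p = (b, e))"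
    if "p \<in> S \<or> boundary n p \<and> is_edge n p" for p
    unfolding D12 by (rule quadrilateral_pairing[OF S quad that])
  have sides_edge: "p \<in> S \<or> boundary n p \<and> is_edge n p" if "is_side n S p" "p \<in> {(a, b), (b, c), (c, e), (a, e)}" for p
    using that ord by (auto simp: is_side_def is_edge_def)
  have orth_D: "omega (D1 - D2) D1 = 0" "omega (D1 - D2) D2 = 0"
    using orth[OF sides_edge[OF sides(1)]] orth[OF sides_edge[OF sides(2)]]
      orth[OF sides_edge[OF sides(3)]] orth[OF sides_edge[OF sides(4)]] ord
    by (simp_all add: D1_def D2_def omega_linear)
  have f'S: "f' \<notin> S" "triangulation n (insert f' (S - {d k}))"
    using triangulation_flip[OF S quad _ dS[OF k], of f'] diag by auto
  have dk: "d j = d k \<longleftrightarrow> j = k" "d j \<noteq> f'" if "j \<in> {1..N}" for j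
    using inj_on_eq_iff[OF inj that k] f'S(1) dS[OF that] by auto
  have orth_k: "omega (D1 - D2) (degp (d j)) = 0" if "j \<in> {1..N}" "j \<noteq> k" for j
    using orth[of "d j"] dS[OF that(1)] dk[OF that(1)] that(2) diag by auto
  have f'_deg: "degp f' = D2 - \<delta>k" using D2' diag by (auto simp: \<delta>k_def)
  have ne4: "(a, b) \<noteq> (c, e)" "(a, b) \<noteq> (b, c)" "(a, b) \<noteq> (a, e)" "(c, e) \<noteq> (b, c)" "(c, e) \<noteq> (a, e)" "(b, c) \<noteq> (a, e)"
    using ord by auto
  \<comment> \<open>Up to sign, column \<open>k\<close> of \<open>B\<close>. The four sides are
    different pairs, so the positive and negative parts are the two pairs of opposite sides.\<close>
  define v where "v = (\<lambda>i. I (a, b) i + I (c, e) i - (I (a, e) i + I (b, c) i))"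
  have vmax: "max (v i) 0 = I (a, b) i + I (c, e) i" "max (- v i) 0 = I (a, e) i + I (b, c) i" for i
  proof -
    have "I (a, b) i + I (c, e) i = 0 \<or> I (a, e) i + I (b, c) i = 0"
      using ne4 unfolding I_def by (cases "d i = (a, b) \<or> d i = (c, e)") auto
    moreover have nn: "0 \<le> I p i" for p by (simp add: I_def)
    have "0 \<le> I (a, b) i + I (c, e) i" "0 \<le> I (a, e) i + I (b, c) i" by (rule add_nonneg_nonneg[OF nn nn])+
    ultimately show "max (v i) 0 = I (a, b) i + I (c, e) i" "max (- v i) 0 = I (a, e) i + I (b, c) i"
      unfolding v_def by linarith+
  qed
  have v_pair: "(\<Sum>i\<in>{1..N}. v i * \<Lambda> i j) = omega (D1 - D2) (degp (d j))" if j: "j \<in> {1..N}" for j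
  proof -
    have "(\<Sum>i\<in>{1..N}. v i * \<Lambda> i j) = (\<Sum>i\<in>{1..N}. c1 i * \<Lambda> i j) - (\<Sum>i\<in>{1..N}. c2 i * \<Lambda> i j)"
      unfolding sum_subtractf[symmetric] by (simp add: v_def c1_def c2_def algebra_simps)
    then show ?thesis unfolding L[OF j] by (simp add: omega_linear)
  qed
  \<comment> \<open>The degree selected by the negative part of column \<open>k\<close>, as in
    \<open>form_change\<close>. For the diagonal \<open>(b, e)\<close> the sign of the column is
    reversed, so \<open>P\<close> is \<open>D1\<close> although the new leading degree comes from
    \<open>D2\<close>.\<close>
  define P where "P = (if d k = (a, c) then D2 else D1)"
  define B' where "B' = (if d k = (a, c) then v else (\<lambda>i. - v i))"
  have B_col: "B l k = B' l" if l: "l \<in> {1..N}" for l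
  proof (rule compatible_pair_column[OF cp k l])
    fix j assume j: "j \<in> {1..N}"
    have ac_be: "(a, c) \<noteq> (b, e)" using ord by auto
    show "(\<Sum>i\<in>{1..N}. B' i * \<Lambda> i j) = of_bool (j = k)"
      using v_pair[OF j] orth[of "d j"] dS[OF j] dk[OF j] diag ac_be
      by (auto simp: B'_def sum_negf)
  qed
  define m1 m2 where "m1 = Q.monomial c1" and "m2 = Q.monomial c2"
  have mC: "m1 \<in> carrier D" "m2 \<in> carrier D" by (simp_all add: m1_def m2_def MC)
  define x' where "x' = mutate_cluster D (\<lambda>c. \<iota> (torus_scalar c)) r N k x B \<Lambda>"
  have x'_other: "x' i = x i" if "i \<noteq> k" for i using that by (simp add: x'_def mutate_cluster_def)
  \<comment> \<open>The sign of the column merely interchanges the two summands.\<close>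
  have x'_k: "x' k = m1 \<oplus> m2"
  proof -
    let ?m = "\<lambda>s. Q.monomial (\<lambda>i. max (s * B i k) 0 - of_bool (i = k))"
    have "x' k = ?m 1 \<oplus> ?m (- 1)" by (simp add: x'_def mutate_cluster_def cm)
    moreover have "?m 1 = m1 \<and> ?m (- 1) = m2 \<or> ?m 1 = m2 \<and> ?m (- 1) = m1"
    proof (cases "d k = (a, c)")
      case True
      then have "?m 1 = m1" "?m (- 1) = m2" unfolding m1_def m2_def
        by (auto intro!: Q.monomial_cong simp: B_col B'_def vmax c1_def c2_def)
      then show ?thesis by blast
    next
      case False
      then have "?m 1 = m2" "?m (- 1) = m1" unfolding m1_def m2_def
        by (auto intro!: Q.monomial_cong simp: B_col B'_def vmax c1_def c2_def)
      then show ?thesis by blast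
    qed
    ultimately show ?thesis using mC by (auto simp: R.a_comm)
  qed
  have pair_mon: "Q.monomial (\<lambda>i. I p i + I p' i) = sc (- omega (degp p) (degp p')) \<otimes> (\<iota> (arcp p) \<otimes> \<iota> (arcp p'))"
    if p: "is_side n S p" "is_side n S p'" for p p'
  proof -
    have "(\<Sum>i\<in>{1..N}. \<Sum>j\<in>{1..N}. I p i * I p' j * \<Lambda> i j) =
        (\<Sum>i\<in>{1..N}. I p i * (\<Sum>j\<in>{1..N}. I p' j * omega (degp (d i)) (degp (d j))))"
      unfolding sum_distrib_left by (intro sum.cong refl) (simp add: Lam)
    also have "\<dots> = omega (degp p) (degp p')"
      using I_sum[OF p(2), of "omega (degp (d _))"] I_sum[OF p(1), of "\<lambda>v. omega v (degp p')"]
      by (simp add: omega_linear)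
    finally have "\<iota> (arcp p) \<otimes> \<iota> (arcp p') = sc (omega (degp p) (degp p')) \<otimes> Q.monomial (\<lambda>i. I p i + I p' i)"
      using Q.monomial_mult[of "I p" "I p'"] I_mon p by (simp add: units_of_mult)
    then show ?thesis using sg.s_merge[OF Q.monomial_closed] by (simp add: units_of_mult units_of_one MC)
  qed
  have plus_k: "(\<lambda>i. c1 i + of_bool (i = k)) = (\<lambda>i. I (a, b) i + I (c, e) i)"
      "(\<lambda>i. c2 i + of_bool (i = k)) = (\<lambda>i. I (a, e) i + I (b, c) i)"
    by (simp_all add: c1_def c2_def)
  have arcs_unit: "\<iota> (arcp p) \<otimes> \<iota> (arcp p') \<in> carrier (units_of D)"
    if "is_side n S p" "is_side n S p'" for p p'
    using I_mon[OF that(1)] I_mon[OF that(2)] MU by (metis R.Units_m_closed units_of_carrier)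
  have right: "m1 \<otimes> x k = sc (omega D1 \<delta>k - omega (degp (a, b)) (degp (c, e))) \<otimes> (\<iota> (arcp (a, b)) \<otimes> \<iota> (arcp (c, e)))"
    "m2 \<otimes> x k = sc (omega D2 \<delta>k - omega (degp (a, e)) (degp (b, c))) \<otimes> (\<iota> (arcp (a, e)) \<otimes> \<iota> (arcp (b, c)))"
    using Q.monomial_mult_gen(1)[OF k, of c1] Q.monomial_mult_gen(1)[OF k, of c2]
      sg.s_merge[OF arcs_unit[OF sides(1,3)]] sg.s_merge[OF arcs_unit[OF sides(4,2)]]
    unfolding plus_k pair_mon[OF sides(1,3)] pair_mon[OF sides(4,2)] L[OF k] m1_def m2_def
    by (simp_all add: units_of_mult omega_linear \<delta>k_def)
  have left: "x k \<otimes> m1 = sc (omega \<delta>k D1 - omega (degp (a, b)) (degp (c, e))) \<otimes> (\<iota> (arcp (a, b)) \<otimes> \<iota> (arcp (c, e)))"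
    "x k \<otimes> m2 = sc (omega \<delta>k D2 - omega (degp (a, e)) (degp (b, c))) \<otimes> (\<iota> (arcp (a, e)) \<otimes> \<iota> (arcp (b, c)))"
    using Q.monomial_mult_gen(2)[OF k, of c1] Q.monomial_mult_gen(2)[OF k, of c2]
      sg.s_merge[OF arcs_unit[OF sides(1,3)]] sg.s_merge[OF arcs_unit[OF sides(4,2)]]
      omega_skew[of \<delta>k D1] omega_skew[of \<delta>k D2]
    unfolding plus_k pair_mon[OF sides(1,3)] pair_mon[OF sides(4,2)] L[OF k] m1_def m2_def
    by (simp_all add: units_of_mult omega_linear \<delta>k_def)
  have exp1: "ptolemy_exp1 a b c e = omega (degp (a, c)) D1 - omega (degp (a, b)) (degp (c, e))"
    and exp2: "ptolemy_exp2 a b c e = omega (degp (a, c)) D2 - omega (degp (a, e)) (degp (b, c))"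
    by (simp_all add: ptolemy_exp1_def ptolemy_exp2_def D1_def D2_def degp_def)
  have pt: "\<iota> (arcp (a, c)) \<otimes> \<iota> (arcp (b, e)) =
      sc (ptolemy_exp1 a b c e) \<otimes> (\<iota> (arcp (a, b)) \<otimes> \<iota> (arcp (c, e))) \<oplus>
      sc (ptolemy_exp2 a b c e) \<otimes> (\<iota> (arcp (a, e)) \<otimes> \<iota> (arcp (b, c)))"
    using arg_cong[OF ptolemy(1)[OF ord], of \<iota>]
    by (simp add: \<iota>_add \<iota>_mult arc_closed T_sub sc_def arcp_def)
  \<comment> \<open>Ptolemy's relation has \<open>(a, c)\<close> to the left of
    \<open>(b, e)\<close>, so the exchange relation is multiplied by \<open>x k\<close> from the
    left or from the right, depending on which diagonal is flipped, before \<open>x k\<close> is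
    cancelled.\<close>
  have x'_arc: "x' k = \<iota> (arcp f')"
  proof (cases "d k = (a, c)")
    case True
    then have f': "f' = (b, e)" using diag ord by auto
    have "x k \<otimes> x' k = x k \<otimes> m1 \<oplus> x k \<otimes> m2" unfolding x'_k using mC xC[OF k] by (simp add: R.r_distr)
    also have "\<dots> = \<iota> (arcp (a, c)) \<otimes> \<iota> (arcp (b, e))" unfolding left pt exp1 exp2 \<delta>k_def True ..
    finally have "x k \<otimes> x' k = x k \<otimes> \<iota> (arcp f')" by (simp add: x[OF k] True f')
    then show ?thesis using R.Units_l_cancel[OF xU[OF k], of "x' k" "\<iota> (arcp f')"] mC by (simp add: x'_k)
  next
    case False
    then have f': "d k = (b, e)" "f' = (a, c)" using diag by auto
    \<comment> \<open>The exponents for multiplication from the right match because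
      \<open>D2\<close> is the sum of the two diagonal degrees and is orthogonal to
      \<open>D1\<close>.\<close>
    have "omega D2 D1 = 0" "omega D1 D2 = 0" using orth_D by (simp_all add: omega_linear omega_skew[of D2 D1])
    then have "omega D1 \<delta>k = omega (degp (a, c)) D1" "omega D2 \<delta>k = omega (degp (a, c)) D2"
      using f'(1) omega_skew[of D1 "degp (b, e)"] omega_skew[of D2 "degp (b, e)"]
        omega_linear(1)[of "degp (a, c)" "degp (b, e)" D1] omega_linear(1)[of "degp (a, c)" "degp (b, e)" D2]
      unfolding D2'[symmetric] \<delta>k_def by simp_all
    then have "m1 \<otimes> x k \<oplus> m2 \<otimes> x k = \<iota> (arcp (a, c)) \<otimes> \<iota> (arcp (b, e))"
      unfolding right pt exp1 exp2 by simp
    then have eq: "x' k \<otimes> x k = \<iota> (arcp f') \<otimes> x k"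
      unfolding x'_k using mC xC[OF k] by (simp add: R.l_distr x[OF k] f')
    have cancel: "(z \<otimes> x k) \<otimes> inv (x k) = z" if "z \<in> carrier D" for z
      using that xC[OF k] xU[OF k] by (simp add: R.m_assoc)
    have "x' k = (x' k \<otimes> x k) \<otimes> inv (x k)" using cancel[of "x' k"] mC by (simp add: x'_k)
    also have "\<dots> = \<iota> (arcp f')" unfolding eq by (rule cancel) simp
    finally show ?thesis .
  qed
  have x'_comm: "x' k \<otimes> x j = sc (2 * omega (degp f') (degp (d j))) \<otimes> (x j \<otimes> x' k)"
    if j: "j \<in> {1..N}" "j \<noteq> k" for j
  proof -
    \<comment> \<open>The degrees of the exchange monomials differ by \<open>D1 - D2\<close>, which
      is orthogonal to \<open>degp (d j)\<close>; hence both commute with \<open>x j\<close> up to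
      the same scalar.\<close>
    have "omega (D1 - \<delta>k) (degp (d j)) = omega (D2 - \<delta>k) (degp (d j))"
      using orth_k[OF j] by (simp add: omega_linear)
    then have "m1 \<otimes> x j = sc (2 * omega (degp f') (degp (d j))) \<otimes> (x j \<otimes> m1)"
      "m2 \<otimes> x j = sc (2 * omega (degp f') (degp (d j))) \<otimes> (x j \<otimes> m2)"
      using Q.monomial_qcomm[OF j(1), of c1] Q.monomial_qcomm[OF j(1), of c2]
      unfolding L[OF j(1)] f'_deg m1_def m2_def by (simp_all add: sg.qcomm_def units_of_mult)
    then show ?thesis
      using mC xC[OF j(1)] R.Units_closed[OF sc_unit] by (simp add: x'_k R.l_distr R.r_distr)
  qed
  \<comment> \<open>\<open>W\<close> may differ from \<open>degp f'\<close> by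
    \<open>D1 - D2\<close>. The resulting forms agree all the same, since pairings with the
    remaining arcs coincide.\<close>
  define W where "W = P - \<delta>k"
  define \<delta>' where "\<delta>' = (\<lambda>i. if i = k then W else degp (d i))"
  have B0: "B k k = 0" using compatible_pairD(1)[OF cp k k] by simp
  \<comment> \<open>The functional \<open>g\<close> is kept arbitrary so that it can be
    \<open>omega\<close> in either argument.\<close>
  have row: "mutate_row N k B \<phi> i = g (\<delta>' i)"
    if i: "i \<in> {1..N}" and \<phi>: "\<And>s. s \<in> {1..N} \<Longrightarrow> \<phi> s = g (degp (d s))"
      and g: "\<And>u w. g (u + w) = g u + g w" "\<And>u w. g (u - w) = g u - g w"
    for i \<phi> and g :: "(nat \<Rightarrow>\<^sub>0 int) \<Rightarrow> int"
  proof (cases "i = k")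
    case False
    then show ?thesis using mutate_row_other[OF i False] \<phi>[OF i] by (simp add: \<delta>'_def)
  next
    case True
    have g0: "g 0 = 0" using g(2)[of 0 0] by simp
    have "(\<Sum>s\<in>{1..N}. max (- B s k) 0 * \<phi> s) = (\<Sum>s\<in>{1..N}. max (- B' s) 0 * g (degp (d s)))"
      by (intro sum.cong refl) (simp add: B_col \<phi>)
    also have "\<dots> = g P"
    proof (cases "d k = (a, c)")
      case True
      then show ?thesis using I_sum[where g=g, OF sides(4) g0] I_sum[where g=g, OF sides(2) g0]
        by (simp add: B'_def P_def vmax D2_def g distrib_right sum.distrib)
    next
      case False
      then show ?thesis using I_sum[where g=g, OF sides(1) g0] I_sum[where g=g, OF sides(3) g0]
        by (simp add: B'_def P_def vmax D1_def g distrib_right sum.distrib)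
    qed
    finally show ?thesis
      using mutate_row_k[where B=B and \<phi>=\<phi>, OF k B0] \<phi>[OF k] True by (simp add: \<delta>'_def W_def g \<delta>k_def)
  qed
  have form: "mutate_form N k B \<Lambda> i j = omega (\<delta>' i) (\<delta>' j)" if "i \<in> {1..N}" "j \<in> {1..N}" for i j
  proof -
    have "mutate_row N k B (\<Lambda> s) j = omega (degp (d s)) (\<delta>' j)" if "s \<in> {1..N}" for s
      using row[OF \<open>j \<in> {1..N}\<close>, of "\<Lambda> s" "omega (degp (d s))"] Lam[OF that] by (simp add: omega_linear)
    then show ?thesis unfolding mutate_form_row
      using row[OF \<open>i \<in> {1..N}\<close>, of "\<lambda>s. mutate_row N k B (\<Lambda> s) j" "\<lambda>u. omega u (\<delta>' j)"]
      by (simp add: omega_linear)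
  qed
  define d' where "d' = d(k := f')"
  have W: "omega W (degp (d j)) = omega (degp f') (degp (d j))" if "j \<in> {1..N}" "j \<noteq> k" for j
    using orth_k[OF that] by (simp add: W_def P_def f'_deg omega_linear)
  have Lam': "mutate_form N k B \<Lambda> i j = omega (degp (d' i)) (degp (d' j))" if ij: "i \<in> {1..N}" "j \<in> {1..N}" for i j
  proof -
    have "omega (degp (d i)) W = omega (degp (d i)) (degp f')" if "i \<noteq> k"
      unfolding omega_skew[of "degp (d i)" W] omega_skew[of "degp (d i)" "degp f'"] W[OF ij(1) that] ..
    then show ?thesis unfolding form[OF ij] using W[OF ij(2)] by (auto simp: \<delta>'_def d'_def)
  qed
  have skew': "mutate_form N k B \<Lambda> k j = - mutate_form N k B \<Lambda> j k" if "j \<in> {1..N}" for j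
    unfolding Lam'[OF k that] Lam'[OF that k] by (rule omega_skew)
  have comm': "x' i \<otimes> x' j = sc (2 * mutate_form N k B \<Lambda> i j) \<otimes> (x' j \<otimes> x' i)"
    if ij: "i \<in> {1..N}" "j \<in> {1..N}" for i j
  proof -
    have x'U: "x' i \<in> carrier (units_of D)" if "i \<in> {1..N}" for i
    proof (cases "i = k")
      case True
      have "is_edge n f'" using f'S(2) by (auto simp: triangulation_def)
      then show ?thesis using \<iota>_unit[OF arcp_closed arcp_nonzero] True x'_arc by (simp add: units_of_carrier)
    qed (use xU that x'_other in \<open>simp add: units_of_carrier\<close>)
    have qk: "sg.qcomm (2 * mutate_form N k B \<Lambda> k j) (x' k) (x' j)" if "j \<in> {1..N}" "j \<noteq> k" for j
      using x'_comm[OF that] Lam'[OF k that(1)] that x'_other by (simp add: sg.qcomm_def units_of_mult d'_def)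
    consider "i = k" "j = k" | "i = k" "j \<noteq> k" | "i \<noteq> k" "j = k" | "i \<noteq> k" "j \<noteq> k" by blast
    then have "sg.qcomm (2 * mutate_form N k B \<Lambda> i j) (x' i) (x' j)"
    proof cases
      case 1
      then show ?thesis using Lam'[OF k k] x'U[OF k] by (simp add: sg.qcomm_def)
    next
      case 2
      then show ?thesis using qk ij by simp
    next
      case 3
      then show ?thesis using sg.qcomm_sym[OF x'U[OF k] x'U[OF ij(1)] qk[OF ij(1)]] skew'[OF ij(1)] by simp
    next
      case 4
      then show ?thesis using xx[OF ij] Lam[OF ij] Lam'[OF ij] x'_other by (simp add: d'_def sg.qcomm_def units_of_mult)
    qed
    then show ?thesis by (simp add: sg.qcomm_def units_of_mult)
  qed
  have inj': "inj_on d' {1..N}" using inj dk k unfolding d'_def inj_on_def by (metis fun_upd_apply)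
  have img: "d' ` {1..N} = insert f' (S - {d k})"
  proof -
    have "S - {d k} = d ` ({1..N} - {k})"
      unfolding S_def using inj_on_image_set_diff[OF inj, of "{1..N}" "{k}"] k by simp
    then show ?thesis using k by (auto simp: d'_def)
  qed
  have arc': "x' i = \<iota> (arcp (d' i))" if "i \<in> {1..N}" for i
    using x'_arc x'_other x[OF that] by (simp add: d'_def)
  show ?thesis
    unfolding seed_ok_def N_def[symmetric] x'_def[symmetric] d'_def[symmetric] img
    by (intro conjI ballI inj' f'S(2) compatible_pair_mutate[OF cp k] Lam' comm' arc')
qed

section \<open>The cluster algebra as the image of the chain\<close>

abbreviation A where "A \<equiv> type_A_quantum_cluster_algebra n r D \<iota>"
abbreviation seeds where
  "seeds \<equiv> mutation_class D (\<lambda>c. \<iota> (torus_scalar c)) r (n - 1)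
    (\<lambda>i. \<iota> (torus_gen i), linear_quiver_matrix, linear_quiver_form)"
abbreviation variables where
  "variables \<equiv> cluster_variables D (\<lambda>c. \<iota> (torus_scalar c)) r (n - 1)
    (\<lambda>i. \<iota> (torus_gen i), linear_quiver_matrix, linear_quiver_form)"

lemma torus_gen_arc: "i \<in> {1..n - 1} \<Longrightarrow> torus_gen i = arc 0 (i + 1)"
proof -
  assume i: "i \<in> {1..n - 1}"
  have "tw (Poly_Mapping.single i 1) (Poly_Mapping.single i 1) = 0"
    using torus_twist_single[OF i i] by (simp add: tw_def)
  then show ?thesis unfolding arc_fan fan_single[OF i] by (simp add: torus_gen_def Mon_def)
qed

lemma initial_seed_ok:
  "seed_ok (\<lambda>i. (0, i + 1)) (\<lambda>i. \<iota> (torus_gen i)) linear_quiver_matrix linear_quiver_form"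
  unfolding seed_ok_def
proof (intro conjI ballI)
  show "inj_on (\<lambda>i. (0, i + 1)) {1..n - 1}" by (auto simp: inj_on_def)
  show "triangulation n ((\<lambda>i. (0, i + 1)) ` {1..n - 1})" by (rule fan_triangulation)
  have "linear_quiver_matrix j i = - linear_quiver_matrix i j" for i j
    by (simp add: linear_quiver_matrix_def)
  then show "compatible_pair (n - 1) linear_quiver_matrix linear_quiver_form"
    unfolding compatible_pair_def
    by (intro ballI conjI linear_quiver_form_inverse[OF n_odd] linear_quiver_form_skew)
next
  fix i assume "i \<in> {1..n - 1}"
  then show "\<iota> (torus_gen i) = \<iota> (arcp (0, i + 1))" by (simp add: arcp_def torus_gen_arc)
next
  fix i j assume ij: "i \<in> {1..n - 1}" "j \<in> {1..n - 1}"
  have deg: "degp (0, i + 1) = Poly_Mapping.single i 1" if "i \<in> {1..n - 1}" for i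
    using fan_single[OF that] by (simp add: degp_def arc_deg_def)
  show "linear_quiver_form i j = omega (degp (0, i + 1)) (degp (0, j + 1))"
    unfolding deg[OF ij(1)] deg[OF ij(2)] omega_gen[OF ij] ..
  let ?e = "\<lambda>i. Poly_Mapping.single i 1 :: nat \<Rightarrow>\<^sub>0 int"
  have gen: "torus_gen i = Mon 1 (?e i)" if "i \<in> {1..n - 1}" for i
    unfolding torus_gen_arc[OF that] arc_fan fan_single[OF that] ..
  have cl: "Mon 1 (?e i) \<in> carrier T" if "i \<in> {1..n - 1}" for i
    unfolding gen[OF that, symmetric] torus_gen_arc[OF that] by (rule arc_closed)
  have "Mon 1 (?e i) \<star> Mon 1 (?e j) =
      torus_scalar (r powi (2 * linear_quiver_form i j)) \<star> (Mon 1 (?e j) \<star> Mon 1 (?e i))"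
    using omega_gen[OF ij] omega_gen[OF ij(2,1)] linear_quiver_form_skew[of i j] r_nz
    by (simp add: Mon_mul scalar_Mon add.commute flip: power_int_add)
  then have "\<iota> (torus_gen i \<star> torus_gen j) =
      \<iota> (torus_scalar (r powi (2 * linear_quiver_form i j)) \<star> (torus_gen j \<star> torus_gen i))"
    unfolding gen[OF ij(1)] gen[OF ij(2)] by simp
  then show "\<iota> (torus_gen i) \<otimes> \<iota> (torus_gen j) =
      sc (2 * linear_quiver_form i j) \<otimes> (\<iota> (torus_gen j) \<otimes> \<iota> (torus_gen i))"
    unfolding gen[OF ij(1)] gen[OF ij(2)] sc_def using cl[OF ij(1)] cl[OF ij(2)]
    by (simp add: \<iota>_mult T_sub)
qed

lemma seeds_ok: "(x, B, \<Lambda>) \<in> seeds \<Longrightarrow> \<exists>d. seed_ok d x B \<Lambda>"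
proof (induction "(x, B, \<Lambda>)" arbitrary: x B \<Lambda> rule: mutation_class.induct)
  case initial
  then show ?case using initial_seed_ok by blast
next
  case (mutate x B \<Lambda> k)
  then obtain d where d: "seed_ok d x B \<Lambda>" by blast
  then have tri: "triangulation n (d ` {1..n - 1})" by (simp add: seed_ok_def)
  obtain u w where uw: "d k = (u, w)" by (cases "d k")
  then have "(u, w) \<in> d ` {1..n - 1}" using mutate(3) by (metis image_eqI)
  then obtain a b c e where quad: "quadrilateral n (d ` {1..n - 1}) a b c e" "(u, w) = (a, c) \<or> (u, w) = (b, e)"
    using quadrilateral_exists[OF tri] by blast
  then show ?case
    using seed_ok_mutate[OF d mutate(3) quad(1), of "(b, e)"] seed_ok_mutate[OF d mutate(3) quad(1), of "(a, c)"] uw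
    by auto
qed

lemma variables_subset: "variables \<subseteq> \<iota> ` chain n"
proof
  fix z assume "z \<in> variables"
  then obtain x B \<Lambda> i where z: "z = x i" "(x, B, \<Lambda>) \<in> seeds" "i \<in> {1..n - 1}"
    unfolding cluster_variables_def by blast
  obtain d where d: "seed_ok d x B \<Lambda>" using seeds_ok[OF z(2)] by blast
  then have "is_edge n (d i)" "x i = \<iota> (arcp (d i))"
    using z(3) unfolding seed_ok_def triangulation_def by blast+
  then show "z \<in> \<iota> ` chain n" unfolding z(1) arcp_def is_edge_def using arc_in_chain_n by auto
qed

text \<open>One mutation of the fan suffices: flipping \<open>(0, k + 1)\<close> in the
  quadrilateral with vertices 0, k, k + 1, k + 2 gives the short arc. For \<open>k = 0\<close> it is
  the first initial variable.\<close>

lemma short_arc_variable: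
  assumes "k < n" shows "\<iota> (arc k (k + 2)) \<in> variables"
proof (cases "k = 0")
  case True
  have "\<iota> (torus_gen 1) \<in> variables"
    unfolding cluster_variables_def using mutation_class.initial n_ge
    by (intro CollectI exI conjI) auto
  then show ?thesis using torus_gen_arc[of 1] n_ge True by simp
next
  case False
  let ?d = "\<lambda>i. (0::nat, i + 1)"
  have k: "k \<in> {1..n - 1}" using False assms by auto
  have side: "is_side n (?d ` {1..n - 1}) (0, m)" if "1 \<le> m" "m \<le> n + 1" for m
  proof (cases "m = 1 \<or> m = n + 1")
    case False
    then have "(0, m) = ?d (m - 1)" "m - 1 \<in> {1..n - 1}" using that by auto
    then show ?thesis unfolding is_side_def by blast
  qed (auto simp: is_side_def boundary_def)
  have "quadrilateral n (?d ` {1..n - 1}) 0 k (k + 1) (k + 2)"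
    unfolding quadrilateral_def using k side[of k] side[of "k + 2"] by (auto simp: is_side_def boundary_def)
  from seed_ok_mutate[OF initial_seed_ok k this, of "(k, k + 2)"]
  have "mutate_cluster D (\<lambda>c. \<iota> (torus_scalar c)) r (n - 1) k (\<lambda>i. \<iota> (torus_gen i))
      linear_quiver_matrix linear_quiver_form k = \<iota> (arc k (k + 2))"
    using k unfolding seed_ok_def by (simp add: arcp_def)
  then show ?thesis
    unfolding cluster_variables_def
    using mutation_class.mutate[OF mutation_class.initial k] k by (metis (mono_tags, lifting) mem_Collect_eq)
qed

lemma \<iota>_chain_subring: "subring (\<iota> ` chain n) D"
proof (rule R.subringI)
  note sub = is_subringD[OF chain_subring] and cc = subsetD[OF chain_carrier]
  show "\<iota> ` chain n \<subseteq> carrier D" using cc by auto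
  show "\<one> \<in> \<iota> ` chain n" using \<iota>_one sub(1) by (metis image_eqI)
  fix h1 assume "h1 \<in> \<iota> ` chain n"
  then obtain x where x: "x \<in> chain n" "h1 = \<iota> x" by blast
  show "\<ominus> h1 \<in> \<iota> ` chain n" using x sub(3)[OF x(1)] \<iota>_uminus[OF cc[OF x(1)]] by (metis image_eqI)
  fix h2 assume "h2 \<in> \<iota> ` chain n"
  then obtain y where y: "y \<in> chain n" "h2 = \<iota> y" by blast
  show "h1 \<otimes> h2 \<in> \<iota> ` chain n" "h1 \<oplus> h2 \<in> \<iota> ` chain n"
    using x y sub(4)[OF x(1) y(1)] sub(6)[OF x(1) y(1)] \<iota>_mult[OF cc cc, OF x(1) y(1)] \<iota>_add[OF cc cc, OF x(1) y(1)]
    by (metis image_eqI)+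
qed

text \<open>All cluster variables are arcs and lie in the image of the chain. Conversely the chain
  is contained in every subring with the scalars and the short arcs, which are cluster
  variables.\<close>

lemma carrier_A: "carrier A = \<iota> ` chain n"
proof -
  let ?G = "generate_ring D (range (\<lambda>c. \<iota> (torus_scalar c)) \<union> variables)"
  have sub: "range (\<lambda>c. \<iota> (torus_scalar c)) \<union> variables \<subseteq> \<iota> ` chain n"
    using variables_subset scalar_in_chain by auto
  then have subD: "range (\<lambda>c. \<iota> (torus_scalar c)) \<union> variables \<subseteq> carrier D"
    using chain_carrier by force
  have "?G \<subseteq> \<iota> ` chain n" by (rule R.generate_ring_min_subring1[OF subD \<iota>_chain_subring sub])
  moreover have "chain n \<subseteq> {x \<in> carrier T. \<iota> x \<in> ?G}"
  proof (rule chain_least)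
    note G = R.generate_ringE[OF subD refl]
    have gens: "\<iota> (torus_scalar c) \<in> ?G" "k < n \<Longrightarrow> \<iota> (arc k (k + 2)) \<in> ?G" for c k
      using G(2) short_arc_variable by blast+
    then show "range torus_scalar \<subseteq> {x \<in> carrier T. \<iota> x \<in> ?G}"
      "\<And>k. k < n \<Longrightarrow> arc k (k + 2) \<in> {x \<in> carrier T. \<iota> x \<in> ?G}"
      using arc_closed by auto
    show "is_subring {x \<in> carrier T. \<iota> x \<in> ?G}"
      unfolding is_subring_def
      using gens T_sub \<iota>_mult \<iota>_diff subringE(4,5,6,7)[OF G(1)]
      by (auto simp: a_minus_def)
  qed simp
  ultimately show ?thesis
    by (auto simp: type_A_quantum_cluster_algebra_def quantum_cluster_algebra_def)
qed

section \<open>Transfer of ideals along the embedding\<close>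

lemma A_simps: "monoid.mult A = monoid.mult D" "ring.add A = ring.add D" "ring.zero A = ring.zero D" "one A = one D"
  by (simp_all add: type_A_quantum_cluster_algebra_def quantum_cluster_algebra_def)

lemma ring_A: "ring A"
  using R.subring_is_ring[OF \<iota>_chain_subring] carrier_A
  by (simp add: type_A_quantum_cluster_algebra_def quantum_cluster_algebra_def)

text \<open>Ideals of the algebra are studied through their preimages in the torus, where the basis
  theorem and the commutator arguments live.\<close>

definition pullback :: "'d set \<Rightarrow> ((nat \<Rightarrow>\<^sub>0 int) \<Rightarrow>\<^sub>0 'k) set" where
  "pullback I = {x \<in> chain n. \<iota> x \<in> I}"

lemma pullback_image:
  assumes "additive_subgroup I A" shows "I = \<iota> ` pullback I"
  using additive_subgroup.a_subset[OF assms] by (auto simp: pullback_def carrier_A)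

lemma pullback_diff:
  assumes "additive_subgroup I A" "x \<in> pullback I" "y \<in> pullback I"
  shows "x - y \<in> pullback I"
proof -
  interpret additive_subgroup I A by (rule assms)
  interpret AR: ring A by (rule ring_A)
  have xy: "x \<in> chain n" "y \<in> chain n" "\<iota> x \<in> I" "\<iota> y \<in> I" using assms(2,3) by (auto simp: pullback_def)
  have "x - y \<in> chain n" using xy is_subringD(5)[OF chain_subring] by blast
  moreover have "\<iota> (x - y) \<oplus>\<^bsub>A\<^esub> \<iota> y = \<iota> x"
    using xy chain_carrier T_sub(5) by (simp add: A_simps subset_iff flip: \<iota>_add)
  then have "\<iota> (x - y) = \<iota> x \<ominus>\<^bsub>A\<^esub> \<iota> y"
    using xy \<open>x - y \<in> chain n\<close> carrier_A
    by (metis AR.add.inv_solve_right' AR.minus_eq image_eqI)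
  then have "\<iota> (x - y) \<in> I" using xy a_closed a_inv_closed by (simp add: AR.minus_eq)
  ultimately show ?thesis by (simp add: pullback_def)
qed

lemma pullback_mult:
  assumes "x \<in> chain n" "y \<in> chain n" "\<iota> x \<otimes>\<^bsub>A\<^esub> \<iota> y \<in> I"
  shows "x \<star> y \<in> pullback I"
  using assms chain_carrier is_subringD(6)[OF chain_subring] by (auto simp: pullback_def A_simps \<iota>_mult subset_iff)

lemma pullback_zero:
  assumes "additive_subgroup I A" shows "0 \<in> pullback I"
  using additive_subgroup.zero_closed[OF assms] is_subringD(2)[OF chain_subring]
  by (simp add: pullback_def \<iota>_zero A_simps)

lemma pullback_left_ideal:
  assumes "left_ideal I A" shows "is_left_ideal (chain n) (pullback I)"
  unfolding is_left_ideal_def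
proof (intro conjI ballI)
  have I: "additive_subgroup I A" and mul: "\<And>x a. x \<in> carrier A \<Longrightarrow> a \<in> I \<Longrightarrow> x \<otimes>\<^bsub>A\<^esub> a \<in> I"
    using assms by (auto simp: left_ideal_def)
  show "0 \<in> pullback I" by (rule pullback_zero[OF I])
  show "x - y \<in> pullback I" if "x \<in> pullback I" "y \<in> pullback I" for x y by (rule pullback_diff[OF I that])
  show "c \<star> x \<in> pullback I" if "c \<in> chain n" "x \<in> pullback I" for c x
    using that mul by (intro pullback_mult) (auto simp: pullback_def carrier_A)
qed (auto simp: pullback_def)

lemma pullback_right_ideal:
  assumes "right_ideal I A" shows "total_ring.is_left_ideal (\<lambda>x y. y \<star> x) (chain n) (pullback I)"
  unfolding total_ring.is_left_ideal_def[OF opposite]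
proof (intro conjI ballI)
  have I: "additive_subgroup I A" and mul: "\<And>x a. x \<in> carrier A \<Longrightarrow> a \<in> I \<Longrightarrow> a \<otimes>\<^bsub>A\<^esub> x \<in> I"
    using assms by (auto simp: right_ideal_def)
  show "0 \<in> pullback I" by (rule pullback_zero[OF I])
  show "x - y \<in> pullback I" if "x \<in> pullback I" "y \<in> pullback I" for x y by (rule pullback_diff[OF I that])
  show "x \<star> c \<in> pullback I" if "c \<in> chain n" "x \<in> pullback I" for c x
    using that mul by (intro pullback_mult) (auto simp: pullback_def carrier_A)
qed (auto simp: pullback_def)

text \<open>\<open>P\<close> and \<open>Q\<close> stand for the left or the right version of being
  an ideal, in the algebra and in the chain, so one transfer serves both sides. An ideal is
  recovered as the image of its preimage.\<close>

lemma pullback_generators: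
  assumes I: "P I" and P: "\<forall>J. P J \<longrightarrow> additive_subgroup J A \<and> Q (pullback J)"
    and G: "finite G" "G \<subseteq> pullback I" "\<forall>J. Q J \<longrightarrow> G \<subseteq> J \<longrightarrow> pullback I \<subseteq> J"
  shows "\<exists>H\<subseteq>carrier A. finite H \<and> I = \<Inter> {J. P J \<and> H \<subseteq> J}"
proof (intro exI[of _ "\<iota> ` G"] conjI)
  show "\<iota> ` G \<subseteq> carrier A" using G(2) by (auto simp: pullback_def carrier_A)
  show "finite (\<iota> ` G)" using G(1) by simp
  have "I \<subseteq> J" if J: "P J" "\<iota> ` G \<subseteq> J" for J
  proof -
    have "G \<subseteq> pullback J" using J(2) G(2) by (auto simp: pullback_def)
    then have "pullback I \<subseteq> pullback J" using G(3) P J(1) by blast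
    then show ?thesis using pullback_image P J(1) I by (metis image_mono)
  qed
  moreover have "\<iota> ` G \<subseteq> I" using G(2) by (auto simp: pullback_def)
  ultimately show "I = \<Inter> {J. P J \<and> \<iota> ` G \<subseteq> J}" using I by blast
qed

lemma left_noetherian_A: "left_noetherian A"
  unfolding left_noetherian_def
proof (intro conjI allI impI ring_A)
  fix I assume I: "left_ideal I A"
  have P: "\<forall>J. left_ideal J A \<longrightarrow> additive_subgroup J A \<and> is_left_ideal (chain n) (pullback J)"
    using pullback_left_ideal by (simp add: left_ideal_def)
  obtain G where "finite G" "G \<subseteq> pullback I"
      "\<forall>J. is_left_ideal (chain n) J \<longrightarrow> G \<subseteq> J \<longrightarrow> pullback I \<subseteq> J"
    using chain_noetherian[OF order_refl] P I unfolding is_left_noetherian_def by blast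
  then show "\<exists>H\<subseteq>carrier A. finite H \<and> I = \<Inter> {J. left_ideal J A \<and> H \<subseteq> J}"
    by (rule pullback_generators[where P = "\<lambda>J. left_ideal J A" and Q = "is_left_ideal (chain n)", OF I P])
qed

lemma right_noetherian_A: "right_noetherian A"
  unfolding right_noetherian_def
proof (intro conjI allI impI ring_A)
  interpret opp: total_ring "\<lambda>x y. y \<star> x" "torus_scalar 1" by (rule opposite)
  fix I assume I: "right_ideal I A"
  have P: "\<forall>J. right_ideal J A \<longrightarrow> additive_subgroup J A \<and> opp.is_left_ideal (chain n) (pullback J)"
    using pullback_right_ideal by (simp add: right_ideal_def)
  obtain G where "finite G" "G \<subseteq> pullback I"
      "\<forall>J. opp.is_left_ideal (chain n) J \<longrightarrow> G \<subseteq> J \<longrightarrow> pullback I \<subseteq> J"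
    using chain_noetherian[OF order_refl] P I unfolding is_right_noetherian_def opp.is_left_noetherian_def by blast
  then show "\<exists>H\<subseteq>carrier A. finite H \<and> I = \<Inter> {J. right_ideal J A \<and> H \<subseteq> J}"
    by (rule pullback_generators[where P = "\<lambda>J. right_ideal J A" and Q = "opp.is_left_ideal (chain n)", OF I P])
qed

lemma simple_ring_A:
  assumes generic: "\<forall>m::nat. m > 0 \<longrightarrow> q ^ m \<noteq> 1"
  shows "simple_ring A"
  unfolding simple_ring_def
proof (intro conjI allI impI ring_A)
  show "\<one>\<^bsub>A\<^esub> \<noteq> \<zero>\<^bsub>A\<^esub>" using division_ring by (simp add: A_simps is_division_ring_def)
  fix I assume "ideal I A"
  then interpret ideal I A .
  show "I = {\<zero>\<^bsub>A\<^esub>} \<or> I = carrier A"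
  proof (cases "I = {\<zero>\<^bsub>A\<^esub>}")
    case False
    then have "\<exists>z\<in>I. z \<noteq> \<zero>\<^bsub>A\<^esub>" using zero_closed by auto
    then obtain z where z: "z \<in> I" "z \<noteq> \<zero>\<^bsub>A\<^esub>" by blast
    have "z \<in> \<iota> ` pullback I"
      using equalityD1[OF pullback_image[OF additive_subgroup_axioms]] z(1) by (rule subsetD)
    then obtain f where f: "f \<in> pullback I" "z = \<iota> f" by blast
    have "f \<noteq> 0" using z(2) f(2) by (auto simp: \<iota>_zero A_simps)
    moreover have "c \<star> x \<in> pullback I" if "c \<in> chain n" "x \<in> pullback I" for c x
      using that I_l_closed by (intro pullback_mult) (auto simp: pullback_def carrier_A)
    moreover have "x \<star> c \<in> pullback I" if "c \<in> chain n" "x \<in> pullback I" for c x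
      using that I_r_closed by (intro pullback_mult) (auto simp: pullback_def carrier_A)
    moreover have "pullback I \<subseteq> carrier T" using chain_carrier by (auto simp: pullback_def)
    ultimately have "torus_scalar 1 \<in> pullback I"
      using I_trivial[OF generic] pullback_diff[OF additive_subgroup_axioms] f(1) by blast
    then have "\<one>\<^bsub>A\<^esub> \<in> I" using \<iota>_one by (simp add: pullback_def A_simps)
    then show ?thesis using one_imp_carrier by blast
  qed blast
qed

end

theorem corollary6p2:
  fixes n :: nat
    and q r :: "'k::alg_closed_field"
    and D :: "('d, 'm) ring_scheme"
    and \<iota> :: "((nat \<Rightarrow>\<^sub>0 int) \<Rightarrow>\<^sub>0 'k) \<Rightarrow> 'd"
  assumes "n \<ge> 3" and "odd n"
    and "q \<noteq> 0" and "\<forall>m::nat. m > 0 \<longrightarrow> q ^ m \<noteq> 1"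
    and "r ^ 2 = q"
    and "division_ring_of_fractions (quantum_torus (n - 1) q linear_quiver_form) D \<iota>"
  shows "simple_ring (type_A_quantum_cluster_algebra n r D \<iota>) \<and>
    right_noetherian (type_A_quantum_cluster_algebra n r D \<iota>) \<and>
    left_noetherian (type_A_quantum_cluster_algebra n r D \<iota>)"
proof -
  interpret type_A_torus n q r using assms(1-3,5) by unfold_locales
  interpret type_A_fractions n q r D \<iota>
    by unfold_locales (use assms(6) in \<open>simp only: T_def\<close>)
  show ?thesis using simple_ring_A[OF assms(4)] right_noetherian_A left_noetherian_A by blast
qed

end
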